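(* Let $R$ be a strong preordered ring in $\mathscr V$, and suppose that $\mathscr V$ has a generating class $\mathscr G$ such that for each object $V\in\mathscr G$, the preordered ring $\mathscr V(V,R)$ in $\mathrm{Set}$ is a firmly archimedean preordered $\mathbb D$-algebra. Then the theory $\mathrm{Mat}_{R_+}^{\mathrm{aff}}$ of left $R$-convex spaces and the theory $\mathrm{Mat}_{R_+^{\mathrm{op}}}^*$ of pointed right $R_+$-modules are commutants of each other over $\underline{\mathscr V}_{R_+}$.
   Context: $\mathscr V$ is a locally small cartesian closed category with equalizers, countable colimits, and intersections of countable families of strong subobjects; $\underline{\mathscr V}$ is $\mathscr V$ as a $\mathscr V$-category, with internal homs $\underline{\mathscr V}(V,W)$. Algebraic formulas below are to be read for generalized elements. \emph{Theories.} A theory (discretely finitary, enriched in $\mathscr V$) is a $\mathscr V$-category $\mathscr T$ whose objects are the natural numbers, equipped for each $n$ with morphisms $\pi_i:n\to1$ ($1\le i\le n$) exhibiting $n$ as a conical ($\mathscr V$-enriched) $n$-th power of $1$, with $\pi_1=\mathrm{id}$ if $n=1$. Morphisms of theories are identity-on-objects $\mathscr V$-functors preserving the designated $\pi_i$; $\mathrm{Th}$ is the resulting category. A $\mathscr T$-algebra is a $\mathscr V$-functor $A:\mathscr T\to\underline{\mathscr V}$ preserving conical finite powers, with carrier $|A|=A(1)$; it is normal if it sends the designated power $n$ of $1$ to the designated power $|A|^n$. $\mathscr T\text{-Alg}$ is the $\mathscr V$-category of $\mathscr T$-algebras, with hom-objects the objects of $\mathscr V$-natural transformations; limits in it are pointwise.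 \emph{Commutants.} For $X\in\mathscr V$, the full theory $\underline{\mathscr V}_X$ has $\underline{\mathscr V}_X(n,m)=\underline{\mathscr V}(X^n,X^m)$, composition as in $\underline{\mathscr V}$, and the product projections as designated $\pi_i$. A theory over $\underline{\mathscr V}_X$ is a theory $\mathscr T$ with a morphism $A:\mathscr T\to\underline{\mathscr V}_X$; it amounts to a $\mathscr T$-algebra $n\mapsto X^n$ with carrier $X$, also called $A$. Its commutant $\mathscr T^\perp$ is the theory with $\mathscr T^\perp(n,m)=\mathscr T\text{-Alg}(A^n,A^m)$, with composition as in $\mathscr T\text{-Alg}$; the forgetful morphisms $\mathscr T\text{-Alg}(A^n,A^m)\hookrightarrow\underline{\mathscr V}(X^n,X^m)$ make $\mathscr T^\perp$ a theory over $\underline{\mathscr V}_X$. Theories $\mathscr T,\mathscr U$ over $\underline{\mathscr V}_X$ are commutants of one another if $\mathscr T\cong\mathscr U^\perp$ and $\mathscr U\cong\mathscr T^\perp$ in $\mathrm{Th}/\underline{\mathscr V}_X$. \emph{Rigs.} A rig in $\mathscr V$ is an object $P$ with a commutative monoid structure $(+,0)$ and a monoid structure $(\bullet,1)$ in $\mathscr V$ such that $\bullet$ preserves $+$ and $0$ in each variable separately; it is a ring if $(P,+,0)$ is an abelian group in $\mathscr V$. $P^{\mathrm{op}}$ has reversed multiplication, and right $P$-modules are left $P^{\mathrm{op}}$-modules. \emph{Preordered rings.} A preordered ring in $\mathscr V$ is a ring $R$ in $\mathscr V$ with a sub-rig $R_+\hookrightarrow R$ (its positive part); it is strong if $R_+\hookrightarrow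 R$ is a strong monomorphism. For $V\in\mathscr V$, $\mathscr V(V,R)$ is a preordered ring in $\mathrm{Set}$ with positive part the set of morphisms $V\to R$ factoring through $R_+$. In a preordered ring $Q$ in $\mathrm{Set}$, $r\le s$ means $s-r\in Q_+$. $Q$ is archimedean if for every $r\in Q$, whenever $\{nr\mid n\in\mathbb N\}$ has an upper bound, $r\le0$; it is firmly archimedean if moreover for every $s\in Q_+$ there is $n\in\mathbb N$ with $s\le n\cdot1$. $\mathbb D$ is the ring of dyadic rationals with its usual order; $Q$ is a preordered $\mathbb D$-algebra if there is a monotone ring homomorphism $\mathbb D\to Q$ (equivalently, $2$ is invertible in $Q$ with inverse in $Q_+$). \emph{Generating class.} A class $\mathscr G\subseteq\mathrm{ob}\,\mathscr V$ is generating if, for all $f,g:A\to B$ in $\mathscr V$, $f\cdot x=g\cdot x$ for all $G\in\mathscr G$ and $x:G\to A$ implies $f=g$. \emph{The theories, for a rig $P$ in $\mathscr V$ (here $P=R_+$).} $\mathrm{Mat}_P$ is the theory with $\mathrm{Mat}_P(n,m)=P^{m\times n}$, composition given by matrix multiplication, identities the identity matrices, and designated projections the standard basis row vectors. $\mathrm{Mat}_P^{\mathrm{aff}}$ is its subtheory in which $\mathrm{Mat}_P^{\mathrm{aff}}(n,m)\hookrightarrow P^{m\times n}$ is the equalizer expressing that each row sums to $1$. Its normal algebras are the left $P$-affine spaces; left $R$-convex spaces are by definition left $R_+$-affine spaces. It is a theory over $\underline{\mathscr V}_P$ via $a\mapsto\big(x\mapsto(\sum_ia_{ji}x_i)_j\big)$.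 A pointed right $P$-module is a right $P$-module $M$ in $\mathscr V$ with a morphism $*:1\to M$ in $\mathscr V$. Pointed right $P$-modules are the normal algebras of the theory $\mathrm{Mat}_{P^{\mathrm{op}}}^*$ with $\mathrm{Mat}_{P^{\mathrm{op}}}^*(n,m)=(P^{1+n})^m$, where $u=(u_0,\dots,u_n)\in P^{1+n}$ acts on $M$ as $x\mapsto *\,u_0+\sum_{i=1}^nx_iu_i:M^n\to M$; composition is by substitution: $(v\circ u)_{k0}=v_{k0}+\sum_ju_{j0}v_{kj}$, $(v\circ u)_{ki}=\sum_ju_{ji}v_{kj}$. It is a theory over $\underline{\mathscr V}_P$ via the pointed right $P$-module $(P,1)$, i.e. via the morphism sending $u\in P^{1+n}$ to $x\mapsto u_0+\sum_{i=1}^nx_iu_i$. *)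

theory Defs
  imports Complex_Main "HOL-Algebra.Ring"
begin

text \<open>Conventions. Hom-sets are HOL sets, so every category here is locally small. Finite families
  are indexed from 0, so that \<open>\<pi>\<^sub>1, \<dots>, \<pi>\<^sub>n\<close> are the projections with index
  \<open>0, \<dots>, n - 1\<close>. Identities between morphisms built from algebraic operations are stated
  for generalized elements \<open>W \<rightarrow> X\<close>.\<close>

section \<open>Categories\<close>

record ('o, 'a) cat =
  Obj :: "'o set"
  Arr :: "'a set"
  Dom :: "'a \<Rightarrow> 'o"
  Cod :: "'a \<Rightarrow> 'o"
  Idn :: "'o \<Rightarrow> 'a"
  Cmp :: "'a \<Rightarrow> 'a \<Rightarrow> 'a"  (infixr "\<cdot>\<index>" 70)

definition homs :: "('o, 'a, 'm) cat_scheme \<Rightarrow> 'o \<Rightarrow> 'o \<Rightarrow> 'a set" where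
  "homs C A B = {f \<in> Arr C. Dom C f = A \<and> Cod C f = B}"

locale category =
  fixes C :: "('o, 'a, 'm) cat_scheme" (structure)
  assumes Dom_Obj: "f \<in> Arr C \<Longrightarrow> Dom C f \<in> Obj C"
    and Cod_Obj: "f \<in> Arr C \<Longrightarrow> Cod C f \<in> Obj C"
    and Idn_homs: "A \<in> Obj C \<Longrightarrow> Idn C A \<in> homs C A A"
    and Cmp_homs: "\<lbrakk>f \<in> homs C A B; g \<in> homs C B D\<rbrakk> \<Longrightarrow> g \<cdot> f \<in> homs C A D"
    and Cmp_Idn: "f \<in> homs C A B \<Longrightarrow> f \<cdot> Idn C A = f"
    and Idn_Cmp: "f \<in> homs C A B \<Longrightarrow> Idn C B \<cdot> f = f"
    and Cmp_assoc: "\<lbrakk>f \<in> homs C A B; g \<in> homs C B D; h \<in> homs C D E\<rbrakk>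
      \<Longrightarrow> (h \<cdot> g) \<cdot> f = h \<cdot> (g \<cdot> f)"

definition is_iso :: "('o, 'a, 'm) cat_scheme \<Rightarrow> 'a \<Rightarrow> bool" where
  "is_iso C f \<longleftrightarrow> f \<in> Arr C \<and> (\<exists>g \<in> homs C (Cod C f) (Dom C f).
     g \<cdot>\<^bsub>C\<^esub> f = Idn C (Dom C f) \<and> f \<cdot>\<^bsub>C\<^esub> g = Idn C (Cod C f))"

definition is_mono :: "('o, 'a, 'm) cat_scheme \<Rightarrow> 'a \<Rightarrow> bool" where
  "is_mono C m \<longleftrightarrow> m \<in> Arr C \<and>
     (\<forall>W. \<forall>x \<in> homs C W (Dom C m). \<forall>y \<in> homs C W (Dom C m).
        m \<cdot>\<^bsub>C\<^esub> x = m \<cdot>\<^bsub>C\<^esub> y \<longrightarrow> x = y)"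

definition is_epi :: "('o, 'a, 'm) cat_scheme \<Rightarrow> 'a \<Rightarrow> bool" where
  "is_epi C e \<longleftrightarrow> e \<in> Arr C \<and>
     (\<forall>W. \<forall>x \<in> homs C (Cod C e) W. \<forall>y \<in> homs C (Cod C e) W.
        x \<cdot>\<^bsub>C\<^esub> e = y \<cdot>\<^bsub>C\<^esub> e \<longrightarrow> x = y)"

definition is_strong_mono :: "('o, 'a, 'm) cat_scheme \<Rightarrow> 'a \<Rightarrow> bool" where
  "is_strong_mono C m \<longleftrightarrow> is_mono C m \<and>
     (\<forall>e u v. is_epi C e \<and> u \<in> homs C (Dom C e) (Dom C m) \<and> v \<in> homs C (Cod C e) (Cod C m)
        \<and> m \<cdot>\<^bsub>C\<^esub> u = v \<cdot>\<^bsub>C\<^esub> e \<longrightarrow>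
        (\<exists>d \<in> homs C (Cod C e) (Dom C m). d \<cdot>\<^bsub>C\<^esub> e = u \<and> m \<cdot>\<^bsub>C\<^esub> d = v))"

definition factors_through :: "('o, 'a, 'm) cat_scheme \<Rightarrow> 'a \<Rightarrow> 'a \<Rightarrow> bool" where
  "factors_through C f m \<longleftrightarrow> (\<exists>h \<in> homs C (Dom C f) (Dom C m). m \<cdot>\<^bsub>C\<^esub> h = f)"

text \<open>The morphism \<open>h\<close> with \<open>m \<cdot> h = f\<close>, meaningful if \<open>f\<close> factors through the mono \<open>m\<close>.\<close>

definition factor :: "('o, 'a, 'm) cat_scheme \<Rightarrow> 'a \<Rightarrow> 'a \<Rightarrow> 'a" where
  "factor C m f = (THE h. h \<in> homs C (Dom C f) (Dom C m) \<and> m \<cdot>\<^bsub>C\<^esub> h = f)"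

definition is_equalizer :: "('o, 'a, 'm) cat_scheme \<Rightarrow> 'a \<Rightarrow> 'a \<Rightarrow> 'a \<Rightarrow> bool" where
  "is_equalizer C f g e \<longleftrightarrow> e \<in> Arr C \<and> Cod C e = Dom C f \<and> f \<cdot>\<^bsub>C\<^esub> e = g \<cdot>\<^bsub>C\<^esub> e \<and>
     (\<forall>W. \<forall>x \<in> homs C W (Dom C f). f \<cdot>\<^bsub>C\<^esub> x = g \<cdot>\<^bsub>C\<^esub> x \<longrightarrow>
        (\<exists>!h. h \<in> homs C W (Dom C e) \<and> e \<cdot>\<^bsub>C\<^esub> h = x))"

definition has_equalizers :: "('o, 'a, 'm) cat_scheme \<Rightarrow> bool" where
  "has_equalizers C \<longleftrightarrow> (\<forall>A B. \<forall>f \<in> homs C A B. \<forall>g \<in> homs C A B. \<exists>e. is_equalizer C f g e)"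

definition equalizer :: "('o, 'a, 'm) cat_scheme \<Rightarrow> 'a \<Rightarrow> 'a \<Rightarrow> 'a" where
  "equalizer C f g = (SOME e. is_equalizer C f g e)"

definition is_functor ::
  "('j, 'k, 'm) cat_scheme \<Rightarrow> ('o, 'a, 'n) cat_scheme \<Rightarrow> ('j \<Rightarrow> 'o) \<Rightarrow> ('k \<Rightarrow> 'a) \<Rightarrow> bool" where
  "is_functor J C Fo Fa \<longleftrightarrow>
     (\<forall>j \<in> Obj J. Fo j \<in> Obj C \<and> Fa (Idn J j) = Idn C (Fo j)) \<and>
     (\<forall>i j. \<forall>f \<in> homs J i j. Fa f \<in> homs C (Fo i) (Fo j)) \<and>
     (\<forall>i j k. \<forall>f \<in> homs J i j. \<forall>g \<in> homs J j k. Fa (g \<cdot>\<^bsub>J\<^esub> f) = Fa g \<cdot>\<^bsub>C\<^esub> Fa f)"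

definition is_cocone :: "('j, 'k, 'm) cat_scheme \<Rightarrow> ('o, 'a, 'n) cat_scheme \<Rightarrow>
    ('j \<Rightarrow> 'o) \<Rightarrow> ('k \<Rightarrow> 'a) \<Rightarrow> 'o \<Rightarrow> ('j \<Rightarrow> 'a) \<Rightarrow> bool" where
  "is_cocone J C Fo Fa L c \<longleftrightarrow> L \<in> Obj C \<and>
     (\<forall>j \<in> Obj J. c j \<in> homs C (Fo j) L) \<and>
     (\<forall>i j. \<forall>f \<in> homs J i j. c j \<cdot>\<^bsub>C\<^esub> Fa f = c i)"

definition is_colimit :: "('j, 'k, 'm) cat_scheme \<Rightarrow> ('o, 'a, 'n) cat_scheme \<Rightarrow>
    ('j \<Rightarrow> 'o) \<Rightarrow> ('k \<Rightarrow> 'a) \<Rightarrow> 'o \<Rightarrow> ('j \<Rightarrow> 'a) \<Rightarrow> bool" where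
  "is_colimit J C Fo Fa L c \<longleftrightarrow> is_cocone J C Fo Fa L c \<and>
     (\<forall>L' c'. is_cocone J C Fo Fa L' c' \<longrightarrow>
        (\<exists>!h. h \<in> homs C L L' \<and> (\<forall>j \<in> Obj J. h \<cdot>\<^bsub>C\<^esub> c j = c' j)))"

text \<open>Every countable category is isomorphic to one whose objects and arrows are natural numbers.\<close>

definition has_countable_colimits :: "('o, 'a, 'm) cat_scheme \<Rightarrow> bool" where
  "has_countable_colimits C \<longleftrightarrow> (\<forall>(J :: (nat, nat) cat) Fo Fa.
     category J \<and> is_functor J C Fo Fa \<longrightarrow> (\<exists>L c. is_colimit J C Fo Fa L c))"

definition is_intersection ::
  "('o, 'a, 'm) cat_scheme \<Rightarrow> 'o \<Rightarrow> 'i set \<Rightarrow> ('i \<Rightarrow> 'a) \<Rightarrow> 'a \<Rightarrow> bool" where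
  "is_intersection C X I m s \<longleftrightarrow> is_mono C s \<and> Cod C s = X \<and>
     (\<forall>i \<in> I. factors_through C s (m i)) \<and>
     (\<forall>W. \<forall>f \<in> homs C W X. (\<forall>i \<in> I. factors_through C f (m i)) \<longrightarrow> factors_through C f s)"

definition has_countable_strong_intersections :: "('o, 'a, 'm) cat_scheme \<Rightarrow> bool" where
  "has_countable_strong_intersections C \<longleftrightarrow> (\<forall>X \<in> Obj C. \<forall>(I :: nat set) m.
     (\<forall>i \<in> I. is_strong_mono C (m i) \<and> Cod C (m i) = X) \<longrightarrow> (\<exists>s. is_intersection C X I m s))"

definition is_generating_class :: "('o, 'a, 'm) cat_scheme \<Rightarrow> 'o set \<Rightarrow> bool" where
  "is_generating_class C \<G> \<longleftrightarrow> \<G> \<subseteq> Obj C \<and>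
     (\<forall>A B. \<forall>f \<in> homs C A B. \<forall>g \<in> homs C A B.
        (\<forall>G \<in> \<G>. \<forall>x \<in> homs C G A. f \<cdot>\<^bsub>C\<^esub> x = g \<cdot>\<^bsub>C\<^esub> x) \<longrightarrow> f = g)"

section \<open>Cartesian closed categories\<close>

text \<open>\<open>Prd [X\<^sub>0, \<dots>]\<close> is the designated product of a list of objects, \<open>Tup W [f\<^sub>0, \<dots>]\<close> the
  tupling of morphisms with domain \<open>W\<close>, \<open>Exp A B\<close> the internal hom from \<open>A\<close> to \<open>B\<close>, and
  \<open>Cur W A B\<close> the transposition of morphisms \<open>W \<times> A \<rightarrow> B\<close>. The product of a
  one-element list is the object itself, with identity projection: the full theory on an object is
  required to have \<open>\<pi>\<^sub>1 = id\<close> for \<open>n = 1\<close>.\<close>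

record ('o, 'a) ccc = "('o, 'a) cat" +
  Prd :: "'o list \<Rightarrow> 'o"
  Prj :: "'o list \<Rightarrow> nat \<Rightarrow> 'a"
  Tup :: "'o \<Rightarrow> 'a list \<Rightarrow> 'a"
  Exp :: "'o \<Rightarrow> 'o \<Rightarrow> 'o"
  Ev  :: "'o \<Rightarrow> 'o \<Rightarrow> 'a"
  Cur :: "'o \<Rightarrow> 'o \<Rightarrow> 'o \<Rightarrow> 'a \<Rightarrow> 'a"

locale cartesian_closed = category V for V :: "('o, 'a) ccc" (structure) +
  assumes Prd_Obj: "set Xs \<subseteq> Obj V \<Longrightarrow> Prd V Xs \<in> Obj V"
    and Prj_homs: "\<lbrakk>set Xs \<subseteq> Obj V; i < length Xs\<rbrakk> \<Longrightarrow> Prj V Xs i \<in> homs V (Prd V Xs) (Xs ! i)"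
    and Tup_homs: "\<lbrakk>W \<in> Obj V; set fs \<subseteq> Arr V; \<forall>f \<in> set fs. Dom V f = W\<rbrakk>
      \<Longrightarrow> Tup V W fs \<in> homs V W (Prd V (map (Cod V) fs))"
    and Prj_Tup: "\<lbrakk>W \<in> Obj V; set fs \<subseteq> Arr V; \<forall>f \<in> set fs. Dom V f = W; i < length fs\<rbrakk>
      \<Longrightarrow> Prj V (map (Cod V) fs) i \<cdot> Tup V W fs = fs ! i"
    and Tup_eta: "\<lbrakk>set Xs \<subseteq> Obj V; h \<in> homs V W (Prd V Xs)\<rbrakk>
      \<Longrightarrow> Tup V W (map (\<lambda>i. Prj V Xs i \<cdot> h) [0..<length Xs]) = h"
    and Prd_single: "X \<in> Obj V \<Longrightarrow> Prd V [X] = X"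
    and Prj_single: "X \<in> Obj V \<Longrightarrow> Prj V [X] 0 = Idn V X"
    and Exp_Obj: "\<lbrakk>A \<in> Obj V; B \<in> Obj V\<rbrakk> \<Longrightarrow> Exp V A B \<in> Obj V"
    and Ev_homs: "\<lbrakk>A \<in> Obj V; B \<in> Obj V\<rbrakk> \<Longrightarrow> Ev V A B \<in> homs V (Prd V [Exp V A B, A]) B"
    and Cur_homs: "\<lbrakk>W \<in> Obj V; A \<in> Obj V; B \<in> Obj V; f \<in> homs V (Prd V [W, A]) B\<rbrakk>
      \<Longrightarrow> Cur V W A B f \<in> homs V W (Exp V A B)"
    and Cur_beta: "\<lbrakk>W \<in> Obj V; A \<in> Obj V; B \<in> Obj V; f \<in> homs V (Prd V [W, A]) B\<rbrakk>
      \<Longrightarrow> Ev V A B \<cdot> Tup V (Prd V [W, A]) [Cur V W A B f \<cdot> Prj V [W, A] 0, Prj V [W, A] 1] = f"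
    and Cur_eta: "\<lbrakk>W \<in> Obj V; A \<in> Obj V; B \<in> Obj V; h \<in> homs V W (Exp V A B)\<rbrakk>
      \<Longrightarrow> Cur V W A B (Ev V A B \<cdot> Tup V (Prd V [W, A]) [h \<cdot> Prj V [W, A] 0, Prj V [W, A] 1]) = h"

definition One :: "('o, 'a) ccc \<Rightarrow> 'o" where
  "One V = Prd V []"

definition terminal_map :: "('o, 'a) ccc \<Rightarrow> 'o \<Rightarrow> 'a" where
  "terminal_map V W = Tup V W []"

definition pair :: "('o, 'a) ccc \<Rightarrow> 'a \<Rightarrow> 'a \<Rightarrow> 'a" where
  "pair V f g = Tup V (Dom V f) [f, g]"

definition tuple :: "('o, 'a) ccc \<Rightarrow> 'o \<Rightarrow> nat \<Rightarrow> (nat \<Rightarrow> 'a) \<Rightarrow> 'a" where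
  "tuple V W n f = Tup V W (map f [0..<n])"

definition vpow :: "('o, 'a) ccc \<Rightarrow> 'o \<Rightarrow> nat \<Rightarrow> 'o" where
  "vpow V X n = Prd V (replicate n X)"

definition vpow_prj :: "('o, 'a) ccc \<Rightarrow> 'o \<Rightarrow> nat \<Rightarrow> nat \<Rightarrow> 'a" where
  "vpow_prj V X n i = Prj V (replicate n X) i"

text \<open>The element \<open>1 \<rightarrow> Exp A B\<close> corresponding to \<open>f : A \<rightarrow> B\<close>.\<close>

definition name_of :: "('o, 'a) ccc \<Rightarrow> 'a \<Rightarrow> 'a" where
  "name_of V f = Cur V (One V) (Dom V f) (Cod V f) (f \<cdot>\<^bsub>V\<^esub> Prj V [One V, Dom V f] 1)"

section \<open>Enriched categories\<close>

text \<open>\<open>VComp a b c : VHom b c \<times> VHom a b \<rightarrow> VHom a c\<close>.\<close>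

record ('c, 'o, 'a) vcat =
  VOb :: "'c set"
  VHom :: "'c \<Rightarrow> 'c \<Rightarrow> 'o"
  VId :: "'c \<Rightarrow> 'a"
  VComp :: "'c \<Rightarrow> 'c \<Rightarrow> 'c \<Rightarrow> 'a"

text \<open>Composition of generalized elements \<open>x : W \<rightarrow> VHom b c\<close> and \<open>y : W \<rightarrow> VHom a b\<close>.\<close>

definition vcomp :: "('o, 'a) ccc \<Rightarrow> ('c, 'o, 'a, 'm) vcat_scheme \<Rightarrow>
    'c \<Rightarrow> 'c \<Rightarrow> 'c \<Rightarrow> 'a \<Rightarrow> 'a \<Rightarrow> 'a" where
  "vcomp V C a b c x y = VComp C a b c \<cdot>\<^bsub>V\<^esub> pair V x y"

text \<open>A global element \<open>u\<close>, regarded as a (constant) generalized element at stage \<open>W\<close>.\<close>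

definition at_stage :: "('o, 'a) ccc \<Rightarrow> 'o \<Rightarrow> 'a \<Rightarrow> 'a" where
  "at_stage V W u = u \<cdot>\<^bsub>V\<^esub> terminal_map V W"

definition is_vcat :: "('o, 'a) ccc \<Rightarrow> ('c, 'o, 'a, 'm) vcat_scheme \<Rightarrow> bool" where
  "is_vcat V C \<longleftrightarrow>
     (\<forall>a \<in> VOb C. \<forall>b \<in> VOb C. VHom C a b \<in> Obj V) \<and>
     (\<forall>a \<in> VOb C. VId C a \<in> homs V (One V) (VHom C a a)) \<and>
     (\<forall>a \<in> VOb C. \<forall>b \<in> VOb C. \<forall>c \<in> VOb C.
        VComp C a b c \<in> homs V (Prd V [VHom C b c, VHom C a b]) (VHom C a c)) \<and>
     (\<forall>a \<in> VOb C. \<forall>b \<in> VOb C. \<forall>W. \<forall>x \<in> homs V W (VHom C a b).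
        vcomp V C a a b x (at_stage V W (VId C a)) = x \<and>
        vcomp V C a b b (at_stage V W (VId C b)) x = x) \<and>
     (\<forall>a \<in> VOb C. \<forall>b \<in> VOb C. \<forall>c \<in> VOb C. \<forall>d \<in> VOb C. \<forall>W.
        \<forall>x \<in> homs V W (VHom C c d). \<forall>y \<in> homs V W (VHom C b c). \<forall>z \<in> homs V W (VHom C a b).
        vcomp V C a b d (vcomp V C b c d x y) z = vcomp V C a c d x (vcomp V C a b c y z))"

definition is_vfunctor :: "('o, 'a) ccc \<Rightarrow> ('c, 'o, 'a, 'm) vcat_scheme \<Rightarrow>
    ('d, 'o, 'a, 'n) vcat_scheme \<Rightarrow> ('c \<Rightarrow> 'd) \<Rightarrow> ('c \<Rightarrow> 'c \<Rightarrow> 'a) \<Rightarrow> bool" where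
  "is_vfunctor V C D Fo Fa \<longleftrightarrow>
     (\<forall>a \<in> VOb C. Fo a \<in> VOb D \<and> Fa a a \<cdot>\<^bsub>V\<^esub> VId C a = VId D (Fo a)) \<and>
     (\<forall>a \<in> VOb C. \<forall>b \<in> VOb C. Fa a b \<in> homs V (VHom C a b) (VHom D (Fo a) (Fo b))) \<and>
     (\<forall>a \<in> VOb C. \<forall>b \<in> VOb C. \<forall>c \<in> VOb C. \<forall>W.
        \<forall>x \<in> homs V W (VHom C b c). \<forall>y \<in> homs V W (VHom C a b).
        Fa a c \<cdot>\<^bsub>V\<^esub> vcomp V C a b c x y =
        vcomp V D (Fo a) (Fo b) (Fo c) (Fa b c \<cdot>\<^bsub>V\<^esub> x) (Fa a b \<cdot>\<^bsub>V\<^esub> y))"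

text \<open>\<open>V\<close> as a category enriched in itself.\<close>

definition self_enriched :: "('o, 'a) ccc \<Rightarrow> ('o, 'o, 'a) vcat" where
  "self_enriched V = \<lparr>
     VOb = Obj V,
     VHom = Exp V,
     VId = (\<lambda>A. name_of V (Idn V A)),
     VComp = (\<lambda>A B C.
       let H = Prd V [Exp V B C, Exp V A B];
           h = Prj V [H, A] 0; x = Prj V [H, A] 1;
           g = Prj V [Exp V B C, Exp V A B] 0 \<cdot>\<^bsub>V\<^esub> h;
           f = Prj V [Exp V B C, Exp V A B] 1 \<cdot>\<^bsub>V\<^esub> h
       in Cur V H A C (Ev V B C \<cdot>\<^bsub>V\<^esub> pair V g (Ev V A B \<cdot>\<^bsub>V\<^esub> pair V f x)))\<rparr>"

text \<open>The object \<open>p\<close> with \<open>\<pi> i : p \<rightarrow> a\<close> for \<open>i < n\<close> is a conical \<open>n\<close>-th power of \<open>a\<close> in \<open>C\<close>: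
  the comparison \<open>C(c, p) \<rightarrow> C(c, a)\<^sup>n\<close> is an isomorphism in \<open>V\<close> for every \<open>c\<close>.\<close>

definition is_conical_power :: "('o, 'a) ccc \<Rightarrow> ('c, 'o, 'a, 'm) vcat_scheme \<Rightarrow>
    'c \<Rightarrow> nat \<Rightarrow> 'c \<Rightarrow> (nat \<Rightarrow> 'a) \<Rightarrow> bool" where
  "is_conical_power V C a n p \<pi> \<longleftrightarrow> a \<in> VOb C \<and> p \<in> VOb C \<and>
     (\<forall>i < n. \<pi> i \<in> homs V (One V) (VHom C p a)) \<and>
     (\<forall>c \<in> VOb C. is_iso V (tuple V (VHom C c p) n
        (\<lambda>i. vcomp V C c p a (at_stage V (VHom C c p) (\<pi> i)) (Idn V (VHom C c p)))))"

text \<open>Families \<open>\<phi> c : E \<rightarrow> D(F c, G c)\<close> that are \<open>V\<close>-natural in \<open>c\<close>; for \<open>E = 1\<close> these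
  are the \<open>V\<close>-natural transformations. The object of \<open>V\<close>-natural transformations carries the
  universal such family.\<close>

definition is_vnatural :: "('o, 'a) ccc \<Rightarrow> ('c, 'o, 'a, 'm) vcat_scheme \<Rightarrow>
    ('d, 'o, 'a, 'n) vcat_scheme \<Rightarrow> ('c \<Rightarrow> 'd) \<times> ('c \<Rightarrow> 'c \<Rightarrow> 'a) \<Rightarrow>
    ('c \<Rightarrow> 'd) \<times> ('c \<Rightarrow> 'c \<Rightarrow> 'a) \<Rightarrow> 'o \<Rightarrow> ('c \<Rightarrow> 'a) \<Rightarrow> bool" where
  "is_vnatural V C D F G E \<phi> \<longleftrightarrow> E \<in> Obj V \<and>
     (\<forall>c \<in> VOb C. \<phi> c \<in> homs V E (VHom D (fst F c) (fst G c))) \<and>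
     (\<forall>c \<in> VOb C. \<forall>d \<in> VOb C. \<forall>W. \<forall>t \<in> homs V W E. \<forall>x \<in> homs V W (VHom C c d).
        vcomp V D (fst F c) (fst F d) (fst G d) (\<phi> d \<cdot>\<^bsub>V\<^esub> t) (snd F c d \<cdot>\<^bsub>V\<^esub> x) =
        vcomp V D (fst F c) (fst G c) (fst G d) (snd G c d \<cdot>\<^bsub>V\<^esub> x) (\<phi> c \<cdot>\<^bsub>V\<^esub> t))"

definition is_nat_object :: "('o, 'a) ccc \<Rightarrow> ('c, 'o, 'a, 'm) vcat_scheme \<Rightarrow>
    ('d, 'o, 'a, 'n) vcat_scheme \<Rightarrow> ('c \<Rightarrow> 'd) \<times> ('c \<Rightarrow> 'c \<Rightarrow> 'a) \<Rightarrow>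
    ('c \<Rightarrow> 'd) \<times> ('c \<Rightarrow> 'c \<Rightarrow> 'a) \<Rightarrow> 'o \<Rightarrow> ('c \<Rightarrow> 'a) \<Rightarrow> bool" where
  "is_nat_object V C D F G N \<nu> \<longleftrightarrow> is_vnatural V C D F G N \<nu> \<and>
     (\<forall>E \<phi>. is_vnatural V C D F G E \<phi> \<longrightarrow>
        (\<exists>!h. h \<in> homs V E N \<and> (\<forall>c \<in> VOb C. \<nu> c \<cdot>\<^bsub>V\<^esub> h = \<phi> c)))"

section \<open>Theories and their algebras\<close>

record ('o, 'a) vtheory = "(nat, 'o, 'a) vcat" +
  TPrj :: "nat \<Rightarrow> nat \<Rightarrow> 'a"

definition is_theory :: "('o, 'a) ccc \<Rightarrow> ('o, 'a) vtheory \<Rightarrow> bool" where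
  "is_theory V T \<longleftrightarrow> is_vcat V T \<and> VOb T = UNIV \<and>
     (\<forall>n. is_conical_power V T 1 n n (TPrj T n)) \<and> TPrj T 1 0 = VId T 1"

definition is_theory_morphism :: "('o, 'a) ccc \<Rightarrow> ('o, 'a) vtheory \<Rightarrow> ('o, 'a) vtheory \<Rightarrow>
    (nat \<Rightarrow> nat \<Rightarrow> 'a) \<Rightarrow> bool" where
  "is_theory_morphism V T S F \<longleftrightarrow> is_vfunctor V T S (\<lambda>n. n) F \<and>
     (\<forall>n. \<forall>i < n. F n 1 \<cdot>\<^bsub>V\<^esub> TPrj T n i = TPrj S n i)"

definition is_algebra :: "('o, 'a) ccc \<Rightarrow> ('o, 'a) vtheory \<Rightarrow>
    (nat \<Rightarrow> 'o) \<times> (nat \<Rightarrow> nat \<Rightarrow> 'a) \<Rightarrow> bool" where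
  "is_algebra V T A \<longleftrightarrow> is_vfunctor V T (self_enriched V) (fst A) (snd A) \<and>
     (\<forall>a n p \<pi>. is_conical_power V T a n p \<pi> \<longrightarrow>
        is_conical_power V (self_enriched V) (fst A a) n (fst A p) (\<lambda>i. snd A p a \<cdot>\<^bsub>V\<^esub> \<pi> i))"

text \<open>A chosen object of \<open>V\<close>-natural transformations between two algebras, its universal family,
  and the morphism into it induced by a natural family. These are meaningful when such an object
  exists; \<open>iso_over\<close> below asserts in particular that the commutants built from them are theories.\<close>

definition alg_nat :: "('o, 'a) ccc \<Rightarrow> ('o, 'a) vtheory \<Rightarrow> (nat \<Rightarrow> 'o) \<times> (nat \<Rightarrow> nat \<Rightarrow> 'a) \<Rightarrow>
    (nat \<Rightarrow> 'o) \<times> (nat \<Rightarrow> nat \<Rightarrow> 'a) \<Rightarrow> 'o \<times> (nat \<Rightarrow> 'a)" where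
  "alg_nat V T A B = (SOME p. is_nat_object V T (self_enriched V) A B (fst p) (snd p))"

definition alg_component :: "('o, 'a) ccc \<Rightarrow> ('o, 'a) vtheory \<Rightarrow>
    (nat \<Rightarrow> 'o) \<times> (nat \<Rightarrow> nat \<Rightarrow> 'a) \<Rightarrow> (nat \<Rightarrow> 'o) \<times> (nat \<Rightarrow> nat \<Rightarrow> 'a) \<Rightarrow> nat \<Rightarrow> 'a" where
  "alg_component V T A B = snd (alg_nat V T A B)"

definition alg_induced :: "('o, 'a) ccc \<Rightarrow> ('o, 'a) vtheory \<Rightarrow>
    (nat \<Rightarrow> 'o) \<times> (nat \<Rightarrow> nat \<Rightarrow> 'a) \<Rightarrow> (nat \<Rightarrow> 'o) \<times> (nat \<Rightarrow> nat \<Rightarrow> 'a) \<Rightarrow>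
    'o \<Rightarrow> (nat \<Rightarrow> 'a) \<Rightarrow> 'a" where
  "alg_induced V T A B E \<phi> = (THE h. h \<in> homs V E (fst (alg_nat V T A B)) \<and>
     (\<forall>k. alg_component V T A B k \<cdot>\<^bsub>V\<^esub> h = \<phi> k))"

definition alg_cat :: "('o, 'a) ccc \<Rightarrow> ('o, 'a) vtheory \<Rightarrow>
    ((nat \<Rightarrow> 'o) \<times> (nat \<Rightarrow> nat \<Rightarrow> 'a), 'o, 'a) vcat" where
  "alg_cat V T = \<lparr>
     VOb = {A. is_algebra V T A},
     VHom = (\<lambda>A B. fst (alg_nat V T A B)),
     VId = (\<lambda>A. alg_induced V T A A (One V) (\<lambda>k. VId (self_enriched V) (fst A k))),
     VComp = (\<lambda>A B C.
       let N = fst (alg_nat V T B C); M = fst (alg_nat V T A B)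
       in alg_induced V T A C (Prd V [N, M]) (\<lambda>k.
            vcomp V (self_enriched V) (fst A k) (fst B k) (fst C k)
              (alg_component V T B C k \<cdot>\<^bsub>V\<^esub> Prj V [N, M] 0)
              (alg_component V T A B k \<cdot>\<^bsub>V\<^esub> Prj V [N, M] 1)))\<rparr>"

text \<open>The pointwise power \<open>A\<^sup>n\<close>.\<close>

definition alg_pow :: "('o, 'a) ccc \<Rightarrow> ('o, 'a) vtheory \<Rightarrow> (nat \<Rightarrow> 'o) \<times> (nat \<Rightarrow> nat \<Rightarrow> 'a) \<Rightarrow>
    nat \<Rightarrow> (nat \<Rightarrow> 'o) \<times> (nat \<Rightarrow> nat \<Rightarrow> 'a)" where
  "alg_pow V T A n =
     (\<lambda>k. vpow V (fst A k) n,
      \<lambda>k l. let D = VHom T k l; Y = vpow V (fst A k) n; W = Prd V [D, Y]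
        in Cur V D Y (vpow V (fst A l) n) (tuple V W n (\<lambda>i.
             Ev V (fst A k) (fst A l) \<cdot>\<^bsub>V\<^esub>
               pair V (snd A k l \<cdot>\<^bsub>V\<^esub> Prj V [D, Y] 0)
                      (vpow_prj V (fst A k) n i \<cdot>\<^bsub>V\<^esub> Prj V [D, Y] 1))))"

section \<open>Commutants\<close>

definition full_theory :: "('o, 'a) ccc \<Rightarrow> 'o \<Rightarrow> ('o, 'a) vtheory" where
  "full_theory V X = \<lparr>
     VOb = UNIV,
     VHom = (\<lambda>n m. VHom (self_enriched V) (vpow V X n) (vpow V X m)),
     VId = (\<lambda>n. VId (self_enriched V) (vpow V X n)),
     VComp = (\<lambda>n m k. VComp (self_enriched V) (vpow V X n) (vpow V X m) (vpow V X k)),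
     TPrj = (\<lambda>n i. name_of V (vpow_prj V X n i))\<rparr>"

definition is_theory_over :: "('o, 'a) ccc \<Rightarrow> 'o \<Rightarrow> ('o, 'a) vtheory \<Rightarrow>
    (nat \<Rightarrow> nat \<Rightarrow> 'a) \<Rightarrow> bool" where
  "is_theory_over V X T A \<longleftrightarrow> is_theory V T \<and> is_theory_morphism V T (full_theory V X) A"

definition over_algebra :: "('o, 'a) ccc \<Rightarrow> 'o \<Rightarrow> (nat \<Rightarrow> nat \<Rightarrow> 'a) \<Rightarrow>
    (nat \<Rightarrow> 'o) \<times> (nat \<Rightarrow> nat \<Rightarrow> 'a)" where
  "over_algebra V X A = (\<lambda>n. vpow V X n, A)"

definition commutant :: "('o, 'a) ccc \<Rightarrow> 'o \<Rightarrow> ('o, 'a) vtheory \<Rightarrow> (nat \<Rightarrow> nat \<Rightarrow> 'a) \<Rightarrow>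
    ('o, 'a) vtheory" where
  "commutant V X T A = (let P = alg_pow V T (over_algebra V X A) in \<lparr>
     VOb = UNIV,
     VHom = (\<lambda>n m. VHom (alg_cat V T) (P n) (P m)),
     VId = (\<lambda>n. VId (alg_cat V T) (P n)),
     VComp = (\<lambda>n m k. VComp (alg_cat V T) (P n) (P m) (P k)),
     TPrj = (\<lambda>n i. alg_induced V T (P n) (P 1) (One V)
       (\<lambda>k. name_of V (vpow_prj V (vpow V X k) n i)))\<rparr>)"

text \<open>The component at \<open>1\<close>, a morphism \<open>T-Alg(A\<^sup>n, A\<^sup>m) \<rightarrow> Exp (X\<^sup>n) (X\<^sup>m)\<close>.\<close>

definition commutant_forget :: "('o, 'a) ccc \<Rightarrow> 'o \<Rightarrow> ('o, 'a) vtheory \<Rightarrow> (nat \<Rightarrow> nat \<Rightarrow> 'a) \<Rightarrow>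
    nat \<Rightarrow> nat \<Rightarrow> 'a" where
  "commutant_forget V X T A n m = (let P = alg_pow V T (over_algebra V X A) in
     alg_component V T (P n) (P m) 1)"

definition is_over_morphism :: "('o, 'a) ccc \<Rightarrow>
    ('o, 'a) vtheory \<times> (nat \<Rightarrow> nat \<Rightarrow> 'a) \<Rightarrow> ('o, 'a) vtheory \<times> (nat \<Rightarrow> nat \<Rightarrow> 'a) \<Rightarrow>
    (nat \<Rightarrow> nat \<Rightarrow> 'a) \<Rightarrow> bool" where
  "is_over_morphism V TA SB F \<longleftrightarrow> is_theory_morphism V (fst TA) (fst SB) F \<and>
     (\<forall>n m. snd SB n m \<cdot>\<^bsub>V\<^esub> F n m = snd TA n m)"

definition iso_over :: "('o, 'a) ccc \<Rightarrow> 'o \<Rightarrow>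
    ('o, 'a) vtheory \<times> (nat \<Rightarrow> nat \<Rightarrow> 'a) \<Rightarrow> ('o, 'a) vtheory \<times> (nat \<Rightarrow> nat \<Rightarrow> 'a) \<Rightarrow> bool" where
  "iso_over V X TA SB \<longleftrightarrow>
     is_theory_over V X (fst TA) (snd TA) \<and> is_theory_over V X (fst SB) (snd SB) \<and>
     (\<exists>F G. is_over_morphism V TA SB F \<and> is_over_morphism V SB TA G \<and>
        (\<forall>n m. G n m \<cdot>\<^bsub>V\<^esub> F n m = Idn V (VHom (fst TA) n m) \<and>
               F n m \<cdot>\<^bsub>V\<^esub> G n m = Idn V (VHom (fst SB) n m)))"

definition are_mutual_commutants :: "('o, 'a) ccc \<Rightarrow> 'o \<Rightarrow>
    ('o, 'a) vtheory \<times> (nat \<Rightarrow> nat \<Rightarrow> 'a) \<Rightarrow> ('o, 'a) vtheory \<times> (nat \<Rightarrow> nat \<Rightarrow> 'a) \<Rightarrow> bool" where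
  "are_mutual_commutants V X TA UB \<longleftrightarrow>
     iso_over V X TA (commutant V X (fst UB) (snd UB), commutant_forget V X (fst UB) (snd UB)) \<and>
     iso_over V X UB (commutant V X (fst TA) (snd TA), commutant_forget V X (fst TA) (snd TA))"

section \<open>Rigs and preordered rings\<close>

record ('o, 'a) rig =
  Rob :: 'o
  Radd :: 'a
  Rzero :: 'a
  Rmul :: 'a
  Rone :: 'a

definition gadd :: "('o, 'a) ccc \<Rightarrow> ('o, 'a) rig \<Rightarrow> 'a \<Rightarrow> 'a \<Rightarrow> 'a" where
  "gadd V P x y = Radd P \<cdot>\<^bsub>V\<^esub> pair V x y"

definition gmul :: "('o, 'a) ccc \<Rightarrow> ('o, 'a) rig \<Rightarrow> 'a \<Rightarrow> 'a \<Rightarrow> 'a" where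
  "gmul V P x y = Rmul P \<cdot>\<^bsub>V\<^esub> pair V x y"

definition gzero :: "('o, 'a) ccc \<Rightarrow> ('o, 'a) rig \<Rightarrow> 'o \<Rightarrow> 'a" where
  "gzero V P W = at_stage V W (Rzero P)"

definition gone :: "('o, 'a) ccc \<Rightarrow> ('o, 'a) rig \<Rightarrow> 'o \<Rightarrow> 'a" where
  "gone V P W = at_stage V W (Rone P)"

primrec gsum :: "('o, 'a) ccc \<Rightarrow> ('o, 'a) rig \<Rightarrow> 'o \<Rightarrow> nat \<Rightarrow> (nat \<Rightarrow> 'a) \<Rightarrow> 'a" where
  "gsum V P W 0 f = gzero V P W"
| "gsum V P W (Suc n) f = gadd V P (gsum V P W n f) (f n)"

definition is_rig :: "('o, 'a) ccc \<Rightarrow> ('o, 'a) rig \<Rightarrow> bool" where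
  "is_rig V P \<longleftrightarrow> Rob P \<in> Obj V \<and>
     Radd P \<in> homs V (Prd V [Rob P, Rob P]) (Rob P) \<and> Rzero P \<in> homs V (One V) (Rob P) \<and>
     Rmul P \<in> homs V (Prd V [Rob P, Rob P]) (Rob P) \<and> Rone P \<in> homs V (One V) (Rob P) \<and>
     (\<forall>W. \<forall>x \<in> homs V W (Rob P).
        gadd V P x (gzero V P W) = x \<and>
        gmul V P x (gone V P W) = x \<and> gmul V P (gone V P W) x = x \<and>
        gmul V P x (gzero V P W) = gzero V P W \<and> gmul V P (gzero V P W) x = gzero V P W) \<and>
     (\<forall>W. \<forall>x \<in> homs V W (Rob P). \<forall>y \<in> homs V W (Rob P). gadd V P x y = gadd V P y x) \<and>
     (\<forall>W. \<forall>x \<in> homs V W (Rob P). \<forall>y \<in> homs V W (Rob P). \<forall>z \<in> homs V W (Rob P).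
        gadd V P (gadd V P x y) z = gadd V P x (gadd V P y z) \<and>
        gmul V P (gmul V P x y) z = gmul V P x (gmul V P y z) \<and>
        gmul V P x (gadd V P y z) = gadd V P (gmul V P x y) (gmul V P x z) \<and>
        gmul V P (gadd V P x y) z = gadd V P (gmul V P x z) (gmul V P y z))"

definition is_ring :: "('o, 'a) ccc \<Rightarrow> ('o, 'a) rig \<Rightarrow> bool" where
  "is_ring V P \<longleftrightarrow> is_rig V P \<and> (\<exists>neg \<in> homs V (Rob P) (Rob P).
     \<forall>W. \<forall>x \<in> homs V W (Rob P). gadd V P x (neg \<cdot>\<^bsub>V\<^esub> x) = gzero V P W)"

definition is_rig_morphism :: "('o, 'a) ccc \<Rightarrow> ('o, 'a) rig \<Rightarrow> ('o, 'a) rig \<Rightarrow> 'a \<Rightarrow> bool" where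
  "is_rig_morphism V P Q f \<longleftrightarrow> f \<in> homs V (Rob P) (Rob Q) \<and>
     f \<cdot>\<^bsub>V\<^esub> Rzero P = Rzero Q \<and> f \<cdot>\<^bsub>V\<^esub> Rone P = Rone Q \<and>
     (\<forall>W. \<forall>x \<in> homs V W (Rob P). \<forall>y \<in> homs V W (Rob P).
        f \<cdot>\<^bsub>V\<^esub> gadd V P x y = gadd V Q (f \<cdot>\<^bsub>V\<^esub> x) (f \<cdot>\<^bsub>V\<^esub> y) \<and>
        f \<cdot>\<^bsub>V\<^esub> gmul V P x y = gmul V Q (f \<cdot>\<^bsub>V\<^esub> x) (f \<cdot>\<^bsub>V\<^esub> y))"

text \<open>A preordered ring \<open>R\<close> with positive part \<open>\<iota> : R\<^sub>+ \<rightarrow> R\<close>.\<close>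

definition is_preordered_ring ::
  "('o, 'a) ccc \<Rightarrow> ('o, 'a) rig \<Rightarrow> ('o, 'a) rig \<Rightarrow> 'a \<Rightarrow> bool" where
  "is_preordered_ring V R Rp \<iota> \<longleftrightarrow>
     is_ring V R \<and> is_rig V Rp \<and> is_rig_morphism V Rp R \<iota> \<and> is_mono V \<iota>"

definition is_strong_preordered_ring ::
  "('o, 'a) ccc \<Rightarrow> ('o, 'a) rig \<Rightarrow> ('o, 'a) rig \<Rightarrow> 'a \<Rightarrow> bool" where
  "is_strong_preordered_ring V R Rp \<iota> \<longleftrightarrow> is_preordered_ring V R Rp \<iota> \<and> is_strong_mono V \<iota>"

definition hom_ring :: "('o, 'a) ccc \<Rightarrow> 'o \<Rightarrow> ('o, 'a) rig \<Rightarrow> 'a ring" where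
  "hom_ring V W R = \<lparr>carrier = homs V W (Rob R), mult = gmul V R, one = gone V R W,
     zero = gzero V R W, add = gadd V R\<rparr>"

definition hom_pos :: "('o, 'a) ccc \<Rightarrow> 'o \<Rightarrow> ('o, 'a) rig \<Rightarrow> 'a \<Rightarrow> 'a set" where
  "hom_pos V W R \<iota> = {f \<in> homs V W (Rob R). factors_through V f \<iota>}"

subsection \<open>Preordered rings in Set\<close>

definition set_preordered_ring :: "('b, 'm) ring_scheme \<Rightarrow> 'b set \<Rightarrow> bool" where
  "set_preordered_ring Q Qp \<longleftrightarrow> ring Q \<and> Qp \<subseteq> carrier Q \<and> \<zero>\<^bsub>Q\<^esub> \<in> Qp \<and> \<one>\<^bsub>Q\<^esub> \<in> Qp \<and>
     (\<forall>x \<in> Qp. \<forall>y \<in> Qp. x \<oplus>\<^bsub>Q\<^esub> y \<in> Qp \<and> x \<otimes>\<^bsub>Q\<^esub> y \<in> Qp)"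

definition ring_le :: "('b, 'm) ring_scheme \<Rightarrow> 'b set \<Rightarrow> 'b \<Rightarrow> 'b \<Rightarrow> bool" where
  "ring_le Q Qp r s \<longleftrightarrow> s \<ominus>\<^bsub>Q\<^esub> r \<in> Qp"

definition archimedean :: "('b, 'm) ring_scheme \<Rightarrow> 'b set \<Rightarrow> bool" where
  "archimedean Q Qp \<longleftrightarrow> (\<forall>r \<in> carrier Q.
     (\<exists>s \<in> carrier Q. \<forall>n :: nat. ring_le Q Qp (add_pow Q n r) s) \<longrightarrow> ring_le Q Qp r \<zero>\<^bsub>Q\<^esub>)"

definition firmly_archimedean :: "('b, 'm) ring_scheme \<Rightarrow> 'b set \<Rightarrow> bool" where
  "firmly_archimedean Q Qp \<longleftrightarrow> archimedean Q Qp \<and>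
     (\<forall>s \<in> Qp. \<exists>n :: nat. ring_le Q Qp s (add_pow Q n \<one>\<^bsub>Q\<^esub>))"

definition dyadic_ring :: "rat ring" where
  "dyadic_ring = \<lparr>carrier = {of_int a / 2 ^ k | (a :: int) (k :: nat). True},
     mult = (*), one = 1, zero = 0, add = (+)\<rparr>"

definition preordered_dyadic_algebra :: "('b, 'm) ring_scheme \<Rightarrow> 'b set \<Rightarrow> bool" where
  "preordered_dyadic_algebra Q Qp \<longleftrightarrow> set_preordered_ring Q Qp \<and>
     (\<exists>h \<in> ring_hom dyadic_ring Q. \<forall>x \<in> carrier dyadic_ring. \<forall>y \<in> carrier dyadic_ring.
        x \<le> y \<longrightarrow> ring_le Q Qp (h x) (h y))"

section \<open>Affine spaces and pointed modules\<close>

text \<open>The object \<open>P\<^bsup>m \<times> n\<^esup>\<close> is taken to be \<open>(P\<^sup>n)\<^sup>m\<close>, that is, matrices are lists of rows.\<close>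

definition mat_entry :: "('o, 'a) ccc \<Rightarrow> 'o \<Rightarrow> nat \<Rightarrow> nat \<Rightarrow> 'a \<Rightarrow> nat \<Rightarrow> nat \<Rightarrow> 'a" where
  "mat_entry V X m n a j i =
     vpow_prj V X n i \<cdot>\<^bsub>V\<^esub> (vpow_prj V (vpow V X n) m j \<cdot>\<^bsub>V\<^esub> a)"

definition mat_of :: "('o, 'a) ccc \<Rightarrow> 'o \<Rightarrow> nat \<Rightarrow> nat \<Rightarrow> (nat \<Rightarrow> nat \<Rightarrow> 'a) \<Rightarrow> 'a" where
  "mat_of V W m n a = tuple V W m (\<lambda>j. tuple V W n (\<lambda>i. a j i))"

definition gdelta :: "('o, 'a) ccc \<Rightarrow> ('o, 'a) rig \<Rightarrow> 'o \<Rightarrow> nat \<Rightarrow> nat \<Rightarrow> 'a" where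
  "gdelta V P W i j = (if i = j then gone V P W else gzero V P W)"

definition mat_theory :: "('o, 'a) ccc \<Rightarrow> ('o, 'a) rig \<Rightarrow> ('o, 'a) vtheory" where
  "mat_theory V P = (let H = (\<lambda>n m. vpow V (vpow V (Rob P) n) m) in \<lparr>
     VOb = UNIV,
     VHom = H,
     VId = (\<lambda>n. mat_of V (One V) n n (gdelta V P (One V))),
     VComp = (\<lambda>n m l.
       let W = Prd V [H m l, H n m];
           b = mat_entry V (Rob P) l m (Prj V [H m l, H n m] 0);
           a = mat_entry V (Rob P) m n (Prj V [H m l, H n m] 1)
       in mat_of V W l n (\<lambda>k i. gsum V P W m (\<lambda>j. gmul V P (b k j) (a j i)))),
     TPrj = (\<lambda>n i. mat_of V (One V) 1 n (\<lambda>_. gdelta V P (One V) i))\<rparr>)"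

definition aff_incl :: "('o, 'a) ccc \<Rightarrow> ('o, 'a) rig \<Rightarrow> nat \<Rightarrow> nat \<Rightarrow> 'a" where
  "aff_incl V P n m = (let W = VHom (mat_theory V P) n m;
       a = mat_entry V (Rob P) m n (Idn V W)
     in equalizer V (tuple V W m (\<lambda>j. gsum V P W n (a j))) (tuple V W m (\<lambda>j. gone V P W)))"

definition mat_aff :: "('o, 'a) ccc \<Rightarrow> ('o, 'a) rig \<Rightarrow> ('o, 'a) vtheory" where
  "mat_aff V P = (let H = (\<lambda>n m. Dom V (aff_incl V P n m)) in \<lparr>
     VOb = UNIV,
     VHom = H,
     VId = (\<lambda>n. factor V (aff_incl V P n n) (VId (mat_theory V P) n)),
     VComp = (\<lambda>n m l. factor V (aff_incl V P n l)
       (vcomp V (mat_theory V P) n m l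
         (aff_incl V P m l \<cdot>\<^bsub>V\<^esub> Prj V [H m l, H n m] 0)
         (aff_incl V P n m \<cdot>\<^bsub>V\<^esub> Prj V [H m l, H n m] 1))),
     TPrj = (\<lambda>n i. factor V (aff_incl V P n 1) (TPrj (mat_theory V P) n i))\<rparr>)"

definition mat_aff_over :: "('o, 'a) ccc \<Rightarrow> ('o, 'a) rig \<Rightarrow> nat \<Rightarrow> nat \<Rightarrow> 'a" where
  "mat_aff_over V P n m = (let H = VHom (mat_aff V P) n m; Y = vpow V (Rob P) n;
       W = Prd V [H, Y];
       a = mat_entry V (Rob P) m n (aff_incl V P n m \<cdot>\<^bsub>V\<^esub> Prj V [H, Y] 0);
       x = (\<lambda>i. vpow_prj V (Rob P) n i \<cdot>\<^bsub>V\<^esub> Prj V [H, Y] 1)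
     in Cur V H Y (vpow V (Rob P) m)
          (tuple V W m (\<lambda>j. gsum V P W n (\<lambda>i. gmul V P (a j i) (x i)))))"

text \<open>The theory of pointed right \<open>P\<close>-modules. An element of its hom-object from \<open>n\<close> to \<open>m\<close> has
  rows \<open>(u\<^sub>j\<^sub>0, u\<^sub>j\<^sub>1, \<dots>, u\<^sub>j\<^sub>n)\<close>; position \<open>0\<close> is the coefficient of the point, and
  the \<open>i\<close>-th variable (\<open>i < n\<close>) has its coefficient at position \<open>Suc i\<close>.\<close>

definition mat_op_pointed :: "('o, 'a) ccc \<Rightarrow> ('o, 'a) rig \<Rightarrow> ('o, 'a) vtheory" where
  "mat_op_pointed V P = (let H = (\<lambda>n m. vpow V (vpow V (Rob P) (1 + n)) m) in \<lparr>
     VOb = UNIV,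
     VHom = H,
     VId = (\<lambda>n. mat_of V (One V) n (1 + n) (\<lambda>j. gdelta V P (One V) (Suc j))),
     VComp = (\<lambda>n m l.
       let W = Prd V [H m l, H n m];
           v = mat_entry V (Rob P) l (1 + m) (Prj V [H m l, H n m] 0);
           u = mat_entry V (Rob P) m (1 + n) (Prj V [H m l, H n m] 1)
       in mat_of V W l (1 + n) (\<lambda>k i.
            let s = gsum V P W m (\<lambda>j. gmul V P (u j i) (v k (Suc j)))
            in if i = 0 then gadd V P (v k 0) s else s)),
     TPrj = (\<lambda>n i. mat_of V (One V) 1 (1 + n) (\<lambda>_. gdelta V P (One V) (Suc i)))\<rparr>)"

definition mat_op_pointed_over :: "('o, 'a) ccc \<Rightarrow> ('o, 'a) rig \<Rightarrow> nat \<Rightarrow> nat \<Rightarrow> 'a" where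
  "mat_op_pointed_over V P n m = (let H = VHom (mat_op_pointed V P) n m; Y = vpow V (Rob P) n;
       W = Prd V [H, Y];
       u = mat_entry V (Rob P) m (1 + n) (Prj V [H, Y] 0);
       x = (\<lambda>i. vpow_prj V (Rob P) n i \<cdot>\<^bsub>V\<^esub> Prj V [H, Y] 1)
     in Cur V H Y (vpow V (Rob P) m)
          (tuple V W m (\<lambda>j. gadd V P (u j 0)
             (gsum V P W n (\<lambda>i. gmul V P (x i) (u j (Suc i)))))))"

end

theory Submission
  imports Defs
begin

text \<open>Write \<open>U\<close> for the carrier \<open>R\<^sub>+\<close>. Both theories consist of operations on \<open>U\<close>: a matrix \<open>a\<close> with
  row sums \<open>1\<close> acts by \<open>x \<mapsto> (\<Sum>\<^sub>i a\<^sub>j\<^sub>i x\<^sub>i)\<^sub>j\<close>, and \<open>u\<close> acts by \<open>x \<mapsto> (u\<^sub>j\<^sub>0 + \<Sum>\<^sub>i x\<^sub>i u\<^sub>j\<^sub>i)\<^sub>j\<close>.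
  These operations commute with each other (\<open>affine_pointed_commute\<close>): an affine combination may be
  taken before or after adding a constant and multiplying by scalars from the other side. The content
  of the theorem is that each theory contains every operation that commutes with the other one.

  The first step turns commutants into theories of commuting operations. A natural transformation
  \<open>A\<^sup>n \<rightarrow> A\<^sup>m\<close> between powers of an algebra on \<open>U\<close> is determined by its component \<open>h : U\<^sup>n \<rightarrow> U\<^sup>m\<close> at
  \<open>1\<close>: naturality for the projections says that the other components are \<open>h\<close> in each coordinate, and
  then naturality says that \<open>h\<close> commutes with the operations of the theory (\<open>vnatural_iff\<close>). So if the
  generalized elements of the hom-objects of a theory of operations are exactly the operations
  commuting with \<open>T\<close>, then these hom-objects are objects of natural transformations, and the theory is
  the commutant of \<open>T\<close> (\<open>iso_over_commutant\<close>). Since all data are embedded in the internal homs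
  \<open>[U\<^sup>n, U\<^sup>m]\<close>, the axioms of a theory need only be checked on generalized elements of \<open>U\<close>.

  An operation \<open>h\<close> that commutes with the pointed module operations is affine
  (\<open>commutes_with_pointed_imp_affine\<close>). Every \<open>x\<close> is obtained by applying the module operation with
  coefficients \<open>x\<close> to the unit vectors, so \<open>h\<close> acts by the matrix of its values at the unit vectors;
  as \<open>h\<close> preserves the point, the rows of this matrix sum to \<open>1\<close>.

  An operation \<open>h\<close> that commutes with affine combinations has the form
  \<open>h x = h 0 + \<Sum>\<^sub>i x\<^sub>i (h e\<^sub>i - h 0)\<close>, with differences taken in \<open>R\<close>, and the slopes \<open>h e\<^sub>i - h 0\<close> are
  positive (\<open>commutes_with_affine_imp_pointed\<close>). At a stage in the generating class choose \<open>N = 2\<^sup>k\<close> with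
  \<open>\<Sum>\<^sub>i x\<^sub>i \<le> N\<close>. The point \<open>x / N\<close> lies on the segment from \<open>0\<close> to \<open>x\<close> and also in the simplex spanned
  by \<open>0\<close> and the unit vectors; computing \<open>h\<close> there in both ways gives the formula. It implies
  \<open>0 \<le> h (m e\<^sub>i) = h 0 + m (h e\<^sub>i - h 0)\<close> for every natural \<open>m\<close>, so the slopes are positive by the
  archimedean property (\<open>affine_map_on_cone\<close>). Equations pass from the generating class to all stages
  by definition; positivity does because \<open>U \<rightarrow> R\<close> is a strong monomorphism
  (\<open>positive_if_positive_at_generators\<close>).\<close>

section \<open>Generalized elements in a cartesian closed category\<close>

text \<open>A morphism \<open>W \<rightarrow> A\<close> is treated as an element of \<open>A\<close> at stage \<open>W\<close>, and composition with
  \<open>W' \<rightarrow> W\<close> as its restriction to stage \<open>W'\<close>. Elements of \<open>Exp A B\<close> are then applied to elements of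
  \<open>A\<close> like functions, and each construction is recorded with its restriction law.\<close>

definition eval_at :: "('o, 'a) ccc \<Rightarrow> 'o \<Rightarrow> 'o \<Rightarrow> 'a \<Rightarrow> 'a \<Rightarrow> 'a" where
  "eval_at V A B h x = Ev V A B \<cdot>\<^bsub>V\<^esub> pair V h x"

lemma homs_Dom: "f \<in> homs C A B \<Longrightarrow> Dom C f = A"
  and homs_Cod: "f \<in> homs C A B \<Longrightarrow> Cod C f = B"
  and homs_Arr: "f \<in> homs C A B \<Longrightarrow> f \<in> Arr C"
  by (auto simp: homs_def)

lemma (in category) homs_Obj:
  "f \<in> homs C A B \<Longrightarrow> A \<in> Obj C" "f \<in> homs C A B \<Longrightarrow> B \<in> Obj C"
  using Dom_Obj Cod_Obj by (auto simp: homs_def)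

lemma tuple_cong: "(\<And>i. i < n \<Longrightarrow> f i = g i) \<Longrightarrow> tuple V W n f = tuple V W n g"
  unfolding tuple_def by (intro arg_cong[where f = "Tup V W"]) simp

context cartesian_closed
begin

subsection \<open>Tuples and pairs\<close>

lemma map_Cod_eq_replicate:
  "(\<And>i. i < n \<Longrightarrow> f i \<in> homs V W X) \<Longrightarrow> map (Cod V) (map f [0..<n]) = replicate n X"
  by (simp add: list_eq_iff_nth_eq homs_def)

lemma vpow_Obj: "X \<in> Obj V \<Longrightarrow> vpow V X n \<in> Obj V"
  unfolding vpow_def by (intro Prd_Obj) auto

lemma vpow_1: "X \<in> Obj V \<Longrightarrow> vpow V X 1 = X" "X \<in> Obj V \<Longrightarrow> vpow V X (Suc 0) = X"
  by (simp_all add: vpow_def Prd_single)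

lemma vpow_prj_1: "X \<in> Obj V \<Longrightarrow> vpow_prj V X 1 0 = Idn V X"
  "X \<in> Obj V \<Longrightarrow> vpow_prj V X (Suc 0) 0 = Idn V X"
  by (simp_all add: vpow_prj_def Prj_single)

lemma vpow_prj_homs: "\<lbrakk>X \<in> Obj V; i < n\<rbrakk> \<Longrightarrow> vpow_prj V X n i \<in> homs V (vpow V X n) X"
  unfolding vpow_def vpow_prj_def using Prj_homs[of "replicate n X" i] by auto

lemma prj_homs:
  "\<lbrakk>h \<in> homs V W (vpow V X n); X \<in> Obj V; i < n\<rbrakk> \<Longrightarrow> vpow_prj V X n i \<cdot> h \<in> homs V W X"
  by (rule Cmp_homs[OF _ vpow_prj_homs])

lemma tuple_homs:
  assumes "W \<in> Obj V" "\<And>i. i < n \<Longrightarrow> f i \<in> homs V W X"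
  shows "tuple V W n f \<in> homs V W (vpow V X n)"
proof -
  have "set (map f [0..<n]) \<subseteq> Arr V" "\<forall>g \<in> set (map f [0..<n]). Dom V g = W"
    using assms(2) by (auto simp: homs_def)
  from Tup_homs[OF assms(1) this] map_Cod_eq_replicate[of n f W X] assms(2)
  show ?thesis by (simp add: tuple_def vpow_def del: map_map)
qed

lemma prj_tuple:
  assumes "W \<in> Obj V" "\<And>i. i < n \<Longrightarrow> f i \<in> homs V W X" "i < n"
  shows "vpow_prj V X n i \<cdot> tuple V W n f = f i"
proof -
  have "set (map f [0..<n]) \<subseteq> Arr V" "\<forall>g \<in> set (map f [0..<n]). Dom V g = W"
    using assms(2) by (auto simp: homs_def)
  from Prj_Tup[OF assms(1) this, of i] assms(3) map_Cod_eq_replicate[of n f W X] assms(2)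
  show ?thesis by (simp add: tuple_def vpow_prj_def del: map_map)
qed

lemma tuple_eta:
  "\<lbrakk>X \<in> Obj V; h \<in> homs V W (vpow V X n)\<rbrakk> \<Longrightarrow> tuple V W n (\<lambda>i. vpow_prj V X n i \<cdot> h) = h"
proof -
  assume X: "X \<in> Obj V" and h: "h \<in> homs V W (vpow V X n)"
  have "set (replicate n X) \<subseteq> Obj V" using X by auto
  from Tup_eta[OF this h[unfolded vpow_def]] show ?thesis
    by (simp add: tuple_def vpow_prj_def)
qed

lemma vpow_eqI:
  assumes "X \<in> Obj V" "h \<in> homs V W (vpow V X n)" "k \<in> homs V W (vpow V X n)"
    and "\<And>i. i < n \<Longrightarrow> vpow_prj V X n i \<cdot> h = vpow_prj V X n i \<cdot> k"
  shows "h = k"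
proof -
  have "tuple V W n (\<lambda>i. vpow_prj V X n i \<cdot> h) = tuple V W n (\<lambda>i. vpow_prj V X n i \<cdot> k)"
    by (rule tuple_cong[OF assms(4)])
  then show ?thesis unfolding tuple_eta[OF assms(1,2)] tuple_eta[OF assms(1,3)] .
qed

lemma tuple_Cmp:
  assumes "X \<in> Obj V" "s \<in> homs V W' W" "\<And>i. i < n \<Longrightarrow> f i \<in> homs V W X"
  shows "tuple V W n f \<cdot> s = tuple V W' n (\<lambda>i. f i \<cdot> s)"
proof (rule vpow_eqI[OF assms(1)])
  have O: "W \<in> Obj V" "W' \<in> Obj V" using homs_Obj[OF assms(2)] by simp_all
  show t: "tuple V W n f \<cdot> s \<in> homs V W' (vpow V X n)"
    by (intro Cmp_homs[OF assms(2)] tuple_homs O assms)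
  have fs: "\<And>i. i < n \<Longrightarrow> f i \<cdot> s \<in> homs V W' X" by (intro Cmp_homs[OF assms(2)] assms)
  then show "tuple V W' n (\<lambda>i. f i \<cdot> s) \<in> homs V W' (vpow V X n)"
    by (intro tuple_homs O)
  fix i assume i: "i < n"
  have "vpow_prj V X n i \<cdot> tuple V W n f \<cdot> s = (vpow_prj V X n i \<cdot> tuple V W n f) \<cdot> s"
    by (rule Cmp_assoc[OF assms(2) _ vpow_prj_homs[OF assms(1) i], symmetric])
      (rule tuple_homs[OF O(1) assms(3)])
  also have "vpow_prj V X n i \<cdot> tuple V W n f = f i"
    by (rule prj_tuple[OF O(1) _ i]) (rule assms(3))
  also have "f i \<cdot> s = vpow_prj V X n i \<cdot> tuple V W' n (\<lambda>i. f i \<cdot> s)"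
    by (rule prj_tuple[OF O(2) _ i, symmetric]) (rule fs)
  finally show "vpow_prj V X n i \<cdot> tuple V W n f \<cdot> s
      = vpow_prj V X n i \<cdot> tuple V W' n (\<lambda>i. f i \<cdot> s)" .
qed

lemma pair_homs:
  assumes f: "f \<in> homs V W A" and g: "g \<in> homs V W B"
  shows "pair V f g \<in> homs V W (Prd V [A, B])"
proof -
  have "set [f, g] \<subseteq> Arr V" "\<forall>h \<in> set [f, g]. Dom V h = W"
    using f g by (auto simp: homs_def)
  from Tup_homs[OF homs_Obj(1)[OF f] this] show ?thesis
    by (simp add: pair_def homs_Dom[OF f] homs_Cod[OF f] homs_Cod[OF g])
qed

lemma Prj_pair:
  assumes f: "f \<in> homs V W A" and g: "g \<in> homs V W B"
  shows "Prj V [A, B] 0 \<cdot> pair V f g = f" "Prj V [A, B] 1 \<cdot> pair V f g = g"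
    "Prj V [A, B] (Suc 0) \<cdot> pair V f g = g"
proof -
  have "set [f, g] \<subseteq> Arr V" "\<forall>h \<in> set [f, g]. Dom V h = W"
    using f g by (auto simp: homs_def)
  note P = Prj_Tup[OF homs_Obj(1)[OF f] this]
  show "Prj V [A, B] 0 \<cdot> pair V f g = f"
    using P[of 0] by (simp add: pair_def homs_Dom[OF f] homs_Cod[OF f] homs_Cod[OF g])
  show "Prj V [A, B] 1 \<cdot> pair V f g = g" "Prj V [A, B] (Suc 0) \<cdot> pair V f g = g"
    using P[of 1] by (simp_all add: pair_def homs_Dom[OF f] homs_Cod[OF f] homs_Cod[OF g])
qed

lemma Prd2_Obj: "\<lbrakk>A \<in> Obj V; B \<in> Obj V\<rbrakk> \<Longrightarrow> Prd V [A, B] \<in> Obj V"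
  by (rule Prd_Obj) auto

lemma Prj2_homs:
  assumes "A \<in> Obj V" "B \<in> Obj V"
  shows "Prj V [A, B] 0 \<in> homs V (Prd V [A, B]) A" "Prj V [A, B] 1 \<in> homs V (Prd V [A, B]) B"
    "Prj V [A, B] (Suc 0) \<in> homs V (Prd V [A, B]) B"
proof -
  have "set [A, B] \<subseteq> Obj V" using assms by simp
  note P = Prj_homs[OF this]
  show "Prj V [A, B] 0 \<in> homs V (Prd V [A, B]) A" using P[of 0] by simp
  show "Prj V [A, B] 1 \<in> homs V (Prd V [A, B]) B"
    "Prj V [A, B] (Suc 0) \<in> homs V (Prd V [A, B]) B" using P[of 1] by simp_all
qed

lemma pair_eta:
  assumes "A \<in> Obj V" "B \<in> Obj V" "h \<in> homs V W (Prd V [A, B])"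
  shows "pair V (Prj V [A, B] 0 \<cdot> h) (Prj V [A, B] 1 \<cdot> h) = h"
proof -
  have "set [A, B] \<subseteq> Obj V" using assms by simp
  from Tup_eta[OF this assms(3)] show ?thesis
    using homs_Dom[OF Cmp_homs[OF assms(3) Prj2_homs(1)[OF assms(1,2)]]] by (simp add: pair_def)
qed

lemma pair_Cmp:
  assumes "f \<in> homs V W A" "g \<in> homs V W B" "s \<in> homs V W' W"
  shows "pair V f g \<cdot> s = pair V (f \<cdot> s) (g \<cdot> s)"
proof -
  have O: "A \<in> Obj V" "B \<in> Obj V" using homs_Obj[OF assms(1)] homs_Obj[OF assms(2)] by simp_all
  have p: "pair V f g \<cdot> s \<in> homs V W' (Prd V [A, B])"
    by (intro Cmp_homs[OF assms(3)] pair_homs assms)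
  show ?thesis
    using pair_eta[OF O p] Cmp_assoc[OF assms(3) pair_homs[OF assms(1,2)] Prj2_homs(1)[OF O]]
      Cmp_assoc[OF assms(3) pair_homs[OF assms(1,2)] Prj2_homs(2)[OF O]]
    by (simp add: Prj_pair[OF assms(1,2)])
qed

subsection \<open>Constants\<close>

lemma One_Obj: "One V \<in> Obj V"
  unfolding One_def by (rule Prd_Obj) simp

lemma terminal_map_homs: "W \<in> Obj V \<Longrightarrow> terminal_map V W \<in> homs V W (One V)"
  using Tup_homs[of W "[]"] by (simp add: terminal_map_def One_def)

lemma terminal_unique: "h \<in> homs V W (One V) \<Longrightarrow> h = terminal_map V W"
  using Tup_eta[of "[]" h W] by (simp add: terminal_map_def One_def)

lemma at_stage_homs: "\<lbrakk>W \<in> Obj V; u \<in> homs V (One V) A\<rbrakk> \<Longrightarrow> at_stage V W u \<in> homs V W A"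
  unfolding at_stage_def by (rule Cmp_homs[OF terminal_map_homs])

lemma at_stage_Cmp:
  assumes "s \<in> homs V W' W" "u \<in> homs V (One V) A"
  shows "at_stage V W u \<cdot> s = at_stage V W' u"
proof -
  have t: "terminal_map V W \<in> homs V W (One V)"
    by (rule terminal_map_homs[OF homs_Obj(2)[OF assms(1)]])
  show ?thesis
    unfolding at_stage_def
    using Cmp_assoc[OF assms(1) t assms(2)] terminal_unique[OF Cmp_homs[OF assms(1) t]] by simp
qed

lemma Cmp_at_stage:
  assumes "W \<in> Obj V" "u \<in> homs V (One V) A" "f \<in> homs V A B"
  shows "f \<cdot> at_stage V W u = at_stage V W (f \<cdot> u)"
  unfolding at_stage_def using Cmp_assoc[OF terminal_map_homs[OF assms(1)] assms(2,3)] by simp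

subsection \<open>Elements of internal homs\<close>

lemma eval_at_homs:
  assumes "h \<in> homs V W (Exp V A B)" "x \<in> homs V W A" "B \<in> Obj V"
  shows "eval_at V A B h x \<in> homs V W B"
proof -
  note A = homs_Obj(2)[OF assms(2)]
  show ?thesis
    unfolding eval_at_def by (rule Cmp_homs[OF pair_homs[OF assms(1,2)] Ev_homs[OF A assms(3)]])
qed

lemma eval_at_Cmp:
  assumes "h \<in> homs V W (Exp V A B)" "x \<in> homs V W A" "B \<in> Obj V" "s \<in> homs V W' W"
  shows "eval_at V A B h x \<cdot> s = eval_at V A B (h \<cdot> s) (x \<cdot> s)"
proof -
  note A = homs_Obj(2)[OF assms(2)]
  show ?thesis
    unfolding eval_at_def
    using Cmp_assoc[OF assms(4) pair_homs[OF assms(1,2)] Ev_homs[OF A assms(3)]]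
      pair_Cmp[OF assms(1,2,4)] by simp
qed

lemma eval_at_Cur:
  assumes O: "W \<in> Obj V" "A \<in> Obj V" "B \<in> Obj V" and f: "f \<in> homs V (Prd V [W, A]) B"
    and s: "s \<in> homs V W' W" and x: "x \<in> homs V W' A"
  shows "eval_at V A B (Cur V W A B f \<cdot> s) x = f \<cdot> pair V s x"
proof -
  let ?P = "Prd V [W, A]" and ?p = "Prj V [W, A] 0" and ?q = "Prj V [W, A] 1"
  note p = Prj2_homs(1)[OF O(1,2)] and q = Prj2_homs(2)[OF O(1,2)]
  note c = Cur_homs[OF O f] and sx = pair_homs[OF s x]
  note cp = Cmp_homs[OF p c]
  have t: "Tup V ?P [Cur V W A B f \<cdot> ?p, ?q] = pair V (Cur V W A B f \<cdot> ?p) ?q"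
    using homs_Dom[OF cp] by (simp add: pair_def)
  have "f \<cdot> pair V s x = (Ev V A B \<cdot> pair V (Cur V W A B f \<cdot> ?p) ?q) \<cdot> pair V s x"
    using Cur_beta[OF O f] t by simp
  also have "\<dots> = Ev V A B \<cdot> pair V (Cur V W A B f \<cdot> ?p) ?q \<cdot> pair V s x"
    by (rule Cmp_assoc[OF sx pair_homs[OF cp q] Ev_homs[OF O(2,3)]])
  also have "pair V (Cur V W A B f \<cdot> ?p) ?q \<cdot> pair V s x = pair V (Cur V W A B f \<cdot> s) x"
    unfolding pair_Cmp[OF cp q sx] Cmp_assoc[OF sx p c] Prj_pair[OF s x] ..
  finally show ?thesis by (simp add: eval_at_def)
qed

text \<open>Extensionality must range over all restrictions of \<open>h\<close>: the generic argument, the projection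
  \<open>W \<times> A \<rightarrow> A\<close>, lives at stage \<open>W \<times> A\<close>.\<close>

lemma Exp_eqI:
  assumes O: "A \<in> Obj V" "B \<in> Obj V"
    and h: "h \<in> homs V W (Exp V A B)" and k: "k \<in> homs V W (Exp V A B)"
    and eq: "\<And>W' s x. \<lbrakk>s \<in> homs V W' W; x \<in> homs V W' A\<rbrakk>
      \<Longrightarrow> eval_at V A B (h \<cdot> s) x = eval_at V A B (k \<cdot> s) x"
  shows "h = k"
proof -
  note W = homs_Obj(1)[OF h]
  let ?P = "Prd V [W, A]" and ?p = "Prj V [W, A] 0" and ?q = "Prj V [W, A] 1"
  note p = Prj2_homs(1)[OF W O(1)] and q = Prj2_homs(2)[OF W O(1)]
  have "Cur V W A B (eval_at V A B (g \<cdot> ?p) ?q) = g" if g: "g \<in> homs V W (Exp V A B)" for g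
    using Cur_eta[OF W O g] homs_Dom[OF Cmp_homs[OF p g]] by (simp add: eval_at_def pair_def)
  from this[OF h, symmetric] this[OF k] show ?thesis unfolding eq[OF p q] by (rule trans)
qed

text \<open>The Yoneda description of an internal hom: its elements at stage \<open>W\<close> are the families of
  functions between generalized elements, indexed by the stages over \<open>W\<close>, that are compatible
  with restriction.\<close>

lemma Exp_exists:
  assumes O: "W \<in> Obj V" "A \<in> Obj V" "B \<in> Obj V"
    and F: "\<And>W' s x. \<lbrakk>s \<in> homs V W' W; x \<in> homs V W' A\<rbrakk> \<Longrightarrow> F s x \<in> homs V W' B"
    and nat: "\<And>W' W'' s x r. \<lbrakk>s \<in> homs V W' W; x \<in> homs V W' A; r \<in> homs V W'' W'\<rbrakk>
      \<Longrightarrow> F s x \<cdot> r = F (s \<cdot> r) (x \<cdot> r)"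
  obtains h where "h \<in> homs V W (Exp V A B)"
    "\<And>W' s x. \<lbrakk>s \<in> homs V W' W; x \<in> homs V W' A\<rbrakk> \<Longrightarrow> eval_at V A B (h \<cdot> s) x = F s x"
proof
  let ?p = "Prj V [W, A] 0" and ?q = "Prj V [W, A] 1"
  note p = Prj2_homs(1)[OF O(1,2)] and q = Prj2_homs(2)[OF O(1,2)]
  let ?h = "Cur V W A B (F ?p ?q)"
  show "?h \<in> homs V W (Exp V A B)"
    by (intro Cur_homs O F p q)
  fix W' s x assume s: "s \<in> homs V W' W" and x: "x \<in> homs V W' A"
  show "eval_at V A B (?h \<cdot> s) x = F s x"
    using eval_at_Cur[OF O F[OF p q] s x] nat[OF p q pair_homs[OF s x]] Prj_pair[OF s x] by simp
qed

lemma name_of_homs: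
  assumes "f \<in> homs V A B"
  shows "name_of V f \<in> homs V (One V) (Exp V A B)"
proof -
  note O = homs_Obj[OF assms]
  show ?thesis
    unfolding name_of_def homs_Dom[OF assms] homs_Cod[OF assms]
    by (intro Cur_homs One_Obj O Cmp_homs[OF _ assms] Prj2_homs)
qed

lemma eval_at_name_of:
  assumes f: "f \<in> homs V A B" and x: "x \<in> homs V W A"
  shows "eval_at V A B (at_stage V W (name_of V f)) x = f \<cdot> x"
proof -
  note O = homs_Obj[OF f] homs_Obj(1)[OF x]
  note q = Prj2_homs(2)[OF One_Obj O(1)] and t = terminal_map_homs[OF O(3)]
  show ?thesis
    unfolding at_stage_def name_of_def homs_Dom[OF f] homs_Cod[OF f]
      eval_at_Cur[OF One_Obj O(1,2) Cmp_homs[OF q f] t x] Cmp_assoc[OF pair_homs[OF t x] q f]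
      Prj_pair[OF t x] ..
qed

lemma self_vcomp_homs_eval_at:
  assumes O: "A \<in> Obj V" "B \<in> Obj V" "C \<in> Obj V"
    and g: "g \<in> homs V W (Exp V B C)" and f: "f \<in> homs V W (Exp V A B)"
  shows self_vcomp_homs: "vcomp V (self_enriched V) A B C g f \<in> homs V W (Exp V A C)"
    and eval_at_self_vcomp: "x \<in> homs V W A \<Longrightarrow>
      eval_at V A C (vcomp V (self_enriched V) A B C g f) x = eval_at V B C g (eval_at V A B f x)"
proof -
  note E = Exp_Obj[OF O(2,3)] Exp_Obj[OF O(1,2)]
  let ?H = "Prd V [Exp V B C, Exp V A B]"
  note H = Prd2_Obj[OF E]
  note h = Prj2_homs(1)[OF H O(1)] and y = Prj2_homs(2)[OF H O(1)]
  note g' = Cmp_homs[OF h Prj2_homs(1)[OF E]] and f' = Cmp_homs[OF h Prj2_homs(2)[OF E]]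
  let ?g = "Prj V [Exp V B C, Exp V A B] 0 \<cdot> Prj V [?H, A] 0"
  let ?f = "Prj V [Exp V B C, Exp V A B] 1 \<cdot> Prj V [?H, A] 0"
  let ?F = "eval_at V B C ?g (eval_at V A B ?f (Prj V [?H, A] 1))"
  have F: "?F \<in> homs V (Prd V [?H, A]) C"
    by (intro eval_at_homs[OF g'] eval_at_homs[OF f'] y O)
  have c: "vcomp V (self_enriched V) A B C g f = Cur V ?H A C ?F \<cdot> pair V g f"
    by (simp add: vcomp_def self_enriched_def Let_def eval_at_def)
  note gf = pair_homs[OF g f]
  show "vcomp V (self_enriched V) A B C g f \<in> homs V W (Exp V A C)"
    unfolding c by (intro Cmp_homs[OF gf] Cur_homs H O F)
  assume x: "x \<in> homs V W A"
  note s = pair_homs[OF gf x]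
  have 1: "?g \<cdot> pair V (pair V g f) x = g" "?f \<cdot> pair V (pair V g f) x = f"
    "Prj V [?H, A] 1 \<cdot> pair V (pair V g f) x = x"
    unfolding Cmp_assoc[OF s h Prj2_homs(1)[OF E]] Cmp_assoc[OF s h Prj2_homs(2)[OF E]]
    by (simp_all only: Prj_pair[OF gf x] Prj_pair[OF g f])
  show "eval_at V A C (vcomp V (self_enriched V) A B C g f) x = eval_at V B C g (eval_at V A B f x)"
    unfolding c eval_at_Cur[OF H O(1,3) F gf x]
      eval_at_Cmp[OF g' eval_at_homs[OF f' y O(2)] O(3) s] eval_at_Cmp[OF f' y O(2) s] 1 ..
qed

lemma vcomp_Cmp:
  assumes "VComp C a b c \<in> homs V (Prd V [VHom C b c, VHom C a b]) (VHom C a c)"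
    and "x \<in> homs V W (VHom C b c)" "y \<in> homs V W (VHom C a b)"
  shows vcomp_homs: "vcomp V C a b c x y \<in> homs V W (VHom C a c)"
    and vcomp_restrict: "s \<in> homs V W' W \<Longrightarrow>
      vcomp V C a b c x y \<cdot> s = vcomp V C a b c (x \<cdot> s) (y \<cdot> s)"
proof -
  note p = pair_homs[OF assms(2,3)]
  show "vcomp V C a b c x y \<in> homs V W (VHom C a c)"
    unfolding vcomp_def by (intro Cmp_homs[OF p] assms)
  assume s: "s \<in> homs V W' W"
  show "vcomp V C a b c x y \<cdot> s = vcomp V C a b c (x \<cdot> s) (y \<cdot> s)"
    unfolding vcomp_def using Cmp_assoc[OF s p assms(1)] pair_Cmp[OF assms(2,3) s] by simp
qed

lemma self_VComp_homs:
  assumes O: "A \<in> Obj V" "B \<in> Obj V" "C \<in> Obj V"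
  shows "VComp (self_enriched V) A B C \<in> homs V (Prd V [Exp V B C, Exp V A B]) (Exp V A C)"
proof -
  note E = Exp_Obj[OF O(2,3)] Exp_Obj[OF O(1,2)]
  note H = Prd2_Obj[OF E]
  note h = Prj2_homs(1)[OF H O(1)] and y = Prj2_homs(2)[OF H O(1)]
  note g' = Cmp_homs[OF h Prj2_homs(1)[OF E]] and f' = Cmp_homs[OF h Prj2_homs(2)[OF E]]
  show ?thesis
    unfolding self_enriched_def Let_def eval_at_def[symmetric] vcat.simps
    by (intro Cur_homs H O eval_at_homs[OF g'] eval_at_homs[OF f'] y)
qed

lemma self_vcomp_Cmp:
  assumes O: "A \<in> Obj V" "B \<in> Obj V" "C \<in> Obj V"
    and g: "g \<in> homs V W (Exp V B C)" and f: "f \<in> homs V W (Exp V A B)" and s: "s \<in> homs V W' W"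
  shows "vcomp V (self_enriched V) A B C g f \<cdot> s = vcomp V (self_enriched V) A B C (g \<cdot> s) (f \<cdot> s)"
proof -
  have H: "VHom (self_enriched V) = Exp V" by (simp add: self_enriched_def)
  show ?thesis by (rule vcomp_restrict) (unfold H, rule self_VComp_homs[OF O], rule g, rule f, rule s)
qed

end

section \<open>Operations on an object\<close>

locale ccc_object = cartesian_closed V for V :: "('o, 'a) ccc" (structure) +
  fixes X :: 'o
  assumes X: "X \<in> Obj V"
begin

text \<open>The \<open>j\<close>-th coordinate of the value of \<open>h : W \<rightarrow> [X\<^sup>n, X\<^sup>m]\<close> at \<open>x\<^sub>0, \<dots>, x\<^sub>n\<^sub>-\<^sub>1\<close>. The stage is read
  off from \<open>h\<close>, because for \<open>n = 0\<close> the arguments do not determine it.\<close>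

definition act :: "nat \<Rightarrow> nat \<Rightarrow> 'a \<Rightarrow> (nat \<Rightarrow> 'a) \<Rightarrow> nat \<Rightarrow> 'a" where
  "act n m h x j =
     vpow_prj V X m j \<cdot> eval_at V (vpow V X n) (vpow V X m) h (tuple V (Dom V h) n x)"

lemma act_cong: "(\<And>i. i < n \<Longrightarrow> x i = y i) \<Longrightarrow> act n m h x j = act n m h y j"
  unfolding act_def by (simp only: tuple_cong[of n x y])

abbreviation operations :: "nat \<Rightarrow> nat \<Rightarrow> 'o" where
  "operations n m \<equiv> Exp V (vpow V X n) (vpow V X m)"

lemmas X1 = vpow_1[OF X] vpow_prj_1[OF X]

lemma act_homs:
  assumes h: "h \<in> homs V W (operations n m)" and x: "\<And>i. i < n \<Longrightarrow> x i \<in> homs V W X" and j: "j < m"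
  shows "act n m h x j \<in> homs V W X"
proof -
  have t: "tuple V W n x \<in> homs V W (vpow V X n)"
    by (rule tuple_homs[OF homs_Obj(1)[OF h]]) (rule x)
  show ?thesis
    unfolding act_def homs_Dom[OF h] by (rule prj_homs[OF eval_at_homs[OF h t vpow_Obj[OF X]] X j])
qed

lemma act_Cmp:
  assumes h: "h \<in> homs V W (operations n m)" and x: "\<And>i. i < n \<Longrightarrow> x i \<in> homs V W X" and j: "j < m"
    and s: "s \<in> homs V W' W"
  shows "act n m h x j \<cdot> s = act n m (h \<cdot> s) (\<lambda>i. x i \<cdot> s) j"
proof -
  have t: "tuple V W n x \<in> homs V W (vpow V X n)"
    by (rule tuple_homs[OF homs_Obj(1)[OF h]]) (rule x)
  have ts: "tuple V W n x \<cdot> s = tuple V W' n (\<lambda>i. x i \<cdot> s)"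
    by (rule tuple_Cmp[OF X s]) (rule x)
  note e = eval_at_homs[OF h t vpow_Obj[OF X]]
  show ?thesis
    unfolding act_def homs_Dom[OF h] homs_Dom[OF Cmp_homs[OF s h]] ts[symmetric]
      Cmp_assoc[OF s e vpow_prj_homs[OF X j]] eval_at_Cmp[OF h t vpow_Obj[OF X] s] ..
qed

lemma eval_at_eq_act:
  assumes h: "h \<in> homs V W (operations n m)" and y: "y \<in> homs V W (vpow V X n)"
  shows "vpow_prj V X m j \<cdot> eval_at V (vpow V X n) (vpow V X m) h y
    = act n m h (\<lambda>i. vpow_prj V X n i \<cdot> y) j"
  unfolding act_def homs_Dom[OF h] tuple_eta[OF X y] ..

lemma act_eqI:
  assumes h: "h \<in> homs V W (operations n m)" and k: "k \<in> homs V W (operations n m)"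
    and eq: "\<And>W' s x j. \<lbrakk>s \<in> homs V W' W; \<And>i. i < n \<Longrightarrow> x i \<in> homs V W' X; j < m\<rbrakk>
      \<Longrightarrow> act n m (h \<cdot> s) x j = act n m (k \<cdot> s) x j"
  shows "h = k"
proof (rule Exp_eqI[OF vpow_Obj[OF X] vpow_Obj[OF X] h k])
  fix W' s y assume s: "s \<in> homs V W' W" and y: "y \<in> homs V W' (vpow V X n)"
  note hs = Cmp_homs[OF s h] and ks = Cmp_homs[OF s k]
  show "eval_at V (vpow V X n) (vpow V X m) (h \<cdot> s) y = eval_at V (vpow V X n) (vpow V X m) (k \<cdot> s) y"
  proof (rule vpow_eqI[OF X eval_at_homs[OF hs y vpow_Obj[OF X]]
        eval_at_homs[OF ks y vpow_Obj[OF X]]])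
    fix j assume "j < m"
    show "vpow_prj V X m j \<cdot> eval_at V (vpow V X n) (vpow V X m) (h \<cdot> s) y =
      vpow_prj V X m j \<cdot> eval_at V (vpow V X n) (vpow V X m) (k \<cdot> s) y"
      unfolding eval_at_eq_act[OF hs y] eval_at_eq_act[OF ks y]
      by (rule eq[OF s prj_homs[OF y X] \<open>j < m\<close>])
  qed
qed

text \<open>Arguments are functions on all natural numbers, of which only the first \<open>n\<close> values enter the
  tuple; hence the last condition on \<open>F\<close>, besides compatibility with restriction.\<close>

lemma act_exists:
  assumes W: "W \<in> Obj V"
    and F: "\<And>W' s x j. \<lbrakk>s \<in> homs V W' W; \<And>i. i < n \<Longrightarrow> x i \<in> homs V W' X; j < m\<rbrakk>
      \<Longrightarrow> F s x j \<in> homs V W' X"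
    and nat: "\<And>W' W'' s x r j. \<lbrakk>s \<in> homs V W' W; \<And>i. i < n \<Longrightarrow> x i \<in> homs V W' X;
      r \<in> homs V W'' W'; j < m\<rbrakk> \<Longrightarrow> F s x j \<cdot> r = F (s \<cdot> r) (\<lambda>i. x i \<cdot> r) j"
    and cong: "\<And>s x y j. (\<And>i. i < n \<Longrightarrow> x i = y i) \<Longrightarrow> F s x j = F s y j"
  obtains h where "h \<in> homs V W (operations n m)"
    "\<And>W' s x j. \<lbrakk>s \<in> homs V W' W; \<And>i. i < n \<Longrightarrow> x i \<in> homs V W' X; j < m\<rbrakk>
      \<Longrightarrow> act n m (h \<cdot> s) x j = F s x j"
proof -
  let ?F = "\<lambda>s y. tuple V (Dom V s) m (F s (\<lambda>i. vpow_prj V X n i \<cdot> y))"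
  have F': "?F s y \<in> homs V W' (vpow V X m)"
    if s: "s \<in> homs V W' W" and y: "y \<in> homs V W' (vpow V X n)" for W' s y
    unfolding homs_Dom[OF s] by (rule tuple_homs[OF homs_Obj(1)[OF s]]) (rule F[OF s prj_homs[OF y X]])
  have nat': "?F s y \<cdot> r = ?F (s \<cdot> r) (y \<cdot> r)"
    if s: "s \<in> homs V W' W" and y: "y \<in> homs V W' (vpow V X n)" and r: "r \<in> homs V W'' W'" for W' W'' s y r
  proof -
    have "?F s y \<cdot> r = tuple V W'' m (\<lambda>j. F s (\<lambda>i. vpow_prj V X n i \<cdot> y) j \<cdot> r)"
      unfolding homs_Dom[OF s]
      by (rule tuple_Cmp[OF X r]) (rule F[OF s prj_homs[OF y X]])
    also have "\<dots> = ?F (s \<cdot> r) (y \<cdot> r)"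
      unfolding homs_Dom[OF Cmp_homs[OF r s]]
    proof (rule tuple_cong)
      fix j assume j: "j < m"
      have "F s (\<lambda>i. vpow_prj V X n i \<cdot> y) j \<cdot> r = F (s \<cdot> r) (\<lambda>i. (vpow_prj V X n i \<cdot> y) \<cdot> r) j"
        by (rule nat[OF s prj_homs[OF y X] r j])
      also have "\<dots> = F (s \<cdot> r) (\<lambda>i. vpow_prj V X n i \<cdot> y \<cdot> r) j"
        by (rule cong) (rule Cmp_assoc[OF r y vpow_prj_homs[OF X]])
      finally show "F s (\<lambda>i. vpow_prj V X n i \<cdot> y) j \<cdot> r
        = F (s \<cdot> r) (\<lambda>i. vpow_prj V X n i \<cdot> y \<cdot> r) j" .
    qed
    finally show ?thesis .
  qed
  obtain h where h: "h \<in> homs V W (operations n m)"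
    and ev: "\<And>W' s y. \<lbrakk>s \<in> homs V W' W; y \<in> homs V W' (vpow V X n)\<rbrakk>
      \<Longrightarrow> eval_at V (vpow V X n) (vpow V X m) (h \<cdot> s) y = ?F s y"
    by (rule Exp_exists[where F = ?F, OF W vpow_Obj[OF X, of n] vpow_Obj[OF X, of m]])
      (erule (1) F', erule (2) nat', blast)
  show ?thesis
  proof (rule that[OF h])
    fix W' s x j
    assume s: "s \<in> homs V W' W" and x: "\<And>i. i < n \<Longrightarrow> x i \<in> homs V W' X" and j: "j < m"
    note W' = homs_Obj(1)[OF s]
    have t: "tuple V W' n x \<in> homs V W' (vpow V X n)" by (rule tuple_homs[OF W']) (rule x)
    have "act n m (h \<cdot> s) x j
      = vpow_prj V X m j \<cdot> tuple V W' m (F s (\<lambda>i. vpow_prj V X n i \<cdot> tuple V W' n x))"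
      unfolding act_def homs_Dom[OF Cmp_homs[OF s h]] ev[OF s t] homs_Dom[OF s] ..
    also have "\<dots> = F s (\<lambda>i. vpow_prj V X n i \<cdot> tuple V W' n x) j"
      by (rule prj_tuple[OF W' _ j]) (rule F[OF s prj_homs[OF t X]])
    also have "\<dots> = F s x j"
      by (rule cong) (rule prj_tuple[OF W' x])
    finally show "act n m (h \<cdot> s) x j = F s x j" .
  qed
qed

lemma act_self_vcomp:
  assumes g: "g \<in> homs V W (operations m k)" and f: "f \<in> homs V W (operations n m)"
    and x: "\<And>i. i < n \<Longrightarrow> x i \<in> homs V W X"
  shows "act n k (vcomp V (self_enriched V) (vpow V X n) (vpow V X m) (vpow V X k) g f) x j
    = act m k g (act n m f x) j"
proof -
  note W = homs_Obj(1)[OF g] and O = vpow_Obj[OF X] vpow_Obj[OF X] vpow_Obj[OF X]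
  have t: "tuple V W n x \<in> homs V W (vpow V X n)" by (rule tuple_homs[OF W]) (rule x)
  note e = eval_at_homs[OF f t O(2)]
  show ?thesis
    unfolding act_def homs_Dom[OF g] homs_Dom[OF f] homs_Dom[OF self_vcomp_homs[OF O g f]]
      eval_at_self_vcomp[OF O g f t] tuple_eta[OF X e] ..
qed

lemma act_name_of_Idn:
  assumes W: "W \<in> Obj V" and x: "\<And>i. i < n \<Longrightarrow> x i \<in> homs V W X" and j: "j < n"
  shows "act n n (at_stage V W (name_of V (Idn V (vpow V X n)))) x j = x j"
proof -
  have t: "tuple V W n x \<in> homs V W (vpow V X n)" by (rule tuple_homs[OF W]) (rule x)
  note i = Idn_homs[OF vpow_Obj[OF X]]
  show ?thesis
    unfolding act_def homs_Dom[OF at_stage_homs[OF W name_of_homs[OF i]]] eval_at_name_of[OF i t]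
      Idn_Cmp[OF t] by (rule prj_tuple[OF W x j])
qed

lemma act_name_of_prj:
  assumes W: "W \<in> Obj V" and x: "\<And>i. i < n \<Longrightarrow> x i \<in> homs V W X" and i: "i < n"
  shows "act n 1 (at_stage V W (name_of V (vpow_prj V X n i))) x 0 = x i"
proof -
  have t: "tuple V W n x \<in> homs V W (vpow V X n)" by (rule tuple_homs[OF W]) (rule x)
  note p = vpow_prj_homs[OF X i]
  have e: "vpow_prj V X n i \<cdot> tuple V W n x = x i" by (rule prj_tuple[OF W x i])
  show ?thesis
    unfolding act_def homs_Dom[OF at_stage_homs[OF W name_of_homs[OF p]]] X1
      eval_at_name_of[OF p t] e by (rule Idn_Cmp[OF x[OF i]])
qed

lemma Cur_tuple:
  assumes H: "H \<in> Obj V" and F: "\<And>j. j < m \<Longrightarrow> F j \<in> homs V (Prd V [H, vpow V X n]) X"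
  shows Cur_tuple_homs:
      "Cur V H (vpow V X n) (vpow V X m) (tuple V (Prd V [H, vpow V X n]) m F) \<in> homs V H (operations n m)"
    and act_Cur_tuple: "\<lbrakk>x \<in> homs V W H; \<And>i. i < n \<Longrightarrow> z i \<in> homs V W X; j < m\<rbrakk> \<Longrightarrow>
      act n m (Cur V H (vpow V X n) (vpow V X m) (tuple V (Prd V [H, vpow V X n]) m F) \<cdot> x) z j
      = F j \<cdot> pair V x (tuple V W n z)"
proof -
  note O = vpow_Obj[OF X, of n] vpow_Obj[OF X, of m]
  note P = Prd2_Obj[OF H O(1)]
  have t: "tuple V (Prd V [H, vpow V X n]) m F \<in> homs V (Prd V [H, vpow V X n]) (vpow V X m)"
    by (rule tuple_homs[OF P F])
  note c = Cur_homs[OF H O t]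
  show "Cur V H (vpow V X n) (vpow V X m) (tuple V (Prd V [H, vpow V X n]) m F) \<in> homs V H (operations n m)"
    by (rule c)
  assume x: "x \<in> homs V W H" and z: "\<And>i. i < n \<Longrightarrow> z i \<in> homs V W X" and j: "j < m"
  have tz: "tuple V W n z \<in> homs V W (vpow V X n)" by (rule tuple_homs[OF homs_Obj(1)[OF x] z])
  have "act n m (Cur V H (vpow V X n) (vpow V X m) (tuple V (Prd V [H, vpow V X n]) m F) \<cdot> x) z j
    = vpow_prj V X m j \<cdot> tuple V (Prd V [H, vpow V X n]) m F \<cdot> pair V x (tuple V W n z)"
    unfolding act_def homs_Dom[OF Cmp_homs[OF x c]] eval_at_Cur[OF H O t x tz] ..
  also have "\<dots> = (vpow_prj V X m j \<cdot> tuple V (Prd V [H, vpow V X n]) m F) \<cdot> pair V x (tuple V W n z)"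
    by (rule Cmp_assoc[OF pair_homs[OF x tz] t vpow_prj_homs[OF X j], symmetric])
  also have "vpow_prj V X m j \<cdot> tuple V (Prd V [H, vpow V X n]) m F = F j"
    by (rule prj_tuple[OF P F j])
  finally show "act n m (Cur V H (vpow V X n) (vpow V X m) (tuple V (Prd V [H, vpow V X n]) m F) \<cdot> x) z j
      = F j \<cdot> pair V x (tuple V W n z)" .
qed

lemma prj_Prj_pair_tuple:
  assumes x: "x \<in> homs V W H" and z: "\<And>i. i < n \<Longrightarrow> z i \<in> homs V W X" and i: "i < n"
  shows "(vpow_prj V X n i \<cdot> Prj V [H, vpow V X n] 1) \<cdot> pair V x (tuple V W n z) = z i"
proof -
  note W = homs_Obj[OF x]
  have tz: "tuple V W n z \<in> homs V W (vpow V X n)" by (rule tuple_homs[OF W(1) z])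
  have "(vpow_prj V X n i \<cdot> Prj V [H, vpow V X n] 1) \<cdot> pair V x (tuple V W n z)
    = vpow_prj V X n i \<cdot> tuple V W n z"
    unfolding Cmp_assoc[OF pair_homs[OF x tz] Prj2_homs(2)[OF W(2) vpow_Obj[OF X]] vpow_prj_homs[OF X i]]
      Prj_pair[OF x tz] ..
  also have "\<dots> = z i" by (rule prj_tuple[OF W(1) z i])
  finally show ?thesis .
qed

lemma Cmp_One_eq_at_stage: "s \<in> homs V W (One V) \<Longrightarrow> u \<cdot> s = at_stage V W u"
  unfolding at_stage_def using terminal_unique by simp

subsection \<open>Matrices of elements\<close>

lemma mat_entry_homs:
  "\<lbrakk>a \<in> homs V W (vpow V (vpow V X n) m); j < m; i < n\<rbrakk> \<Longrightarrow> mat_entry V X m n a j i \<in> homs V W X"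
  unfolding mat_entry_def by (rule prj_homs[OF prj_homs[OF _ vpow_Obj[OF X]] X])

lemma mat_entry_Cmp:
  assumes a: "a \<in> homs V W (vpow V (vpow V X n) m)" and j: "j < m" and i: "i < n"
    and s: "s \<in> homs V W' W"
  shows "mat_entry V X m n a j i \<cdot> s = mat_entry V X m n (a \<cdot> s) j i"
  unfolding mat_entry_def
    Cmp_assoc[OF s prj_homs[OF a vpow_Obj[OF X] j] vpow_prj_homs[OF X i]]
    Cmp_assoc[OF s a vpow_prj_homs[OF vpow_Obj[OF X] j]] ..

lemma mat_eqI:
  assumes a: "a \<in> homs V W (vpow V (vpow V X n) m)" and b: "b \<in> homs V W (vpow V (vpow V X n) m)"
    and eq: "\<And>j i. \<lbrakk>j < m; i < n\<rbrakk> \<Longrightarrow> mat_entry V X m n a j i = mat_entry V X m n b j i"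
  shows "a = b"
proof (rule vpow_eqI[OF vpow_Obj[OF X] a b])
  fix j assume j: "j < m"
  show "vpow_prj V (vpow V X n) m j \<cdot> a = vpow_prj V (vpow V X n) m j \<cdot> b"
    by (rule vpow_eqI[OF X prj_homs[OF a vpow_Obj[OF X] j] prj_homs[OF b vpow_Obj[OF X] j]])
      (rule eq[OF j, unfolded mat_entry_def])
qed

lemma mat_of_homs:
  assumes W: "W \<in> Obj V" and a: "\<And>j i. \<lbrakk>j < m; i < n\<rbrakk> \<Longrightarrow> a j i \<in> homs V W X"
  shows "mat_of V W m n a \<in> homs V W (vpow V (vpow V X n) m)"
  unfolding mat_of_def by (intro tuple_homs W a)

lemma mat_entry_mat_of:
  assumes W: "W \<in> Obj V" and a: "\<And>j i. \<lbrakk>j < m; i < n\<rbrakk> \<Longrightarrow> a j i \<in> homs V W X"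
    and j: "j < m" and i: "i < n"
  shows "mat_entry V X m n (mat_of V W m n a) j i = a j i"
proof -
  have "vpow_prj V (vpow V X n) m j \<cdot> tuple V W m (\<lambda>j. tuple V W n (a j)) = tuple V W n (a j)"
    by (rule prj_tuple[OF W _ j]) (intro tuple_homs W a)
  then show ?thesis
    unfolding mat_entry_def mat_of_def using prj_tuple[where f = "a j", OF W a[OF j] i] by simp
qed

lemma mat_entry_1:
  "mat_entry V X m 1 a j 0 = vpow_prj V X m j \<cdot> a" if "a \<in> homs V W (vpow V X m)" "j < m"
  unfolding mat_entry_def X1 using Idn_Cmp[OF prj_homs[OF that(1) X that(2)]] by simp

lemma mat_entry_mat_of_Cmp:
  assumes s: "s \<in> homs V W' W" and a: "\<And>j i. \<lbrakk>j < m; i < n\<rbrakk> \<Longrightarrow> a j i \<in> homs V W X"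
    and j: "j < m" and i: "i < n"
  shows "mat_entry V X m n (mat_of V W m n a \<cdot> s) j i = a j i \<cdot> s"
proof -
  note W = homs_Obj(2)[OF s]
  have "mat_entry V X m n (mat_of V W m n a \<cdot> s) j i = mat_entry V X m n (mat_of V W m n a) j i \<cdot> s"
    by (rule mat_entry_Cmp[OF mat_of_homs[OF W a] j i s, symmetric])
  also have "mat_entry V X m n (mat_of V W m n a) j i = a j i"
    by (rule mat_entry_mat_of[OF W a j i])
  finally show ?thesis .
qed

end

section \<open>Theories of operations\<close>

text \<open>The hom-objects of \<open>S\<close> embed by \<open>B\<close> into the objects of operations \<open>[X\<^sup>n, X\<^sup>m]\<close>, compatibly with
  identities, composition and projections. The category laws follow because they hold for operations
  and \<open>B\<close> is monic; that the projections exhibit powers is a matter of closure under tupling, which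
  commutants enjoy (\<open>is_conical_power\<close> below).\<close>

locale operation_theory = ccc_object V X for V :: "('o, 'a) ccc" (structure) and X +
  fixes S :: "('o, 'a) vtheory" and B :: "nat \<Rightarrow> nat \<Rightarrow> 'a"
  assumes VOb: "VOb S = UNIV"
    and VHom: "VHom S n m \<in> Obj V"
    and VId: "VId S n \<in> homs V (One V) (VHom S n n)"
    and VComp: "VComp S n m k \<in> homs V (Prd V [VHom S m k, VHom S n m]) (VHom S n k)"
    and TPrj: "i < n \<Longrightarrow> TPrj S n i \<in> homs V (One V) (VHom S n 1)"
    and B: "B n m \<in> homs V (VHom S n m) (operations n m)"
    and B_mono: "\<lbrakk>x \<in> homs V W (VHom S n m); y \<in> homs V W (VHom S n m); B n m \<cdot> x = B n m \<cdot> y\<rbrakk>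
      \<Longrightarrow> x = y"
    and B_VId: "B n n \<cdot> VId S n = name_of V (Idn V (vpow V X n))"
    and B_vcomp: "\<lbrakk>x \<in> homs V W (VHom S m k); y \<in> homs V W (VHom S n m)\<rbrakk>
      \<Longrightarrow> B n k \<cdot> vcomp V S n m k x y
        = vcomp V (self_enriched V) (vpow V X n) (vpow V X m) (vpow V X k) (B m k \<cdot> x) (B n m \<cdot> y)"
    and B_TPrj: "i < n \<Longrightarrow> B n 1 \<cdot> TPrj S n i = name_of V (vpow_prj V X n i)"
begin

lemma B_homs: "x \<in> homs V W (VHom S n m) \<Longrightarrow> B n m \<cdot> x \<in> homs V W (operations n m)"
  by (rule Cmp_homs[OF _ B])

text \<open>Equations in the theory are checked on arguments, since \<open>B\<close> is monic.\<close>

lemma eqI: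
  assumes x: "x \<in> homs V W (VHom S n m)" and y: "y \<in> homs V W (VHom S n m)"
    and eq: "\<And>W' s z j. \<lbrakk>s \<in> homs V W' W; \<And>i. i < n \<Longrightarrow> z i \<in> homs V W' X; j < m\<rbrakk>
      \<Longrightarrow> act n m (B n m \<cdot> x \<cdot> s) z j = act n m (B n m \<cdot> y \<cdot> s) z j"
  shows "x = y"
  by (rule B_mono[OF x y], rule act_eqI[OF B_homs[OF x] B_homs[OF y]],
      unfold Cmp_assoc[OF _ x B] Cmp_assoc[OF _ y B], rule eq)

lemma act_vcomp:
  assumes x: "x \<in> homs V W (VHom S m k)" and y: "y \<in> homs V W (VHom S n m)"
    and z: "\<And>i. i < n \<Longrightarrow> z i \<in> homs V W X"
  shows "act n k (B n k \<cdot> vcomp V S n m k x y) z j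
    = act m k (B m k \<cdot> x) (act n m (B n m \<cdot> y) z) j"
  unfolding B_vcomp[OF x y] by (rule act_self_vcomp[OF B_homs[OF x] B_homs[OF y] z])

lemma act_VId:
  assumes W: "W \<in> Obj V" and z: "\<And>i. i < n \<Longrightarrow> z i \<in> homs V W X" and j: "j < n"
  shows "act n n (B n n \<cdot> at_stage V W (VId S n)) z j = z j"
  unfolding Cmp_at_stage[OF W VId B] B_VId by (rule act_name_of_Idn[OF W z j])

lemma act_TPrj:
  assumes W: "W \<in> Obj V" and z: "\<And>i. i < n \<Longrightarrow> z i \<in> homs V W X" and i: "i < n"
  shows "act n 1 (B n 1 \<cdot> at_stage V W (TPrj S n i)) z 0 = z i"
  unfolding Cmp_at_stage[OF W TPrj[OF i] B] B_TPrj[OF i] by (rule act_name_of_prj[OF W z i])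

lemma act_coordinate:
  assumes x: "x \<in> homs V W (VHom S n m)" and z: "\<And>i. i < n \<Longrightarrow> z i \<in> homs V W X" and j: "j < m"
  shows "act n 1 (B n 1 \<cdot> vcomp V S n m 1 (at_stage V W (TPrj S m j)) x) z 0
    = act n m (B n m \<cdot> x) z j"
proof -
  note W = homs_Obj(1)[OF x]
  have "act n 1 (B n 1 \<cdot> vcomp V S n m 1 (at_stage V W (TPrj S m j)) x) z 0
    = act m 1 (B m 1 \<cdot> at_stage V W (TPrj S m j)) (act n m (B n m \<cdot> x) z) 0"
    by (rule act_vcomp[OF at_stage_homs[OF W TPrj[OF j]] x z])
  also have "\<dots> = act n m (B n m \<cdot> x) z j"
    by (rule act_TPrj[OF W _ j]) (rule act_homs[OF B_homs[OF x] z])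
  finally show ?thesis .
qed

lemma VComp_vcomp_homs:
  "\<lbrakk>x \<in> homs V W (VHom S m k); y \<in> homs V W (VHom S n m)\<rbrakk>
    \<Longrightarrow> vcomp V S n m k x y \<in> homs V W (VHom S n k)"
  by (rule vcomp_homs[OF VComp])

lemma VComp_vcomp_Cmp:
  "\<lbrakk>x \<in> homs V W (VHom S m k); y \<in> homs V W (VHom S n m); s \<in> homs V W' W\<rbrakk>
    \<Longrightarrow> vcomp V S n m k x y \<cdot> s = vcomp V S n m k (x \<cdot> s) (y \<cdot> s)"
  by (rule vcomp_restrict[OF VComp])

lemma is_vcat: "is_vcat V S"
proof -
  have unit: "vcomp V S a a b x (at_stage V W (VId S a)) = x"
    "vcomp V S a b b (at_stage V W (VId S b)) x = x"
    if x: "x \<in> homs V W (VHom S a b)" for a b W x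
  proof -
    note W = homs_Obj(1)[OF x] and O = VId
    note ia = at_stage_homs[OF W VId[of a]] and ib = at_stage_homs[OF W VId[of b]]
    show "vcomp V S a a b x (at_stage V W (VId S a)) = x"
    proof (rule eqI[OF VComp_vcomp_homs[OF x ia] x])
      fix W' s z j
      assume s: "s \<in> homs V W' W" and z: "\<And>i. i < a \<Longrightarrow> z i \<in> homs V W' X" and j: "j < b"
      note W' = homs_Obj(1)[OF s] and xs = Cmp_homs[OF s x]
      show "act a b (B a b \<cdot> vcomp V S a a b x (at_stage V W (VId S a)) \<cdot> s) z j
        = act a b (B a b \<cdot> x \<cdot> s) z j"
        unfolding VComp_vcomp_Cmp[OF x ia s] at_stage_Cmp[OF s VId]
        by (rule trans[OF act_vcomp[OF xs at_stage_homs[OF W' VId] z]], assumption,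
            rule act_cong, rule act_VId[OF W' z])
    qed
    show "vcomp V S a b b (at_stage V W (VId S b)) x = x"
    proof (rule eqI[OF VComp_vcomp_homs[OF ib x] x])
      fix W' s z j
      assume s: "s \<in> homs V W' W" and z: "\<And>i. i < a \<Longrightarrow> z i \<in> homs V W' X" and j: "j < b"
      note W' = homs_Obj(1)[OF s] and xs = Cmp_homs[OF s x]
      show "act a b (B a b \<cdot> vcomp V S a b b (at_stage V W (VId S b)) x \<cdot> s) z j
        = act a b (B a b \<cdot> x \<cdot> s) z j"
        unfolding VComp_vcomp_Cmp[OF ib x s] at_stage_Cmp[OF s VId]
        by (rule trans[OF act_vcomp[OF at_stage_homs[OF W' VId] xs z]], assumption,
            rule act_VId[OF W' _ j], rule act_homs[OF B_homs[OF xs] z])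
    qed
  qed
  have assoc: "vcomp V S a b d (vcomp V S b c d x y) z = vcomp V S a c d x (vcomp V S a b c y z)"
    if x: "x \<in> homs V W (VHom S c d)" and y: "y \<in> homs V W (VHom S b c)"
      and z: "z \<in> homs V W (VHom S a b)" for a b c d W x y z
  proof -
    note xy = VComp_vcomp_homs[OF x y] and yz = VComp_vcomp_homs[OF y z]
    show ?thesis
    proof (rule eqI[OF VComp_vcomp_homs[OF xy z] VComp_vcomp_homs[OF x yz]])
      fix W' s w j
      assume s: "s \<in> homs V W' W" and w: "\<And>i. i < a \<Longrightarrow> w i \<in> homs V W' X" and j: "j < d"
      note xs = Cmp_homs[OF s x] and ys = Cmp_homs[OF s y] and zs = Cmp_homs[OF s z]
      have zw: "\<And>i. i < b \<Longrightarrow> act a b (B a b \<cdot> z \<cdot> s) w i \<in> homs V W' X"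
        by (rule act_homs[OF B_homs[OF zs] w])
      have "act a d (B a d \<cdot> vcomp V S a b d (vcomp V S b c d x y) z \<cdot> s) w j
        = act b d (B b d \<cdot> vcomp V S b c d (x \<cdot> s) (y \<cdot> s)) (act a b (B a b \<cdot> z \<cdot> s) w) j"
        unfolding VComp_vcomp_Cmp[OF xy z s] VComp_vcomp_Cmp[OF x y s]
        by (rule act_vcomp[OF VComp_vcomp_homs[OF xs ys] zs w])
      also have "\<dots> = act c d (B c d \<cdot> x \<cdot> s)
          (act b c (B b c \<cdot> y \<cdot> s) (act a b (B a b \<cdot> z \<cdot> s) w)) j"
        by (rule act_vcomp[OF xs ys zw])
      also have "\<dots> = act c d (B c d \<cdot> x \<cdot> s) (act a c (B a c \<cdot> vcomp V S a b c (y \<cdot> s) (z \<cdot> s)) w) j"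
        by (rule act_cong) (rule act_vcomp[OF ys zs w, symmetric])
      also have "\<dots> = act a d (B a d \<cdot> vcomp V S a c d x (vcomp V S a b c y z) \<cdot> s) w j"
        unfolding VComp_vcomp_Cmp[OF x yz s] VComp_vcomp_Cmp[OF y z s]
        by (rule act_vcomp[OF xs VComp_vcomp_homs[OF ys zs] w, symmetric])
      finally show "act a d (B a d \<cdot> vcomp V S a b d (vcomp V S b c d x y) z \<cdot> s) w j
        = act a d (B a d \<cdot> vcomp V S a c d x (vcomp V S a b c y z) \<cdot> s) w j" .
    qed
  qed
  show ?thesis
    unfolding is_vcat_def using VHom VId VComp unit assoc by simp
qed

lemma TPrj_1: "TPrj S 1 0 = VId S 1"
proof (rule B_mono)
  show "TPrj S 1 0 \<in> homs V (One V) (VHom S 1 1)" by (rule TPrj) simp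
  show "VId S 1 \<in> homs V (One V) (VHom S 1 1)" by (rule VId)
  show "B 1 1 \<cdot> TPrj S 1 0 = B 1 1 \<cdot> VId S 1"
    unfolding B_VId using B_TPrj[of 0 1] by (simp add: X1)
qed

lemma is_theory_morphism_full: "is_theory_morphism V S (full_theory V X) B"
proof -
  have "vcomp V (full_theory V X) a b c x y
      = vcomp V (self_enriched V) (vpow V X a) (vpow V X b) (vpow V X c) x y" for a b c x y
    by (simp add: vcomp_def full_theory_def)
  then show ?thesis
    unfolding is_theory_morphism_def is_vfunctor_def VOb
    using B_VId B B_vcomp B_TPrj by (simp add: full_theory_def self_enriched_def)
qed

end

section \<open>Natural transformations between powers of an algebra\<close>

context ccc_object
begin

text \<open>The \<open>n\<close>-th power of an algebra on \<open>X\<close> takes the value \<open>(X\<^sup>k)\<^sup>n\<close> at \<open>k\<close>. Its elements are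
  \<open>n \<times> k\<close> matrices over \<open>X\<close>.\<close>

abbreviation powers :: "nat \<Rightarrow> nat \<Rightarrow> 'o" where
  "powers k n \<equiv> vpow V (vpow V X k) n"

text \<open>The morphism \<open>h'\<close> applies \<open>h : X\<^sup>n \<rightarrow> X\<^sup>m\<close> to each of the \<open>k\<close> columns of an \<open>n \<times> k\<close> matrix.\<close>

definition coordinatewise :: "nat \<Rightarrow> nat \<Rightarrow> nat \<Rightarrow> 'a \<Rightarrow> 'a \<Rightarrow> bool" where
  "coordinatewise k n m h h' \<longleftrightarrow>
     h' \<in> homs V (Dom V h) (Exp V (powers k n) (powers k m)) \<and>
     (\<forall>W s y j a. s \<in> homs V W (Dom V h) \<longrightarrow> y \<in> homs V W (powers k n) \<longrightarrow> j < m \<longrightarrow> a < k \<longrightarrow>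
        mat_entry V X m k (eval_at V (powers k n) (powers k m) (h' \<cdot> s) y) j a
        = act n m (h \<cdot> s) (\<lambda>i. mat_entry V X n k y i a) j)"

text \<open>Applying an operation \<open>t\<close> of arity \<open>k\<close> to the rows of an \<open>n \<times> k\<close> matrix and \<open>h\<close> to the results
  is the same as applying \<open>h\<close> to the columns first. Operations \<open>t\<close> with a single value suffice, since
  an element of \<open>T(k, l)\<close> acts by its \<open>l\<close> coordinates.\<close>

definition commutes_with ::
  "('o, 'a) vtheory \<Rightarrow> (nat \<Rightarrow> nat \<Rightarrow> 'a) \<Rightarrow> nat \<Rightarrow> nat \<Rightarrow> 'a \<Rightarrow> bool" where
  "commutes_with T A n m h \<longleftrightarrow>
     (\<forall>W s k t x j. s \<in> homs V W (Dom V h) \<longrightarrow> t \<in> homs V W (VHom T k 1) \<longrightarrow>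
        (\<forall>i < n. \<forall>a < k. x i a \<in> homs V W X) \<longrightarrow> j < m \<longrightarrow>
        act n m (h \<cdot> s) (\<lambda>i. act k 1 (A k 1 \<cdot> t) (x i) 0) j
        = act k 1 (A k 1 \<cdot> t) (\<lambda>a. act n m (h \<cdot> s) (\<lambda>i. x i a) j) 0)"

lemma powers_Obj: "powers k n \<in> Obj V"
  by (intro vpow_Obj X)

lemma coordinatewise_homs:
  "\<lbrakk>coordinatewise k n m h h'; h \<in> homs V W (operations n m)\<rbrakk>
    \<Longrightarrow> h' \<in> homs V W (Exp V (powers k n) (powers k m))"
  by (simp add: coordinatewise_def homs_Dom)

lemma coordinatewise_entry:
  assumes "coordinatewise k n m h h'" "h \<in> homs V W (operations n m)"
    "s \<in> homs V W' W" "y \<in> homs V W' (powers k n)" "j < m" "a < k"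
  shows "mat_entry V X m k (eval_at V (powers k n) (powers k m) (h' \<cdot> s) y) j a
    = act n m (h \<cdot> s) (\<lambda>i. mat_entry V X n k y i a) j"
  using assms by (simp add: coordinatewise_def homs_Dom)

lemma coordinatewiseI:
  assumes "h \<in> homs V W (operations n m)" "h' \<in> homs V W (Exp V (powers k n) (powers k m))"
    and "\<And>W' s y j a. \<lbrakk>s \<in> homs V W' W; y \<in> homs V W' (powers k n); j < m; a < k\<rbrakk> \<Longrightarrow>
      mat_entry V X m k (eval_at V (powers k n) (powers k m) (h' \<cdot> s) y) j a
      = act n m (h \<cdot> s) (\<lambda>i. mat_entry V X n k y i a) j"
  shows "coordinatewise k n m h h'"
  using assms by (simp add: coordinatewise_def homs_Dom)

lemma coordinatewise_exists:
  assumes h: "h \<in> homs V W (operations n m)"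
  obtains h' where "coordinatewise k n m h h'"
proof -
  note W = homs_Obj(1)[OF h]
  let ?a = "\<lambda>s y j a. act n m (h \<cdot> s) (\<lambda>i. mat_entry V X n k y i a) j"
  let ?F = "\<lambda>s y. mat_of V (Dom V s) m k (?a s y)"
  have a: "?a s y j a \<in> homs V W' X"
    if s: "s \<in> homs V W' W" and y: "y \<in> homs V W' (powers k n)" and "j < m" "a < k" for W' s y j a
    using that by (intro act_homs[OF Cmp_homs[OF s h]] mat_entry_homs[OF y])
  have F: "?F s y \<in> homs V W' (powers k m)"
    if s: "s \<in> homs V W' W" and y: "y \<in> homs V W' (powers k n)" for W' s y
    unfolding homs_Dom[OF s] by (rule mat_of_homs[OF homs_Obj(1)[OF s]]) (rule a[OF s y])
  have ent: "mat_entry V X m k (?F s y) j a = ?a s y j a"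
    if s: "s \<in> homs V W' W" and y: "y \<in> homs V W' (powers k n)" and j: "j < m" "a < k" for W' s y j a
    unfolding homs_Dom[OF s]
    by (rule mat_entry_mat_of[OF homs_Obj(1)[OF s] _ j]) (rule a[OF s y])
  have nat: "?F s y \<cdot> r = ?F (s \<cdot> r) (y \<cdot> r)"
    if s: "s \<in> homs V W' W" and y: "y \<in> homs V W' (powers k n)" and r: "r \<in> homs V W'' W'"
    for W' W'' s y r
  proof (rule mat_eqI[OF Cmp_homs[OF r F[OF s y]] F[OF Cmp_homs[OF r s] Cmp_homs[OF r y]]])
    fix j a assume j: "j < m" and a: "a < k"
    have "mat_entry V X m k (?F s y \<cdot> r) j a = ?a s y j a \<cdot> r"
      unfolding mat_entry_Cmp[OF F[OF s y] j a r, symmetric] ent[OF s y j a] ..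
    also have "\<dots> = act n m ((h \<cdot> s) \<cdot> r) (\<lambda>i. mat_entry V X n k y i a \<cdot> r) j"
      by (rule act_Cmp[OF Cmp_homs[OF s h] _ j r]) (rule mat_entry_homs[OF y _ a])
    also have "\<dots> = ?a (s \<cdot> r) (y \<cdot> r) j a"
      unfolding Cmp_assoc[OF r s h] by (rule act_cong) (rule mat_entry_Cmp[OF y _ a r])
    finally show "mat_entry V X m k (?F s y \<cdot> r) j a = mat_entry V X m k (?F (s \<cdot> r) (y \<cdot> r)) j a"
      unfolding ent[OF Cmp_homs[OF r s] Cmp_homs[OF r y] j a] .
  qed
  obtain h' where h': "h' \<in> homs V W (Exp V (powers k n) (powers k m))"
    and ev: "\<And>W' s y. \<lbrakk>s \<in> homs V W' W; y \<in> homs V W' (powers k n)\<rbrakk>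
      \<Longrightarrow> eval_at V (powers k n) (powers k m) (h' \<cdot> s) y = ?F s y"
    by (rule Exp_exists[where F = ?F, OF W powers_Obj[of k n] powers_Obj[of k m]])
      (erule (1) F, erule (2) nat, blast)
  have "coordinatewise k n m h h'"
    by (rule coordinatewiseI[OF h h']) (simp only: ev ent)
  then show ?thesis by (rule that)
qed

lemma coordinatewise_unique:
  assumes h: "h \<in> homs V W (operations n m)"
    and h': "coordinatewise k n m h h'" and h'': "coordinatewise k n m h h''"
  shows "h' = h''"
proof (rule Exp_eqI[OF powers_Obj powers_Obj coordinatewise_homs[OF h' h] coordinatewise_homs[OF h'' h]])
  fix W' s y assume s: "s \<in> homs V W' W" and y: "y \<in> homs V W' (powers k n)"
  show "eval_at V (powers k n) (powers k m) (h' \<cdot> s) y = eval_at V (powers k n) (powers k m) (h'' \<cdot> s) y"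
    by (rule mat_eqI[OF eval_at_homs[OF Cmp_homs[OF s coordinatewise_homs[OF h' h]] y powers_Obj]
          eval_at_homs[OF Cmp_homs[OF s coordinatewise_homs[OF h'' h]] y powers_Obj]])
      (simp only: coordinatewise_entry[OF h' h s y] coordinatewise_entry[OF h'' h s y])
qed

lemma coordinatewise_Cmp:
  assumes h: "h \<in> homs V W (operations n m)" and h': "coordinatewise k n m h h'"
    and r: "r \<in> homs V W' W"
  shows "coordinatewise k n m (h \<cdot> r) (h' \<cdot> r)"
proof (rule coordinatewiseI[OF Cmp_homs[OF r h] Cmp_homs[OF r coordinatewise_homs[OF h' h]]])
  fix W'' s y j a
  assume s: "s \<in> homs V W'' W'" and y: "y \<in> homs V W'' (powers k n)" and j: "j < m" "a < k"
  show "mat_entry V X m k (eval_at V (powers k n) (powers k m) ((h' \<cdot> r) \<cdot> s) y) j a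
    = act n m ((h \<cdot> r) \<cdot> s) (\<lambda>i. mat_entry V X n k y i a) j"
    unfolding Cmp_assoc[OF s r h] Cmp_assoc[OF s r coordinatewise_homs[OF h' h]]
    by (rule coordinatewise_entry[OF h' h Cmp_homs[OF s r] y j])
qed

lemma coordinatewise_1:
  assumes h: "h \<in> homs V W (operations n m)"
  shows "coordinatewise 1 n m h h"
proof (rule coordinatewiseI[OF h])
  show "h \<in> homs V W (Exp V (powers 1 n) (powers 1 m))" using h by (simp add: X1)
  fix W' s y j and a :: nat
  assume s: "s \<in> homs V W' W" and y: "y \<in> homs V W' (powers 1 n)" and j: "j < m" "a < 1"
  have a: "a = 0" using j by simp
  note y = y[unfolded X1] and hs = Cmp_homs[OF s h]
  have "mat_entry V X m 1 (eval_at V (vpow V X n) (vpow V X m) (h \<cdot> s) y) j 0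
    = act n m (h \<cdot> s) (\<lambda>i. vpow_prj V X n i \<cdot> y) j"
    unfolding mat_entry_1[OF eval_at_homs[OF hs y vpow_Obj[OF X]] j(1)]
    by (rule eval_at_eq_act[OF hs y])
  also have "\<dots> = act n m (h \<cdot> s) (\<lambda>i. mat_entry V X n 1 y i 0) j"
    by (rule act_cong) (rule mat_entry_1[OF y, symmetric])
  finally show "mat_entry V X m 1 (eval_at V (powers 1 n) (powers 1 m) (h \<cdot> s) y) j a
    = act n m (h \<cdot> s) (\<lambda>i. mat_entry V X n 1 y i a) j"
    unfolding X1 a .
qed

text \<open>The coordinatewise extension is functorial, so that composition, identities and projections of
  natural transformations may be computed on their components at \<open>1\<close>.\<close>

lemma coordinatewise_self_vcomp:
  assumes g: "g \<in> homs V W (operations m l)" and f: "f \<in> homs V W (operations n m)"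
    and g': "coordinatewise k m l g g'" and f': "coordinatewise k n m f f'"
  shows "coordinatewise k n l
    (vcomp V (self_enriched V) (vpow V X n) (vpow V X m) (vpow V X l) g f)
    (vcomp V (self_enriched V) (powers k n) (powers k m) (powers k l) g' f')"
    (is "coordinatewise k n l ?gf ?gf'")
proof (rule coordinatewiseI)
  note G = coordinatewise_homs[OF g' g] and F = coordinatewise_homs[OF f' f]
  note P = powers_Obj[of k n] powers_Obj[of k m] powers_Obj[of k l]
    and Q = vpow_Obj[OF X, of n] vpow_Obj[OF X, of m] vpow_Obj[OF X, of l]
  show "?gf \<in> homs V W (operations n l)" by (rule self_vcomp_homs[OF Q g f])
  show "?gf' \<in> homs V W (Exp V (powers k n) (powers k l))" by (rule self_vcomp_homs[OF P G F])
  fix W' s y j a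
  assume s: "s \<in> homs V W' W" and y: "y \<in> homs V W' (powers k n)" and j: "j < l" and a: "a < k"
  note gs = Cmp_homs[OF s g] and fs = Cmp_homs[OF s f] and Gs = Cmp_homs[OF s G] and Fs = Cmp_homs[OF s F]
  note e = eval_at_homs[OF Fs y P(2)]
  have "mat_entry V X l k (eval_at V (powers k n) (powers k l) (?gf' \<cdot> s) y) j a
    = mat_entry V X l k (eval_at V (powers k m) (powers k l) (g' \<cdot> s)
        (eval_at V (powers k n) (powers k m) (f' \<cdot> s) y)) j a"
    unfolding self_vcomp_Cmp[OF P G F s] eval_at_self_vcomp[OF P Gs Fs y] ..
  also have "\<dots> = act m l (g \<cdot> s)
      (\<lambda>i. mat_entry V X m k (eval_at V (powers k n) (powers k m) (f' \<cdot> s) y) i a) j"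
    by (rule coordinatewise_entry[OF g' g s e j a])
  also have "\<dots> = act m l (g \<cdot> s) (\<lambda>i. act n m (f \<cdot> s) (\<lambda>i. mat_entry V X n k y i a) i) j"
    by (rule act_cong) (rule coordinatewise_entry[OF f' f s y _ a])
  also have "\<dots> = act n l (?gf \<cdot> s) (\<lambda>i. mat_entry V X n k y i a) j"
    unfolding self_vcomp_Cmp[OF Q g f s]
    by (rule act_self_vcomp[OF gs fs, symmetric]) (rule mat_entry_homs[OF y _ a])
  finally show "mat_entry V X l k (eval_at V (powers k n) (powers k l) (?gf' \<cdot> s) y) j a
    = act n l (?gf \<cdot> s) (\<lambda>i. mat_entry V X n k y i a) j" .
qed

lemma coordinatewise_name_of_Idn:
  "coordinatewise k n n (name_of V (Idn V (vpow V X n))) (name_of V (Idn V (powers k n)))"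
proof (rule coordinatewiseI)
  note i = Idn_homs[OF vpow_Obj[OF X, of n]] and I = Idn_homs[OF powers_Obj[of k n]]
  show h: "name_of V (Idn V (vpow V X n)) \<in> homs V (One V) (operations n n)"
    by (rule name_of_homs[OF i])
  show h': "name_of V (Idn V (powers k n)) \<in> homs V (One V) (Exp V (powers k n) (powers k n))"
    by (rule name_of_homs[OF I])
  fix W s y j a
  assume s: "s \<in> homs V W (One V)" and y: "y \<in> homs V W (powers k n)" and j: "j < n" and a: "a < k"
  note W = homs_Obj(1)[OF s]
  have c: "name_of V f \<cdot> s = at_stage V W (name_of V f)" for f
    unfolding at_stage_def using terminal_unique[OF s] by simp
  show "mat_entry V X n k (eval_at V (powers k n) (powers k n) (name_of V (Idn V (powers k n)) \<cdot> s) y) j a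
    = act n n (name_of V (Idn V (vpow V X n)) \<cdot> s) (\<lambda>i. mat_entry V X n k y i a) j"
    unfolding c eval_at_name_of[OF I y] Idn_Cmp[OF y]
    by (rule act_name_of_Idn[OF W mat_entry_homs[OF y _ a] j, symmetric])
qed

lemma coordinatewise_name_of_prj:
  assumes i: "i < n"
  shows "coordinatewise k n 1 (name_of V (vpow_prj V X n i)) (name_of V (vpow_prj V (vpow V X k) n i))"
proof (rule coordinatewiseI)
  note p = vpow_prj_homs[OF X i] and P = vpow_prj_homs[OF vpow_Obj[OF X, of k] i]
  note X1' = vpow_1[OF vpow_Obj[OF X]]
  show h: "name_of V (vpow_prj V X n i) \<in> homs V (One V) (operations n 1)"
    using name_of_homs[OF p] by (simp add: X1)
  show h': "name_of V (vpow_prj V (vpow V X k) n i) \<in> homs V (One V) (Exp V (powers k n) (powers k 1))"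
    using name_of_homs[OF P] by (simp add: X1')
  fix W s y a and j :: nat
  assume s: "s \<in> homs V W (One V)" and y: "y \<in> homs V W (powers k n)" and j: "j < 1" and a: "a < k"
  note W = homs_Obj(1)[OF s]
  have c: "name_of V f \<cdot> s = at_stage V W (name_of V f)" for f
    unfolding at_stage_def using terminal_unique[OF s] by simp
  have j0: "j = 0" using j by simp
  have "mat_entry V X 1 k (vpow_prj V (vpow V X k) n i \<cdot> y) 0 a = mat_entry V X n k y i a"
    unfolding mat_entry_def vpow_prj_1[OF vpow_Obj[OF X]] Idn_Cmp[OF prj_homs[OF y vpow_Obj[OF X] i]] ..
  also have "\<dots> = act n 1 (at_stage V W (name_of V (vpow_prj V X n i))) (\<lambda>i. mat_entry V X n k y i a) 0"
    by (rule act_name_of_prj[OF W mat_entry_homs[OF y _ a] i, symmetric])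
  finally show "mat_entry V X 1 k (eval_at V (powers k n) (powers k 1)
      (name_of V (vpow_prj V (vpow V X k) n i) \<cdot> s) y) j a
    = act n 1 (name_of V (vpow_prj V X n i) \<cdot> s) (\<lambda>i. mat_entry V X n k y i a) j"
    unfolding c j0 X1' eval_at_name_of[OF P y] .
qed

end

context operation_theory
begin

abbreviation power_algebra :: "nat \<Rightarrow> (nat \<Rightarrow> 'o) \<times> (nat \<Rightarrow> nat \<Rightarrow> 'a)" where
  "power_algebra n \<equiv> alg_pow V S (over_algebra V X B) n"

lemma fst_power_algebra: "fst (power_algebra n) k = powers k n"
  by (simp add: alg_pow_def over_algebra_def)

lemma power_algebra_eval_at:
  shows power_algebra_arr:
      "snd (power_algebra n) k l \<in> homs V (VHom S k l) (Exp V (powers k n) (powers l n))"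
    and power_algebra_homs: "x \<in> homs V W (VHom S k l) \<Longrightarrow>
      snd (power_algebra n) k l \<cdot> x \<in> homs V W (Exp V (powers k n) (powers l n))"
    and power_algebra_entry: "\<lbrakk>x \<in> homs V W (VHom S k l); y \<in> homs V W (powers k n); i < n; b < l\<rbrakk> \<Longrightarrow>
      mat_entry V X n l (eval_at V (powers k n) (powers l n) (snd (power_algebra n) k l \<cdot> x) y) i b
      = act k l (B k l \<cdot> x) (mat_entry V X n k y i) b"
proof -
  let ?D = "VHom S k l" and ?Y = "powers k n"
  let ?P = "Prd V [?D, ?Y]"
  note D = VHom[of k l] and Y = powers_Obj[of k n] and O = vpow_Obj[OF X]
  note p = Prj2_homs(1)[OF D Y] and q = Prj2_homs(2)[OF D Y] and P = Prd2_Obj[OF D Y]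
  let ?f = "\<lambda>i. eval_at V (vpow V X k) (vpow V X l) (B k l \<cdot> Prj V [?D, ?Y] 0)
    (vpow_prj V (vpow V X k) n i \<cdot> Prj V [?D, ?Y] 1)"
  have f: "?f i \<in> homs V ?P (vpow V X l)" if "i < n" for i
    by (rule eval_at_homs[OF B_homs[OF p] prj_homs[OF q O that] O])
  have F: "tuple V ?P n ?f \<in> homs V ?P (powers l n)"
    by (rule tuple_homs[OF P f])
  have c: "snd (power_algebra n) k l = Cur V ?D ?Y (powers l n) (tuple V ?P n ?f)"
    by (simp add: alg_pow_def over_algebra_def eval_at_def Let_def)
  note C = Cur_homs[OF D Y powers_Obj F, folded c]
  show "snd (power_algebra n) k l \<in> homs V (VHom S k l) (Exp V (powers k n) (powers l n))"
    by (rule C)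
  assume x: "x \<in> homs V W (VHom S k l)"
  show "snd (power_algebra n) k l \<cdot> x \<in> homs V W (Exp V (powers k n) (powers l n))"
    by (rule Cmp_homs[OF x C])
  assume y: "y \<in> homs V W (powers k n)" and i: "i < n" and b: "b < l"
  note xy = pair_homs[OF x y]
  have "vpow_prj V (vpow V X l) n i \<cdot> tuple V ?P n ?f \<cdot> pair V x y
    = (vpow_prj V (vpow V X l) n i \<cdot> tuple V ?P n ?f) \<cdot> pair V x y"
    by (rule Cmp_assoc[OF xy F vpow_prj_homs[OF O i], symmetric])
  also have "vpow_prj V (vpow V X l) n i \<cdot> tuple V ?P n ?f = ?f i"
    by (rule prj_tuple[OF P f i])
  also have "?f i \<cdot> pair V x y = eval_at V (vpow V X k) (vpow V X l) (B k l \<cdot> x) (vpow_prj V (vpow V X k) n i \<cdot> y)"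
    unfolding eval_at_Cmp[OF B_homs[OF p] prj_homs[OF q O i] O xy] Cmp_assoc[OF xy p B]
      Cmp_assoc[OF xy q vpow_prj_homs[OF O i]] Prj_pair[OF x y] ..
  finally show "mat_entry V X n l (eval_at V (powers k n) (powers l n) (snd (power_algebra n) k l \<cdot> x) y) i b
      = act k l (B k l \<cdot> x) (mat_entry V X n k y i) b"
    unfolding c eval_at_Cur[OF D Y powers_Obj F x y] mat_entry_def
    by (simp only: eval_at_eq_act[OF B_homs[OF x] prj_homs[OF y O i]])
qed

text \<open>Naturality for the projections \<open>k \<rightarrow> 1\<close> says that \<open>\<phi> k\<close> is \<open>\<phi> 1\<close> in each column; given this,
  naturality for an arbitrary element of \<open>S(k, 1)\<close> says that \<open>\<phi> 1\<close> commutes with it. Conversely these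
  two properties give naturality for elements of \<open>S(k, l)\<close> one coordinate at a time.\<close>

lemma vnatural_iff:
  "is_vnatural V S (self_enriched V) (power_algebra n) (power_algebra m) E \<phi> \<longleftrightarrow>
     \<phi> 1 \<in> homs V E (operations n m) \<and> commutes_with S B n m (\<phi> 1) \<and>
     (\<forall>k. coordinatewise k n m (\<phi> 1) (\<phi> k))"
  (is "?nat \<longleftrightarrow> ?op")
proof
  assume ?nat
  then have E: "E \<in> Obj V"
    and \<phi>: "\<And>k. \<phi> k \<in> homs V E (Exp V (powers k n) (powers k m))"
    and nat: "\<And>k l W t x. \<lbrakk>t \<in> homs V W E; x \<in> homs V W (VHom S k l)\<rbrakk> \<Longrightarrow>
      vcomp V (self_enriched V) (powers k n) (powers l n) (powers l m) (\<phi> l \<cdot> t)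
        (snd (power_algebra n) k l \<cdot> x)
      = vcomp V (self_enriched V) (powers k n) (powers k m) (powers l m)
        (snd (power_algebra m) k l \<cdot> x) (\<phi> k \<cdot> t)"
    unfolding is_vnatural_def VOb fst_power_algebra
    by (simp_all add: self_enriched_def)
  have \<phi>1: "\<phi> 1 \<in> homs V E (operations n m)" using \<phi>[of 1] by (simp add: X1)
  \<comment> \<open>The naturality square for \<open>x : k \<rightarrow> 1\<close>, evaluated at a matrix \<open>y\<close>.\<close>
  have key: "act n m (\<phi> 1 \<cdot> t) (\<lambda>i. act k 1 (B k 1 \<cdot> x) (mat_entry V X n k y i) 0) j
      = act k 1 (B k 1 \<cdot> x) (mat_entry V X m k (eval_at V (powers k n) (powers k m) (\<phi> k \<cdot> t) y) j) 0"
    if t: "t \<in> homs V W E" and x: "x \<in> homs V W (VHom S k 1)" and y: "y \<in> homs V W (powers k n)"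
      and j: "j < m" for W t x k y j
  proof -
    note P = powers_Obj
    note n = power_algebra_homs[OF x, of n] and m = power_algebra_homs[OF x, of m]
    note f1 = Cmp_homs[OF t \<phi>[of 1]] and fk = Cmp_homs[OF t \<phi>[of k]]
    let ?z = "eval_at V (powers k n) (powers 1 n) (snd (power_algebra n) k 1 \<cdot> x) y"
    have z: "?z \<in> homs V W (powers 1 n)" by (rule eval_at_homs[OF n y P])
    have "act n m (\<phi> 1 \<cdot> t) (\<lambda>i. act k 1 (B k 1 \<cdot> x) (mat_entry V X n k y i) 0) j
      = act n m (\<phi> 1 \<cdot> t) (\<lambda>i. mat_entry V X n 1 ?z i 0) j"
      by (rule act_cong) (rule power_algebra_entry[OF x y, symmetric], simp_all)
    also have "\<dots> = mat_entry V X m 1 (eval_at V (powers 1 n) (powers 1 m) (\<phi> 1 \<cdot> t) ?z) j 0"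
      by (rule coordinatewise_entry[OF coordinatewise_1[OF \<phi>1] \<phi>1 t z j, symmetric]) simp
    also have "\<dots> = mat_entry V X m 1 (eval_at V (powers k n) (powers 1 m)
        (vcomp V (self_enriched V) (powers k n) (powers k m) (powers 1 m)
          (snd (power_algebra m) k 1 \<cdot> x) (\<phi> k \<cdot> t)) y) j 0"
      unfolding nat[OF t x, symmetric] eval_at_self_vcomp[OF P P P f1 n y] ..
    also have "\<dots> = mat_entry V X m 1 (eval_at V (powers k m) (powers 1 m) (snd (power_algebra m) k 1 \<cdot> x)
        (eval_at V (powers k n) (powers k m) (\<phi> k \<cdot> t) y)) j 0"
      unfolding eval_at_self_vcomp[OF P P P m fk y] ..
    also have "\<dots> = act k 1 (B k 1 \<cdot> x)
        (mat_entry V X m k (eval_at V (powers k n) (powers k m) (\<phi> k \<cdot> t) y) j) 0"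
      by (rule power_algebra_entry[OF x eval_at_homs[OF fk y P] j]) simp
    finally show ?thesis .
  qed
  \<comment> \<open>Specialize \<open>x\<close> to a projection.\<close>
  have coord: "coordinatewise k n m (\<phi> 1) (\<phi> k)" for k
  proof (rule coordinatewiseI[OF \<phi>1 \<phi>])
    fix W t y j a
    assume t: "t \<in> homs V W E" and y: "y \<in> homs V W (powers k n)" and j: "j < m" and a: "a < k"
    note W = homs_Obj(1)[OF t]
    note e = eval_at_homs[OF Cmp_homs[OF t \<phi>[of k]] y powers_Obj]
    show "mat_entry V X m k (eval_at V (powers k n) (powers k m) (\<phi> k \<cdot> t) y) j a
      = act n m (\<phi> 1 \<cdot> t) (\<lambda>i. mat_entry V X n k y i a) j"
    proof -
      have "act n m (\<phi> 1 \<cdot> t) (\<lambda>i. mat_entry V X n k y i a) j = act n m (\<phi> 1 \<cdot> t)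
          (\<lambda>i. act k 1 (B k 1 \<cdot> at_stage V W (TPrj S k a)) (mat_entry V X n k y i) 0) j"
        by (rule act_cong) (rule act_TPrj[OF W mat_entry_homs[OF y] a, symmetric])
      also have "\<dots> = act k 1 (B k 1 \<cdot> at_stage V W (TPrj S k a))
          (mat_entry V X m k (eval_at V (powers k n) (powers k m) (\<phi> k \<cdot> t) y) j) 0"
        by (rule key[OF t at_stage_homs[OF W TPrj[OF a]] y j])
      also have "\<dots> = mat_entry V X m k (eval_at V (powers k n) (powers k m) (\<phi> k \<cdot> t) y) j a"
        by (rule act_TPrj[OF W mat_entry_homs[OF e j] a])
      finally show ?thesis ..
    qed
  qed
  have "commutes_with S B n m (\<phi> 1)"
    unfolding commutes_with_def homs_Dom[OF \<phi>1]
  proof (intro allI impI)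
    fix W s k t x j
    assume s: "s \<in> homs V W E" and t: "t \<in> homs V W (VHom S k 1)"
      and x: "\<forall>i<n. \<forall>a<k. x i a \<in> homs V W X" and j: "j < m"
    note W = homs_Obj(1)[OF s]
    have x': "\<And>i a. \<lbrakk>i < n; a < k\<rbrakk> \<Longrightarrow> x i a \<in> homs V W X" using x by blast
    let ?y = "mat_of V W n k x"
    have y: "?y \<in> homs V W (powers k n)" by (rule mat_of_homs[OF W x'])
    have e: "\<And>i a. \<lbrakk>i < n; a < k\<rbrakk> \<Longrightarrow> mat_entry V X n k ?y i a = x i a"
      by (rule mat_entry_mat_of[OF W x'])
    have "act n m (\<phi> 1 \<cdot> s) (\<lambda>i. act k 1 (B k 1 \<cdot> t) (x i) 0) j
      = act n m (\<phi> 1 \<cdot> s) (\<lambda>i. act k 1 (B k 1 \<cdot> t) (mat_entry V X n k ?y i) 0) j"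
      by (intro act_cong e[symmetric])
    also have "\<dots> = act k 1 (B k 1 \<cdot> t)
        (mat_entry V X m k (eval_at V (powers k n) (powers k m) (\<phi> k \<cdot> s) ?y) j) 0"
      by (rule key[OF s t y j])
    also have "\<dots> = act k 1 (B k 1 \<cdot> t) (\<lambda>a. act n m (\<phi> 1 \<cdot> s) (\<lambda>i. mat_entry V X n k ?y i a) j) 0"
      by (rule act_cong) (rule coordinatewise_entry[OF coord \<phi>1 s y j])
    also have "\<dots> = act k 1 (B k 1 \<cdot> t) (\<lambda>a. act n m (\<phi> 1 \<cdot> s) (\<lambda>i. x i a) j) 0"
      by (intro act_cong e)
    finally show "act n m (\<phi> 1 \<cdot> s) (\<lambda>i. act k 1 (B k 1 \<cdot> t) (x i) 0) j
      = act k 1 (B k 1 \<cdot> t) (\<lambda>a. act n m (\<phi> 1 \<cdot> s) (\<lambda>i. x i a) j) 0" .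
  qed
  with \<phi>1 coord show ?op by blast
next
  assume ?op
  then have \<phi>1: "\<phi> 1 \<in> homs V E (operations n m)" and com: "commutes_with S B n m (\<phi> 1)"
    and coord: "\<And>k. coordinatewise k n m (\<phi> 1) (\<phi> k)" by auto
  note \<phi> = coordinatewise_homs[OF coord \<phi>1] and E = homs_Obj(1)[OF \<phi>1] and P = powers_Obj
  have com': "act n m (\<phi> 1 \<cdot> s) (\<lambda>i. act k l (B k l \<cdot> t) (x i) b) j
      = act k l (B k l \<cdot> t) (\<lambda>a. act n m (\<phi> 1 \<cdot> s) (\<lambda>i. x i a) j) b"
    if s: "s \<in> homs V W E" and t: "t \<in> homs V W (VHom S k l)"
      and x: "\<And>i a. \<lbrakk>i < n; a < k\<rbrakk> \<Longrightarrow> x i a \<in> homs V W X" and j: "j < m" and b: "b < l"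
    for W s k l t x j b
  proof -
    note W = homs_Obj(1)[OF s]
    let ?u = "vcomp V S k l 1 (at_stage V W (TPrj S l b)) t"
    have u: "?u \<in> homs V W (VHom S k 1)"
      by (rule VComp_vcomp_homs[OF at_stage_homs[OF W TPrj[OF b]] t])
    have "act n m (\<phi> 1 \<cdot> s) (\<lambda>i. act k l (B k l \<cdot> t) (x i) b) j
      = act n m (\<phi> 1 \<cdot> s) (\<lambda>i. act k 1 (B k 1 \<cdot> ?u) (x i) 0) j"
      by (rule act_cong) (rule act_coordinate[OF t x b, symmetric])
    also have "\<dots> = act k 1 (B k 1 \<cdot> ?u) (\<lambda>a. act n m (\<phi> 1 \<cdot> s) (\<lambda>i. x i a) j) 0"
      using com s u x j unfolding commutes_with_def homs_Dom[OF \<phi>1] by blast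
    also have "\<dots> = act k l (B k l \<cdot> t) (\<lambda>a. act n m (\<phi> 1 \<cdot> s) (\<lambda>i. x i a) j) b"
      by (rule act_coordinate[OF t act_homs[OF Cmp_homs[OF s \<phi>1] x j] b])
    finally show ?thesis .
  qed
  have nat: "vcomp V (self_enriched V) (powers k n) (powers l n) (powers l m) (\<phi> l \<cdot> t)
        (snd (power_algebra n) k l \<cdot> x)
      = vcomp V (self_enriched V) (powers k n) (powers k m) (powers l m)
        (snd (power_algebra m) k l \<cdot> x) (\<phi> k \<cdot> t)"
    if t: "t \<in> homs V W E" and x: "x \<in> homs V W (VHom S k l)" for k l W t x
  proof -
    note n = power_algebra_homs[OF x, of n] and m = power_algebra_homs[OF x, of m]
    note n0 = power_algebra_arr[of n k l] and m0 = power_algebra_arr[of m k l]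
    note fl = Cmp_homs[OF t \<phi>[of l]] and fk = Cmp_homs[OF t \<phi>[of k]]
    show ?thesis
    proof (rule Exp_eqI[OF P P self_vcomp_homs[OF P P P fl n] self_vcomp_homs[OF P P P m fk]])
      fix W' s y assume s: "s \<in> homs V W' W" and y: "y \<in> homs V W' (powers k n)"
      note ts = Cmp_homs[OF s t] and xs = Cmp_homs[OF s x]
      note n' = power_algebra_homs[OF xs, of n] and m' = power_algebra_homs[OF xs, of m]
      note fl' = Cmp_homs[OF ts \<phi>[of l]] and fk' = Cmp_homs[OF ts \<phi>[of k]]
      let ?z = "eval_at V (powers k n) (powers l n) (snd (power_algebra n) k l \<cdot> x \<cdot> s) y"
      let ?w = "eval_at V (powers k n) (powers k m) (\<phi> k \<cdot> t \<cdot> s) y"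
      have z: "?z \<in> homs V W' (powers l n)" by (rule eval_at_homs[OF n' y P])
      have w: "?w \<in> homs V W' (powers k m)" by (rule eval_at_homs[OF fk' y P])
      have "eval_at V (powers l n) (powers l m) (\<phi> l \<cdot> t \<cdot> s) ?z
        = eval_at V (powers k m) (powers l m) (snd (power_algebra m) k l \<cdot> x \<cdot> s) ?w"
      proof (rule mat_eqI[OF eval_at_homs[OF fl' z P] eval_at_homs[OF m' w P]])
        fix j b assume j: "j < m" and b: "b < l"
        have "mat_entry V X m l (eval_at V (powers l n) (powers l m) (\<phi> l \<cdot> t \<cdot> s) ?z) j b
          = act n m (\<phi> 1 \<cdot> t \<cdot> s) (\<lambda>i. mat_entry V X n l ?z i b) j"
          by (rule coordinatewise_entry[OF coord \<phi>1 ts z j b])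
        also have "\<dots> = act n m (\<phi> 1 \<cdot> t \<cdot> s) (\<lambda>i. act k l (B k l \<cdot> x \<cdot> s) (mat_entry V X n k y i) b) j"
          by (rule act_cong) (rule power_algebra_entry[OF xs y _ b])
        also have "\<dots> = act k l (B k l \<cdot> x \<cdot> s)
            (\<lambda>a. act n m (\<phi> 1 \<cdot> t \<cdot> s) (\<lambda>i. mat_entry V X n k y i a) j) b"
          by (rule com'[OF ts xs mat_entry_homs[OF y] j b])
        also have "\<dots> = act k l (B k l \<cdot> x \<cdot> s) (mat_entry V X m k ?w j) b"
          by (rule act_cong) (rule coordinatewise_entry[OF coord \<phi>1 ts y j, symmetric])
        also have "\<dots> = mat_entry V X m l
            (eval_at V (powers k m) (powers l m) (snd (power_algebra m) k l \<cdot> x \<cdot> s) ?w) j b"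
          by (rule power_algebra_entry[OF xs w j b, symmetric])
        finally show "mat_entry V X m l (eval_at V (powers l n) (powers l m) (\<phi> l \<cdot> t \<cdot> s) ?z) j b
          = mat_entry V X m l (eval_at V (powers k m) (powers l m) (snd (power_algebra m) k l \<cdot> x \<cdot> s) ?w) j b" .
      qed
      then show "eval_at V (powers k n) (powers l m)
          (vcomp V (self_enriched V) (powers k n) (powers l n) (powers l m) (\<phi> l \<cdot> t)
            (snd (power_algebra n) k l \<cdot> x) \<cdot> s) y
        = eval_at V (powers k n) (powers l m)
          (vcomp V (self_enriched V) (powers k n) (powers k m) (powers l m)
            (snd (power_algebra m) k l \<cdot> x) (\<phi> k \<cdot> t) \<cdot> s) y"
        unfolding self_vcomp_Cmp[OF P P P fl n s] self_vcomp_Cmp[OF P P P m fk s]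
          Cmp_assoc[OF s t \<phi>] Cmp_assoc[OF s x n0] Cmp_assoc[OF s x m0]
          eval_at_self_vcomp[OF P P P fl' n' y] eval_at_self_vcomp[OF P P P m' fk' y] .
    qed
  qed
  show ?nat
    unfolding is_vnatural_def VOb fst_power_algebra using E \<phi> nat by (simp add: self_enriched_def)
qed

end

section \<open>Recognizing commutants\<close>

text \<open>By the Yoneda lemma a morphism that is bijective on generalized elements is invertible: a
  preimage of the identity is a right inverse, and injectivity makes it a left inverse.\<close>

lemma (in category) is_isoI:
  assumes f: "f \<in> homs C A B"
    and surj: "\<And>W y. y \<in> homs C W B \<Longrightarrow> \<exists>x \<in> homs C W A. f \<cdot> x = y"
    and inj: "\<And>W x x'. \<lbrakk>x \<in> homs C W A; x' \<in> homs C W A; f \<cdot> x = f \<cdot> x'\<rbrakk> \<Longrightarrow> x = x'"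
  shows "is_iso C f"
proof -
  note A = Idn_homs[OF homs_Obj(1)[OF f]] and B = Idn_homs[OF homs_Obj(2)[OF f]]
  obtain g where g: "g \<in> homs C B A" and fg: "f \<cdot> g = Idn C B" using surj[OF B] by blast
  have "g \<cdot> f = Idn C A"
  proof (rule inj[OF Cmp_homs[OF f g] A])
    show "f \<cdot> g \<cdot> f = f \<cdot> Idn C A"
      unfolding Cmp_assoc[OF f g f, symmetric] fg Idn_Cmp[OF f] Cmp_Idn[OF f] ..
  qed
  with g fg homs_Arr[OF f] show ?thesis unfolding is_iso_def homs_Dom[OF f] homs_Cod[OF f] by blast
qed

lemma is_nat_object_iso:
  assumes V: "category V"
    and N: "is_nat_object V C D F G N \<nu>" and N': "is_nat_object V C D F G N' \<nu>'"
  obtains i j where "i \<in> homs V N N'" "j \<in> homs V N' N"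
    "j \<cdot>\<^bsub>V\<^esub> i = Idn V N" "i \<cdot>\<^bsub>V\<^esub> j = Idn V N'"
    "\<And>c. c \<in> VOb C \<Longrightarrow> \<nu>' c \<cdot>\<^bsub>V\<^esub> i = \<nu> c" "\<And>c. c \<in> VOb C \<Longrightarrow> \<nu> c \<cdot>\<^bsub>V\<^esub> j = \<nu>' c"
proof -
  interpret category V by (rule V)
  have factor: "\<exists>h. h \<in> homs V K M \<and> (\<forall>c \<in> VOb C. \<mu> c \<cdot>\<^bsub>V\<^esub> h = \<kappa> c)"
    if "is_nat_object V C D F G K \<kappa>" "is_nat_object V C D F G M \<mu>" for K \<kappa> M \<mu>
    using that unfolding is_nat_object_def by blast
  have idn: "k \<cdot>\<^bsub>V\<^esub> h = Idn V K"
    if K: "is_nat_object V C D F G K \<kappa>" and h: "h \<in> homs V K M" and k: "k \<in> homs V M K"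
      and \<mu>h: "\<And>c. c \<in> VOb C \<Longrightarrow> \<mu> c \<cdot>\<^bsub>V\<^esub> h = \<kappa> c"
      and \<kappa>k: "\<And>c. c \<in> VOb C \<Longrightarrow> \<kappa> c \<cdot>\<^bsub>V\<^esub> k = \<mu> c"
    for K \<kappa> M \<mu> h k
  proof -
    have nat: "is_vnatural V C D F G K \<kappa>"
      and unique: "\<exists>!h. h \<in> homs V K K \<and> (\<forall>c \<in> VOb C. \<kappa> c \<cdot>\<^bsub>V\<^esub> h = \<kappa> c)"
      using K unfolding is_nat_object_def by blast+
    have \<kappa>: "\<kappa> c \<in> homs V K (VHom D (fst F c) (fst G c))" if "c \<in> VOb C" for c
      using nat that unfolding is_vnatural_def by blast
    have "\<kappa> c \<cdot>\<^bsub>V\<^esub> k \<cdot>\<^bsub>V\<^esub> h = \<kappa> c" if c: "c \<in> VOb C" for c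
      unfolding Cmp_assoc[OF h k \<kappa>[OF c], symmetric] \<kappa>k[OF c] \<mu>h[OF c] ..
    then show ?thesis
      using unique Cmp_homs[OF h k] Idn_homs[OF homs_Obj(1)[OF h]] Cmp_Idn[OF \<kappa>] by blast
  qed
  obtain i where i: "i \<in> homs V N N'" "\<And>c. c \<in> VOb C \<Longrightarrow> \<nu>' c \<cdot>\<^bsub>V\<^esub> i = \<nu> c"
    using factor[OF N N'] by blast
  obtain j where j: "j \<in> homs V N' N" "\<And>c. c \<in> VOb C \<Longrightarrow> \<nu> c \<cdot>\<^bsub>V\<^esub> j = \<nu>' c"
    using factor[OF N' N] by blast
  show ?thesis
    by (rule that[OF i(1) j(1) idn[OF N i(1) j(1) i(2) j(2)] idn[OF N' j(1) i(1) j(2) i(2)] i(2) j(2)])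
qed

text \<open>As \<open>B'\<close> is monic, functoriality of \<open>G\<close> follows from that of \<open>B = B' G\<close>.\<close>

lemma over_morphismI:
  assumes S: "operation_theory V X S B" and S': "operation_theory V X S' B'"
    and G: "\<And>n m. G n m \<in> homs V (VHom S n m) (VHom S' n m)"
    and BG: "\<And>n m. B' n m \<cdot>\<^bsub>V\<^esub> G n m = B n m"
  shows "is_over_morphism V (S, B) (S', B') G"
proof -
  interpret S: operation_theory V X S B by (rule S)
  interpret S': operation_theory V X S' B' by (rule S')
  have BG': "B' n m \<cdot>\<^bsub>V\<^esub> G n m \<cdot>\<^bsub>V\<^esub> x = B n m \<cdot>\<^bsub>V\<^esub> x" if "x \<in> homs V W (VHom S n m)" for W x n m
    unfolding S.Cmp_assoc[OF that G S'.B, symmetric] BG ..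
  have 1: "G n n \<cdot>\<^bsub>V\<^esub> VId S n = VId S' n" for n
    by (rule S'.B_mono[OF S.Cmp_homs[OF S.VId G] S'.VId]) (simp only: BG'[OF S.VId] S.B_VId S'.B_VId)
  have 2: "G a c \<cdot>\<^bsub>V\<^esub> vcomp V S a b c x y = vcomp V S' a b c (G b c \<cdot>\<^bsub>V\<^esub> x) (G a b \<cdot>\<^bsub>V\<^esub> y)"
    if x: "x \<in> homs V W (VHom S b c)" and y: "y \<in> homs V W (VHom S a b)" for W x y a b c
  proof -
    note xy = S.VComp_vcomp_homs[OF x y] and Gx = S.Cmp_homs[OF x G] and Gy = S.Cmp_homs[OF y G]
    show ?thesis
      by (rule S'.B_mono[OF S.Cmp_homs[OF xy G] S'.VComp_vcomp_homs[OF Gx Gy]])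
        (simp only: BG'[OF xy] S.B_vcomp[OF x y] S'.B_vcomp[OF Gx Gy] BG'[OF x] BG'[OF y])
  qed
  have 3: "G n 1 \<cdot>\<^bsub>V\<^esub> TPrj S n i = TPrj S' n i" if i: "i < n" for n i
    by (rule S'.B_mono[OF S.Cmp_homs[OF S.TPrj[OF i] G] S'.TPrj[OF i]])
      (simp only: BG'[OF S.TPrj[OF i]] S.B_TPrj[OF i] S'.B_TPrj[OF i])
  show ?thesis
    unfolding is_over_morphism_def is_theory_morphism_def is_vfunctor_def fst_conv snd_conv S.VOb S'.VOb
    using 1 2 3 G BG by simp
qed

text \<open>The operations in \<open>S\<close> are those commuting with \<open>T\<close>, at every stage. This is the universal
  property of the commutant of \<open>T\<close>, once natural transformations are replaced by their components
  at \<open>1\<close>.\<close>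

locale commutant_of_operations = ccc_object V X + S: operation_theory V X S B + T: operation_theory V X T A
  for V :: "('o, 'a) ccc" (structure) and X S B T A +
  assumes represents: "h \<in> homs V W (operations n m) \<Longrightarrow>
    commutes_with T A n m h \<longleftrightarrow> (\<exists>x \<in> homs V W (VHom S n m). B n m \<cdot> x = h)"
begin

text \<open>Commutation is a condition on each coordinate of \<open>h\<close> separately, so the operations in \<open>S\<close> are
  closed under tupling.\<close>

lemma represents_tuple:
  assumes h: "h \<in> homs V W (operations n m)"
    and y: "\<And>j. j < m \<Longrightarrow> y j \<in> homs V W (VHom S n 1)"
    and hy: "\<And>W' s z j. \<lbrakk>s \<in> homs V W' W; \<And>i. i < n \<Longrightarrow> z i \<in> homs V W' X; j < m\<rbrakk>
      \<Longrightarrow> act n m (h \<cdot> s) z j = act n 1 ((B n 1 \<cdot> y j) \<cdot> s) z 0"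
  shows "\<exists>x \<in> homs V W (VHom S n m). B n m \<cdot> x = h"
proof -
  have "commutes_with T A n m h"
    unfolding commutes_with_def homs_Dom[OF h]
  proof (intro allI impI)
    fix W' s k t x j
    assume s: "s \<in> homs V W' W" and t: "t \<in> homs V W' (VHom T k 1)"
      and x: "\<forall>i<n. \<forall>a<k. x i a \<in> homs V W' X" and j: "j < m"
    have x': "\<And>i a. \<lbrakk>i < n; a < k\<rbrakk> \<Longrightarrow> x i a \<in> homs V W' X" using x by blast
    note By = S.B_homs[OF y[OF j]]
    have com: "commutes_with T A n 1 (B n 1 \<cdot> y j)"
      using represents[OF By] y[OF j] by blast
    have tx: "\<And>i. i < n \<Longrightarrow> act k 1 (A k 1 \<cdot> t) (x i) 0 \<in> homs V W' X"
      by (rule act_homs[OF T.B_homs[OF t] x']) auto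
    have "act n m (h \<cdot> s) (\<lambda>i. act k 1 (A k 1 \<cdot> t) (x i) 0) j
      = act n 1 ((B n 1 \<cdot> y j) \<cdot> s) (\<lambda>i. act k 1 (A k 1 \<cdot> t) (x i) 0) 0"
      by (rule hy[OF s tx j])
    also have "\<dots> = act k 1 (A k 1 \<cdot> t) (\<lambda>a. act n 1 ((B n 1 \<cdot> y j) \<cdot> s) (\<lambda>i. x i a) 0) 0"
      using com s t x unfolding commutes_with_def homs_Dom[OF By] by blast
    also have "\<dots> = act k 1 (A k 1 \<cdot> t) (\<lambda>a. act n m (h \<cdot> s) (\<lambda>i. x i a) j) 0"
      by (rule act_cong) (rule hy[OF s x' j, symmetric])
    finally show "act n m (h \<cdot> s) (\<lambda>i. act k 1 (A k 1 \<cdot> t) (x i) 0) j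
      = act k 1 (A k 1 \<cdot> t) (\<lambda>a. act n m (h \<cdot> s) (\<lambda>i. x i a) j) 0" .
  qed
  with represents[OF h] show ?thesis by blast
qed

text \<open>The comparison morphism sends an operation to its list of coordinates. It is injective on
  elements because coordinates determine an operation, and surjective by closure under tupling.\<close>

lemma is_conical_power: "is_conical_power V S 1 n n (TPrj S n)"
proof -
  have iso: "is_iso V (tuple V (VHom S c n) n
      (\<lambda>i. vcomp V S c n 1 (at_stage V (VHom S c n) (TPrj S n i)) (Idn V (VHom S c n))))"
    (is "is_iso V ?\<theta>") for c
  proof -
    let ?H = "VHom S c n" and ?H1 = "VHom S c 1"
    note H = S.VHom[of c n] and H1 = S.VHom[of c 1]
    note I = Idn_homs[OF H]
    let ?v = "\<lambda>i. vcomp V S c n 1 (at_stage V ?H (TPrj S n i)) (Idn V ?H)"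
    have v: "?v i \<in> homs V ?H ?H1" if i: "i < n" for i
      by (rule S.VComp_vcomp_homs[OF at_stage_homs[OF H S.TPrj[OF i]] I])
    have \<theta>: "?\<theta> \<in> homs V ?H (vpow V ?H1 n)" by (rule tuple_homs[OF H v])
    have coord: "vpow_prj V ?H1 n i \<cdot> ?\<theta> \<cdot> x = vcomp V S c n 1 (at_stage V W (TPrj S n i)) x"
      if x: "x \<in> homs V W ?H" and i: "i < n" for W x i
    proof -
      have "vpow_prj V ?H1 n i \<cdot> ?\<theta> \<cdot> x = (vpow_prj V ?H1 n i \<cdot> ?\<theta>) \<cdot> x"
        by (rule Cmp_assoc[OF x \<theta> vpow_prj_homs[OF H1 i], symmetric])
      also have "vpow_prj V ?H1 n i \<cdot> ?\<theta> = ?v i" by (rule prj_tuple[OF H v i])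
      also have "?v i \<cdot> x = vcomp V S c n 1 (at_stage V W (TPrj S n i)) x"
        unfolding S.VComp_vcomp_Cmp[OF at_stage_homs[OF H S.TPrj[OF i]] I x]
          at_stage_Cmp[OF x S.TPrj[OF i]] Idn_Cmp[OF x] ..
      finally show ?thesis .
    qed
    have coord_act: "act c 1 (B c 1 \<cdot> (vpow_prj V ?H1 n i \<cdot> ?\<theta> \<cdot> x) \<cdot> s) z 0
        = act c n (B c n \<cdot> x \<cdot> s) z i"
      if x: "x \<in> homs V W ?H" and i: "i < n" and s: "s \<in> homs V W' W"
        and z: "\<And>i. i < c \<Longrightarrow> z i \<in> homs V W' X" for W W' x i s z
    proof -
      note W = homs_Obj(1)[OF x]
      show ?thesis
        unfolding coord[OF x i] S.VComp_vcomp_Cmp[OF at_stage_homs[OF W S.TPrj[OF i]] x s]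
          at_stage_Cmp[OF s S.TPrj[OF i]]
        by (rule S.act_coordinate[OF Cmp_homs[OF s x] z i])
    qed
    show ?thesis
    proof (rule is_isoI[OF \<theta>])
      fix W x x' assume x: "x \<in> homs V W ?H" and x': "x' \<in> homs V W ?H" and eq: "?\<theta> \<cdot> x = ?\<theta> \<cdot> x'"
      show "x = x'"
      proof (rule S.eqI[OF x x'])
        fix W' s z j assume s: "s \<in> homs V W' W" and z: "\<And>i. i < c \<Longrightarrow> z i \<in> homs V W' X" and j: "j < n"
        have "act c n (B c n \<cdot> x \<cdot> s) z j
          = act c 1 (B c 1 \<cdot> (vpow_prj V ?H1 n j \<cdot> ?\<theta> \<cdot> x) \<cdot> s) z 0"
          by (rule coord_act[OF x j s z, symmetric])
        also have "\<dots> = act c n (B c n \<cdot> x' \<cdot> s) z j"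
          unfolding eq by (rule coord_act[OF x' j s z])
        finally show "act c n (B c n \<cdot> x \<cdot> s) z j = act c n (B c n \<cdot> x' \<cdot> s) z j" .
      qed
    next
      fix W y assume y: "y \<in> homs V W (vpow V ?H1 n)"
      note W = homs_Obj(1)[OF y]
      let ?y = "\<lambda>i. vpow_prj V ?H1 n i \<cdot> y"
      have yi: "?y i \<in> homs V W ?H1" if "i < n" for i by (rule prj_homs[OF y H1 that])
      obtain h where h: "h \<in> homs V W (operations c n)"
        and ev: "\<And>W' s z j. \<lbrakk>s \<in> homs V W' W; \<And>i. i < c \<Longrightarrow> z i \<in> homs V W' X; j < n\<rbrakk>
          \<Longrightarrow> act c n (h \<cdot> s) z j = act c 1 ((B c 1 \<cdot> ?y j) \<cdot> s) z 0"
      proof (rule act_exists[where F = "\<lambda>s z j. act c 1 ((B c 1 \<cdot> ?y j) \<cdot> s) z 0", OF W, of c n])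
        fix W' s z j assume s: "s \<in> homs V W' W" and z: "\<And>i. i < c \<Longrightarrow> z i \<in> homs V W' X" and j: "j < n"
        note b = Cmp_homs[OF s S.B_homs[OF yi[OF j]]]
        show "act c 1 ((B c 1 \<cdot> ?y j) \<cdot> s) z 0 \<in> homs V W' X"
          by (rule act_homs[OF b z]) auto
      next
        fix W' W'' s z r j assume s: "s \<in> homs V W' W" and z: "\<And>i. i < c \<Longrightarrow> z i \<in> homs V W' X"
          and r: "r \<in> homs V W'' W'" and j: "j < n"
        note b = S.B_homs[OF yi[OF j]]
        show "act c 1 ((B c 1 \<cdot> ?y j) \<cdot> s) z 0 \<cdot> r
          = act c 1 ((B c 1 \<cdot> ?y j) \<cdot> s \<cdot> r) (\<lambda>i. z i \<cdot> r) 0"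
          unfolding Cmp_assoc[OF r s b, symmetric]
          by (rule act_Cmp[OF Cmp_homs[OF s b] z _ r]) auto
      next
        fix s j and z w :: "nat \<Rightarrow> 'a" assume "\<And>i. i < c \<Longrightarrow> z i = w i"
        then show "act c 1 ((B c 1 \<cdot> ?y j) \<cdot> s) z 0 = act c 1 ((B c 1 \<cdot> ?y j) \<cdot> s) w 0"
          by (rule act_cong)
      qed blast
      obtain x where x: "x \<in> homs V W ?H" and Bx: "B c n \<cdot> x = h"
        using represents_tuple[where y = ?y, OF h] yi ev by blast
      have "?\<theta> \<cdot> x = y"
      proof (rule vpow_eqI[OF H1 Cmp_homs[OF x \<theta>] y])
        fix i assume i: "i < n"
        show "vpow_prj V ?H1 n i \<cdot> ?\<theta> \<cdot> x = ?y i"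
        proof (rule S.eqI[OF prj_homs[OF Cmp_homs[OF x \<theta>] H1 i] yi[OF i]])
          fix W' s z and j :: nat
          assume s: "s \<in> homs V W' W" and z: "\<And>i. i < c \<Longrightarrow> z i \<in> homs V W' X" and "j < 1"
          then have j: "j = 0" by simp
          have "act c 1 (B c 1 \<cdot> (vpow_prj V ?H1 n i \<cdot> ?\<theta> \<cdot> x) \<cdot> s) z 0
            = act c n (B c n \<cdot> x \<cdot> s) z i"
            by (rule coord_act[OF x i s z])
          also have "\<dots> = act c 1 ((B c 1 \<cdot> ?y i) \<cdot> s) z 0"
            unfolding Cmp_assoc[OF s x S.B, symmetric] Bx by (rule ev[OF s z i])
          finally show "act c 1 (B c 1 \<cdot> (vpow_prj V ?H1 n i \<cdot> ?\<theta> \<cdot> x) \<cdot> s) z j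
            = act c 1 (B c 1 \<cdot> ?y i \<cdot> s) z j"
            unfolding j Cmp_assoc[OF s yi[OF i] S.B] .
        qed
      qed
      with x show "\<exists>x \<in> homs V W ?H. ?\<theta> \<cdot> x = y" by blast
    qed
  qed
  show ?thesis
    unfolding is_conical_power_def S.VOb using iso S.TPrj by simp
qed

lemma is_theory_over: "is_theory_over V X S B"
  unfolding is_theory_over_def is_theory_def
  using S.is_vcat S.VOb is_conical_power S.TPrj_1 S.is_theory_morphism_full by blast

definition component :: "nat \<Rightarrow> nat \<Rightarrow> nat \<Rightarrow> 'a" where
  "component n m k = (SOME h. coordinatewise k n m (B n m) h)"

lemma component: "coordinatewise k n m (B n m) (component n m k)"
  unfolding component_def by (rule someI_ex) (metis coordinatewise_exists[OF S.B])

lemma component_1: "component n m 1 = B n m"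
  by (rule coordinatewise_unique[OF S.B component coordinatewise_1[OF S.B]])

lemma component_homs: "component n m k \<in> homs V (VHom S n m) (Exp V (powers k n) (powers k m))"
  by (rule coordinatewise_homs[OF component S.B])

lemma component_Cmp:
  assumes "x \<in> homs V W (VHom S n m)" "coordinatewise k n m (B n m \<cdot> x) h"
  shows "component n m k \<cdot> x = h"
  by (rule coordinatewise_unique[OF S.B_homs[OF assms(1)]
        coordinatewise_Cmp[OF S.B component assms(1)] assms(2)])

text \<open>The component at \<open>1\<close> of a natural family commutes with \<open>T\<close>, hence is an element of \<open>S(n, m)\<close>;
  all other components are determined by it.\<close>

lemma is_nat_object:
  "is_nat_object V T (self_enriched V) (T.power_algebra n) (T.power_algebra m)
     (VHom S n m) (component n m)"
  unfolding is_nat_object_def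
proof (intro conjI allI impI)
  have "commutes_with T A n m (B n m)"
    using represents[OF S.B] Idn_homs[OF S.VHom] Cmp_Idn[OF S.B] by blast
  then show "is_vnatural V T (self_enriched V) (T.power_algebra n) (T.power_algebra m)
      (VHom S n m) (component n m)"
    unfolding T.vnatural_iff component_1 using component S.B by blast
  fix E \<phi>
  assume "is_vnatural V T (self_enriched V) (T.power_algebra n) (T.power_algebra m) E \<phi>"
  then have \<phi>1: "\<phi> 1 \<in> homs V E (operations n m)" and com: "commutes_with T A n m (\<phi> 1)"
    and coord: "\<And>k. coordinatewise k n m (\<phi> 1) (\<phi> k)"
    unfolding T.vnatural_iff by blast+
  obtain x where x: "x \<in> homs V E (VHom S n m)" and Bx: "B n m \<cdot> x = \<phi> 1"
    using represents[OF \<phi>1] com by blast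
  have "component n m k \<cdot> x = \<phi> k" for k
    by (rule component_Cmp[OF x]) (simp only: Bx coord)
  moreover have "y = x" if y: "y \<in> homs V E (VHom S n m)" and "component n m 1 \<cdot> y = \<phi> 1" for y
    by (rule S.B_mono[OF y x]) (use that(2) in \<open>simp only: Bx component_1\<close>)
  ultimately show "\<exists>!h. h \<in> homs V E (VHom S n m) \<and> (\<forall>c\<in>VOb T. component n m c \<cdot> h = \<phi> c)"
    unfolding T.VOb using x by blast
qed

abbreviation "nat_obj n m \<equiv> fst (alg_nat V T (T.power_algebra n) (T.power_algebra m))"
abbreviation "nat_comp n m \<equiv> alg_component V T (T.power_algebra n) (T.power_algebra m)"

lemma alg_nat: "is_nat_object V T (self_enriched V) (T.power_algebra n) (T.power_algebra m)
     (nat_obj n m) (nat_comp n m)"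
  unfolding alg_component_def alg_nat_def
  by (rule someI[where x = "(VHom S n m, component n m)"]) (simp add: is_nat_object)

lemma comparison_exists:
  obtains I J where
    "\<And>n m. I n m \<in> homs V (VHom S n m) (nat_obj n m)"
    "\<And>n m. J n m \<in> homs V (nat_obj n m) (VHom S n m)"
    "\<And>n m. J n m \<cdot> I n m = Idn V (VHom S n m)" "\<And>n m. I n m \<cdot> J n m = Idn V (nat_obj n m)"
    "\<And>n m k. nat_comp n m k \<cdot> I n m = component n m k"
    "\<And>n m k. component n m k \<cdot> J n m = nat_comp n m k"
proof -
  have "\<exists>i j. i \<in> homs V (VHom S n m) (nat_obj n m) \<and> j \<in> homs V (nat_obj n m) (VHom S n m) \<and>
    j \<cdot> i = Idn V (VHom S n m) \<and> i \<cdot> j = Idn V (nat_obj n m) \<and>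
    (\<forall>k. nat_comp n m k \<cdot> i = component n m k) \<and> (\<forall>k. component n m k \<cdot> j = nat_comp n m k)" for n m
    using is_nat_object_iso[OF category_axioms is_nat_object[of n m] alg_nat[of n m]]
    unfolding T.VOb by (metis UNIV_I)
  then show ?thesis using that by metis
qed

text \<open>The object of natural transformations used by the commutant is some representing object, so it
  is isomorphic to \<open>S(n, m)\<close> by \<open>I\<close> and \<open>J\<close>. The identities, composition and projections of the
  commutant are those of \<open>S\<close> transported along these isomorphisms, which makes the commutant a theory
  of operations with the same elements as \<open>S\<close>.\<close>

theorem iso_over_commutant:
  "iso_over V X (S, B) (commutant V X T A, commutant_forget V X T A)"
proof -
  obtain I J where I: "\<And>n m. I n m \<in> homs V (VHom S n m) (nat_obj n m)"
    and J: "\<And>n m. J n m \<in> homs V (nat_obj n m) (VHom S n m)"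
    and JI: "\<And>n m. J n m \<cdot> I n m = Idn V (VHom S n m)" and IJ: "\<And>n m. I n m \<cdot> J n m = Idn V (nat_obj n m)"
    and cI: "\<And>n m k. nat_comp n m k \<cdot> I n m = component n m k"
    and cJ: "\<And>n m k. component n m k \<cdot> J n m = nat_comp n m k"
    by (rule comparison_exists) blast
  let ?C = "commutant V X T A" and ?F = "commutant_forget V X T A"
  have F: "?F n m = B n m \<cdot> J n m" for n m
    unfolding commutant_forget_def Let_def using cJ[of n m 1] by (simp only: component_1)
  have comp: "nat_comp n m k \<in> homs V (nat_obj n m) (Exp V (powers k n) (powers k m))" for n m k
    using Cmp_homs[OF J component_homs, of n m k] by (simp only: cJ)
  have F_homs: "?F n m \<in> homs V (nat_obj n m) (operations n m)" for n m
    unfolding F by (rule S.B_homs[OF J])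
  have J_inj: "x = y" if x: "x \<in> homs V W (nat_obj n m)" and y: "y \<in> homs V W (nat_obj n m)"
    and "J n m \<cdot> x = J n m \<cdot> y" for W x y n m
    using Cmp_assoc[OF x J I] Cmp_assoc[OF y J I] that(3) by (simp add: IJ Idn_Cmp[OF x] Idn_Cmp[OF y])
  have F_mono: "x = y" if x: "x \<in> homs V W (nat_obj n m)" and y: "y \<in> homs V W (nat_obj n m)"
    and "?F n m \<cdot> x = ?F n m \<cdot> y" for W x y n m
    by (rule J_inj[OF x y], rule S.B_mono[OF Cmp_homs[OF x J] Cmp_homs[OF y J]])
      (use that(3) in \<open>simp only: F Cmp_assoc[OF x J S.B] Cmp_assoc[OF y J S.B]\<close>)
  \<comment> \<open>Each structure morphism of the commutant is an induced morphism, identified here.\<close>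
  have induced: "alg_induced V T (T.power_algebra n) (T.power_algebra m) E \<phi> = I n m \<cdot> x"
    if x: "x \<in> homs V E (VHom S n m)" and \<phi>: "\<And>k. coordinatewise k n m (B n m \<cdot> x) (\<phi> k)"
    for n m E \<phi> x
    unfolding alg_induced_def
  proof (rule the_equality)
    have "nat_comp n m k \<cdot> I n m \<cdot> x = \<phi> k" for k
      unfolding Cmp_assoc[OF x I comp, symmetric] cI by (rule component_Cmp[OF x \<phi>])
    then show c: "I n m \<cdot> x \<in> homs V E (nat_obj n m) \<and> (\<forall>k. nat_comp n m k \<cdot> I n m \<cdot> x = \<phi> k)"
      using Cmp_homs[OF x I] by blast
    fix h assume h: "h \<in> homs V E (nat_obj n m) \<and> (\<forall>k. nat_comp n m k \<cdot> h = \<phi> k)"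
    have "nat_comp n m 1 = ?F n m" by (simp add: commutant_forget_def Let_def)
    then show "h = I n m \<cdot> x" using F_mono h c by metis
  qed
  have FI: "?F n m \<cdot> I n m = B n m" for n m
    unfolding F Cmp_assoc[OF I J S.B] JI by (rule Cmp_Idn[OF S.B])
  have FIx: "?F n m \<cdot> I n m \<cdot> x = B n m \<cdot> x" if x: "x \<in> homs V W (VHom S n m)" for W n m x
    unfolding Cmp_assoc[OF x I F_homs, symmetric] FI ..
  have VHomC: "VHom ?C n m = nat_obj n m" for n m
    by (simp add: commutant_def alg_cat_def Let_def)
  have VIdC: "VId ?C n = I n n \<cdot> VId S n" for n
  proof -
    have "VId ?C n = alg_induced V T (T.power_algebra n) (T.power_algebra n) (One V)
        (\<lambda>k. name_of V (Idn V (powers k n)))"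
      by (simp add: commutant_def alg_cat_def Let_def self_enriched_def T.fst_power_algebra)
    also have "\<dots> = I n n \<cdot> VId S n"
      by (rule induced[OF S.VId]) (simp only: S.B_VId coordinatewise_name_of_Idn)
    finally show ?thesis .
  qed
  have TPrjC: "TPrj ?C n i = I n 1 \<cdot> TPrj S n i" if i: "i < n" for n i
  proof -
    have "TPrj ?C n i = alg_induced V T (T.power_algebra n) (T.power_algebra 1) (One V)
        (\<lambda>k. name_of V (vpow_prj V (vpow V X k) n i))"
      by (simp add: commutant_def Let_def)
    also have "\<dots> = I n 1 \<cdot> TPrj S n i"
      by (rule induced[OF S.TPrj[OF i]]) (simp only: S.B_TPrj[OF i] coordinatewise_name_of_prj[OF i])
    finally show ?thesis .
  qed
  let ?p = "\<lambda>n m k. Prj V [nat_obj m k, nat_obj n m] 0" and ?q = "\<lambda>n m k. Prj V [nat_obj m k, nat_obj n m] 1"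
  have O: "nat_obj n m \<in> Obj V" for n m by (rule homs_Obj(1)[OF J])
  note p = Prj2_homs(1)[OF O O] and q = Prj2_homs(2)[OF O O]
  have VCompC: "VComp ?C n m k = I n k \<cdot> vcomp V S n m k (J m k \<cdot> ?p n m k) (J n m \<cdot> ?q n m k)" for n m k
  proof -
    let ?x = "J m k \<cdot> ?p n m k" and ?y = "J n m \<cdot> ?q n m k"
    have x: "?x \<in> homs V (Prd V [nat_obj m k, nat_obj n m]) (VHom S m k)" by (rule Cmp_homs[OF p J])
    have y: "?y \<in> homs V (Prd V [nat_obj m k, nat_obj n m]) (VHom S n m)" by (rule Cmp_homs[OF q J])
    have cx: "nat_comp m k l \<cdot> ?p n m k = component m k l \<cdot> ?x" for l
      unfolding Cmp_assoc[OF p J component_homs, symmetric] cJ ..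
    have cy: "nat_comp n m l \<cdot> ?q n m k = component n m l \<cdot> ?y" for l
      unfolding Cmp_assoc[OF q J component_homs, symmetric] cJ ..
    have "VComp ?C n m k = alg_induced V T (T.power_algebra n) (T.power_algebra k)
       (Prd V [nat_obj m k, nat_obj n m])
       (\<lambda>l. vcomp V (self_enriched V) (powers l n) (powers l m) (powers l k)
         (nat_comp m k l \<cdot> ?p n m k) (nat_comp n m l \<cdot> ?q n m k))"
      by (simp add: commutant_def alg_cat_def Let_def T.fst_power_algebra)
    also have "\<dots> = I n k \<cdot> vcomp V S n m k ?x ?y"
      unfolding cx cy
      by (rule induced[OF S.VComp_vcomp_homs[OF x y]], unfold S.B_vcomp[OF x y],
          rule coordinatewise_self_vcomp[OF S.B_homs[OF x] S.B_homs[OF y]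
            coordinatewise_Cmp[OF S.B component x] coordinatewise_Cmp[OF S.B component y]])
    finally show ?thesis .
  qed
  have VCompC_homs: "VComp ?C n m k \<in> homs V (Prd V [nat_obj m k, nat_obj n m]) (nat_obj n k)" for n m k
    unfolding VCompC
    by (rule Cmp_homs[OF S.VComp_vcomp_homs[OF Cmp_homs[OF p J] Cmp_homs[OF q J]] I])
  have vcompC: "vcomp V ?C n m k x y = I n k \<cdot> vcomp V S n m k (J m k \<cdot> x) (J n m \<cdot> y)"
    if x: "x \<in> homs V W (nat_obj m k)" and y: "y \<in> homs V W (nat_obj n m)" for W x y n m k
  proof -
    have pp: "?p n m k \<in> homs V (Prd V [nat_obj m k, nat_obj n m]) (nat_obj m k)" by (rule p)
    have qq: "?q n m k \<in> homs V (Prd V [nat_obj m k, nat_obj n m]) (nat_obj n m)" by (rule q)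
    note xy = pair_homs[OF x y] and Jp = Cmp_homs[OF pp J] and Jq = Cmp_homs[OF qq J]
    show ?thesis
      unfolding vcomp_def[of V ?C] VCompC Cmp_assoc[OF xy S.VComp_vcomp_homs[OF Jp Jq] I]
        S.VComp_vcomp_Cmp[OF Jp Jq xy] Cmp_assoc[OF xy pp J] Cmp_assoc[OF xy qq J] Prj_pair[OF x y] ..
  qed
  have C: "operation_theory V X ?C ?F"
  proof (unfold_locales, unfold VHomC)
    show "VOb ?C = UNIV" by (simp add: commutant_def Let_def)
    show "nat_obj n m \<in> Obj V" for n m by (rule O)
    show "VId ?C n \<in> homs V (One V) (nat_obj n n)" for n
      unfolding VIdC by (rule Cmp_homs[OF S.VId I])
    show "VComp ?C n m k \<in> homs V (Prd V [nat_obj m k, nat_obj n m]) (nat_obj n k)" for n m k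
      by (rule VCompC_homs)
    show "TPrj ?C n i \<in> homs V (One V) (nat_obj n 1)" if "i < n" for i n
      unfolding TPrjC[OF that] by (rule Cmp_homs[OF S.TPrj[OF that] I])
    show "?F n m \<in> homs V (nat_obj n m) (operations n m)" for n m by (rule F_homs)
    show "x = y" if "x \<in> homs V W (nat_obj n m)" "y \<in> homs V W (nat_obj n m)"
      "?F n m \<cdot> x = ?F n m \<cdot> y" for x W n m y using that by (rule F_mono)
    show "?F n n \<cdot> VId ?C n = name_of V (Idn V (vpow V X n))" for n
      unfolding VIdC FIx[OF S.VId] by (rule S.B_VId)
    show "?F n k \<cdot> vcomp V ?C n m k x y
      = vcomp V (self_enriched V) (vpow V X n) (vpow V X m) (vpow V X k) (?F m k \<cdot> x) (?F n m \<cdot> y)"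
      if x: "x \<in> homs V W (nat_obj m k)" and y: "y \<in> homs V W (nat_obj n m)" for x W m k y n
    proof -
      note Jx = Cmp_homs[OF x J] and Jy = Cmp_homs[OF y J]
      have Fx: "?F m k \<cdot> x = B m k \<cdot> J m k \<cdot> x" unfolding F by (rule Cmp_assoc[OF x J S.B])
      have Fy: "?F n m \<cdot> y = B n m \<cdot> J n m \<cdot> y" unfolding F by (rule Cmp_assoc[OF y J S.B])
      show ?thesis
        unfolding vcompC[OF x y] FIx[OF S.VComp_vcomp_homs[OF Jx Jy]] S.B_vcomp[OF Jx Jy] Fx Fy ..
    qed
    show "?F n 1 \<cdot> TPrj ?C n i = name_of V (vpow_prj V X n i)" if "i < n" for i n
      unfolding TPrjC[OF that] FIx[OF S.TPrj[OF that]] by (rule S.B_TPrj[OF that])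
  qed
  have "commutant_of_operations V X ?C ?F T A"
  proof (intro commutant_of_operations.intro ccc_object_axioms C T.operation_theory_axioms
      commutant_of_operations_axioms.intro, unfold VHomC)
    fix h W n m assume h: "h \<in> homs V W (operations n m)"
    have "(\<exists>x \<in> homs V W (nat_obj n m). ?F n m \<cdot> x = h) \<longleftrightarrow> (\<exists>x \<in> homs V W (VHom S n m). B n m \<cdot> x = h)"
      using FIx F Cmp_assoc[OF _ J S.B] Cmp_homs[OF _ I] Cmp_homs[OF _ J] by metis
    with represents[OF h] show "commutes_with T A n m h \<longleftrightarrow> (\<exists>x \<in> homs V W (nat_obj n m). ?F n m \<cdot> x = h)"
      by blast
  qed
  then have "is_theory_over V X ?C ?F" by (rule commutant_of_operations.is_theory_over)
  moreover have "is_over_morphism V (S, B) (?C, ?F) I"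
    by (rule over_morphismI[OF S.operation_theory_axioms C]) (simp_all only: VHomC I FI)
  moreover have "is_over_morphism V (?C, ?F) (S, B) J"
    by (rule over_morphismI[OF C S.operation_theory_axioms]) (simp_all only: VHomC J F)
  ultimately show ?thesis
    unfolding iso_over_def fst_conv snd_conv VHomC using is_theory_over JI IJ by blast
qed

end

section \<open>Sums in semirings\<close>

context semiring
begin

lemma finsum_swap:
  assumes "finite A" "finite B" "\<And>i j. \<lbrakk>i \<in> A; j \<in> B\<rbrakk> \<Longrightarrow> f i j \<in> carrier R"
  shows "(\<Oplus>i\<in>A. \<Oplus>j\<in>B. f i j) = (\<Oplus>j\<in>B. \<Oplus>i\<in>A. f i j)"
  using assms(1,3)
proof (induction A rule: finite_induct)
  case empty
  then show ?case by (simp add: finsum_zero)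
next
  case (insert a A)
  have "(\<Oplus>j\<in>B. \<Oplus>i\<in>insert a A. f i j) = (\<Oplus>j\<in>B. f a j \<oplus> (\<Oplus>i\<in>A. f i j))"
    by (rule finsum_cong') (use insert in \<open>auto simp: Pi_def intro!: finsum_closed a_closed\<close>)
  also have "\<dots> = (\<Oplus>j\<in>B. f a j) \<oplus> (\<Oplus>j\<in>B. \<Oplus>i\<in>A. f i j)"
    by (rule finsum_addf) (use insert in \<open>auto simp: Pi_def intro!: finsum_closed\<close>)
  finally show ?case
    using insert by (simp add: finsum_insert Pi_def finsum_closed)
qed

text \<open>Associativity of the product of a row, a matrix and a column. It accounts for the composition
  laws of both theories and for their commutation.\<close>

lemma finsum_product_assoc:
  assumes "finite I" "finite J" "\<And>j. j \<in> J \<Longrightarrow> b j \<in> carrier R"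
    and "\<And>j i. \<lbrakk>j \<in> J; i \<in> I\<rbrakk> \<Longrightarrow> a j i \<in> carrier R" "\<And>i. i \<in> I \<Longrightarrow> x i \<in> carrier R"
  shows "(\<Oplus>i\<in>I. (\<Oplus>j\<in>J. b j \<otimes> a j i) \<otimes> x i) = (\<Oplus>j\<in>J. b j \<otimes> (\<Oplus>i\<in>I. a j i \<otimes> x i))"
proof -
  have "(\<Oplus>i\<in>I. (\<Oplus>j\<in>J. b j \<otimes> a j i) \<otimes> x i) = (\<Oplus>i\<in>I. \<Oplus>j\<in>J. b j \<otimes> a j i \<otimes> x i)"
    by (rule finsum_cong') (use assms in \<open>auto simp: finsum_ldistr Pi_def intro!: finsum_closed\<close>)
  also have "\<dots> = (\<Oplus>j\<in>J. \<Oplus>i\<in>I. b j \<otimes> a j i \<otimes> x i)"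
    by (rule finsum_swap) (use assms in auto)
  also have "\<dots> = (\<Oplus>j\<in>J. b j \<otimes> (\<Oplus>i\<in>I. a j i \<otimes> x i))"
  proof (rule finsum_cong')
    fix j assume j: "j \<in> J"
    have "(\<Oplus>i\<in>I. b j \<otimes> a j i \<otimes> x i) = (\<Oplus>i\<in>I. b j \<otimes> (a j i \<otimes> x i))"
      by (rule finsum_cong') (use assms j in \<open>auto simp: m_assoc\<close>)
    then show "(\<Oplus>i\<in>I. b j \<otimes> a j i \<otimes> x i) = b j \<otimes> (\<Oplus>i\<in>I. a j i \<otimes> x i)"
      using assms j by (simp add: finsum_rdistr Pi_def)
  qed (use assms in \<open>auto intro!: finsum_closed\<close>)
  finally show ?thesis .
qed

lemma finsum_delta:
  assumes "finite I" "j \<in> I" "\<And>i. i \<in> I \<Longrightarrow> x i \<in> carrier R"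
  shows "(\<Oplus>i\<in>I. (if j = i then \<one> else \<zero>) \<otimes> x i) = x j"
    and "(\<Oplus>i\<in>I. (if i = j then \<one> else \<zero>) \<otimes> x i) = x j"
    and "(\<Oplus>i\<in>I. x i \<otimes> (if j = i then \<one> else \<zero>)) = x j"
    and "(\<Oplus>i\<in>I. x i \<otimes> (if i = j then \<one> else \<zero>)) = x j"
proof -
  have s: "(\<Oplus>i\<in>I. if j = i then x i else \<zero>) = x j"
    by (rule finsum_singleton) (use assms in auto)
  have e: "(\<Oplus>i\<in>I. g i) = x j" if "\<And>i. i \<in> I \<Longrightarrow> g i = (if j = i then x i else \<zero>)" for g
    unfolding s[symmetric] by (rule finsum_cong') (use assms that in auto)
  show "(\<Oplus>i\<in>I. (if j = i then \<one> else \<zero>) \<otimes> x i) = x j"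
    "(\<Oplus>i\<in>I. (if i = j then \<one> else \<zero>) \<otimes> x i) = x j"
    "(\<Oplus>i\<in>I. x i \<otimes> (if j = i then \<one> else \<zero>)) = x j"
    "(\<Oplus>i\<in>I. x i \<otimes> (if i = j then \<one> else \<zero>)) = x j"
    by (rule e, use assms in auto)+
qed

end

section \<open>Rigs in a cartesian closed category\<close>

lemma hom_ring_simps:
  "carrier (hom_ring V W P) = homs V W (Rob P)" "mult (hom_ring V W P) = gmul V P"
  "one (hom_ring V W P) = gone V P W" "zero (hom_ring V W P) = gzero V P W"
  "add (hom_ring V W P) = gadd V P"
  by (simp_all add: hom_ring_def)

locale rig_object = cartesian_closed V for V :: "('o, 'a) ccc" (structure) +
  fixes P :: "('o, 'a) rig"
  assumes is_rig: "is_rig V P"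
begin

sublocale ccc_object V "Rob P"
  by unfold_locales (use is_rig in \<open>simp add: is_rig_def\<close>)

abbreviation "U \<equiv> Rob P"

lemma rig_homs:
  "Radd P \<in> homs V (Prd V [U, U]) U" "Rmul P \<in> homs V (Prd V [U, U]) U"
  "Rzero P \<in> homs V (One V) U" "Rone P \<in> homs V (One V) U"
  using is_rig by (simp_all add: is_rig_def)

lemma gadd_homs: "\<lbrakk>x \<in> homs V W U; y \<in> homs V W U\<rbrakk> \<Longrightarrow> gadd V P x y \<in> homs V W U"
  unfolding gadd_def by (rule Cmp_homs[OF pair_homs rig_homs(1)])

lemma gmul_homs: "\<lbrakk>x \<in> homs V W U; y \<in> homs V W U\<rbrakk> \<Longrightarrow> gmul V P x y \<in> homs V W U"
  unfolding gmul_def by (rule Cmp_homs[OF pair_homs rig_homs(2)])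

lemma gzero_homs: "W \<in> Obj V \<Longrightarrow> gzero V P W \<in> homs V W U"
  unfolding gzero_def by (rule at_stage_homs[OF _ rig_homs(3)])

lemma gone_homs: "W \<in> Obj V \<Longrightarrow> gone V P W \<in> homs V W U"
  unfolding gone_def by (rule at_stage_homs[OF _ rig_homs(4)])

lemma gdelta_homs: "W \<in> Obj V \<Longrightarrow> gdelta V P W i j \<in> homs V W U"
  unfolding gdelta_def by (simp add: gone_homs gzero_homs)

lemma gadd_Cmp:
  assumes "x \<in> homs V W U" "y \<in> homs V W U" "s \<in> homs V W' W"
  shows "gadd V P x y \<cdot> s = gadd V P (x \<cdot> s) (y \<cdot> s)"
  unfolding gadd_def pair_Cmp[OF assms, symmetric]
  by (rule Cmp_assoc[OF assms(3) pair_homs[OF assms(1,2)] rig_homs(1)])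

lemma gmul_Cmp:
  assumes "x \<in> homs V W U" "y \<in> homs V W U" "s \<in> homs V W' W"
  shows "gmul V P x y \<cdot> s = gmul V P (x \<cdot> s) (y \<cdot> s)"
  unfolding gmul_def pair_Cmp[OF assms, symmetric]
  by (rule Cmp_assoc[OF assms(3) pair_homs[OF assms(1,2)] rig_homs(2)])

lemma gzero_Cmp: "s \<in> homs V W' W \<Longrightarrow> gzero V P W \<cdot> s = gzero V P W'"
  unfolding gzero_def by (rule at_stage_Cmp[OF _ rig_homs(3)])

lemma gone_Cmp: "s \<in> homs V W' W \<Longrightarrow> gone V P W \<cdot> s = gone V P W'"
  unfolding gone_def by (rule at_stage_Cmp[OF _ rig_homs(4)])

lemma gdelta_Cmp: "s \<in> homs V W' W \<Longrightarrow> gdelta V P W i j \<cdot> s = gdelta V P W' i j"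
  unfolding gdelta_def by (simp add: gone_Cmp gzero_Cmp)

lemma semiring_hom_ring:
  assumes W: "W \<in> Obj V"
  shows "semiring (hom_ring V W P)"
proof -
  note [simp] = hom_ring_simps gadd_homs gmul_homs gzero_homs[OF W] gone_homs[OF W]
  have comm: "gadd V P x y = gadd V P y x" if "x \<in> homs V W U" "y \<in> homs V W U" for x y
    using is_rig that unfolding is_rig_def by blast
  have unit: "gadd V P x (gzero V P W) = x"
    "gmul V P x (gone V P W) = x" "gmul V P (gone V P W) x = x"
    "gmul V P x (gzero V P W) = gzero V P W" "gmul V P (gzero V P W) x = gzero V P W"
    if "x \<in> homs V W U" for x
    using is_rig that unfolding is_rig_def by blast+
  have assoc: "gadd V P (gadd V P x y) z = gadd V P x (gadd V P y z)"
    "gmul V P (gmul V P x y) z = gmul V P x (gmul V P y z)"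
    "gmul V P x (gadd V P y z) = gadd V P (gmul V P x y) (gmul V P x z)"
    "gmul V P (gadd V P x y) z = gadd V P (gmul V P x z) (gmul V P y z)"
    if "x \<in> homs V W U" "y \<in> homs V W U" "z \<in> homs V W U" for x y z
    using is_rig that unfolding is_rig_def by blast+
  have unit': "gadd V P (gzero V P W) x = x" if "x \<in> homs V W U" for x
    using unit(1)[OF that] comm[OF that gzero_homs[OF W]] by simp
  show ?thesis
    by (intro semiring.intro abelian_monoidI monoid.intro semiring_axioms.intro; unfold hom_ring_simps)
      (intro gadd_homs gmul_homs gzero_homs gone_homs W comm unit unit' assoc; assumption)+
qed

lemma gsum_homs: "\<lbrakk>W \<in> Obj V; \<And>i. i < n \<Longrightarrow> f i \<in> homs V W U\<rbrakk> \<Longrightarrow> gsum V P W n f \<in> homs V W U"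
  by (induction n) (auto intro: gzero_homs gadd_homs)

lemma gsum_Cmp:
  assumes s: "s \<in> homs V W' W" and f: "\<And>i. i < n \<Longrightarrow> f i \<in> homs V W U"
  shows "gsum V P W n f \<cdot> s = gsum V P W' n (\<lambda>i. f i \<cdot> s)"
  using f
proof (induction n)
  case 0
  show ?case by (simp add: gzero_Cmp[OF s])
next
  case (Suc n)
  have "gsum V P W n f \<in> homs V W U" by (rule gsum_homs[OF homs_Obj(2)[OF s]]) (use Suc.prems in auto)
  then show ?case using Suc by (simp add: gadd_Cmp[OF _ _ s])
qed

lemma gsum_cong: "(\<And>i. i < n \<Longrightarrow> f i = g i) \<Longrightarrow> gsum V P W n f = gsum V P W n g"
  by (induction n) auto

text \<open>At a fixed stage a rig is a semiring in sets, and its sums are finite sums there. This is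
  how the algebraic identities below are obtained.\<close>

lemma gsum_eq_finsum:
  assumes W: "W \<in> Obj V" and f: "\<And>i. i < n \<Longrightarrow> f i \<in> homs V W U"
  shows "gsum V P W n f = finsum (hom_ring V W P) f {..<n}"
  using f
proof (induction n)
  interpret Q: semiring "hom_ring V W P" by (rule semiring_hom_ring[OF W])
  { case 0
    show ?case by (simp add: Q.finsum_empty hom_ring_simps)
  next
    case (Suc n)
    have "finsum (hom_ring V W P) f {..<Suc n}
      = f n \<oplus>\<^bsub>hom_ring V W P\<^esub> finsum (hom_ring V W P) f {..<n}"
      unfolding lessThan_Suc
      by (rule Q.finsum_insert) (use Suc.prems in \<open>auto simp: hom_ring_simps\<close>)
    also have "\<dots> = finsum (hom_ring V W P) f {..<n} \<oplus>\<^bsub>hom_ring V W P\<^esub> f n"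
      by (rule Q.a_comm) (use Suc.prems in \<open>auto simp: hom_ring_simps intro!: Q.finsum_closed[unfolded hom_ring_simps]\<close>)
    finally show ?case using Suc by (simp add: hom_ring_simps) }
qed

lemma gsum_product_assoc:
  assumes W: "W \<in> Obj V" and b: "\<And>j. j < m \<Longrightarrow> b j \<in> homs V W U"
    and a: "\<And>j i. \<lbrakk>j < m; i < n\<rbrakk> \<Longrightarrow> a j i \<in> homs V W U" and x: "\<And>i. i < n \<Longrightarrow> x i \<in> homs V W U"
  shows "gsum V P W n (\<lambda>i. gmul V P (gsum V P W m (\<lambda>j. gmul V P (b j) (a j i))) (x i))
    = gsum V P W m (\<lambda>j. gmul V P (b j) (gsum V P W n (\<lambda>i. gmul V P (a j i) (x i))))"
proof -
  interpret Q: semiring "hom_ring V W P" by (rule semiring_hom_ring[OF W])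
  let ?S = "finsum (hom_ring V W P)"
  have "gsum V P W n (\<lambda>i. gmul V P (gsum V P W m (\<lambda>j. gmul V P (b j) (a j i))) (x i))
    = gsum V P W n (\<lambda>i. gmul V P (?S (\<lambda>j. gmul V P (b j) (a j i)) {..<m}) (x i))"
    by (rule gsum_cong, subst gsum_eq_finsum[OF W]) (auto intro!: gmul_homs b a)
  also have "\<dots> = ?S (\<lambda>i. gmul V P (?S (\<lambda>j. gmul V P (b j) (a j i)) {..<m}) (x i)) {..<n}"
    by (rule gsum_eq_finsum[OF W])
      (auto intro!: gmul_homs b a x Q.finsum_closed[unfolded hom_ring_simps])
  also have "\<dots> = ?S (\<lambda>j. gmul V P (b j) (?S (\<lambda>i. gmul V P (a j i) (x i)) {..<n})) {..<m}"
    using Q.finsum_product_assoc[of "{..<n}" "{..<m}" b a x] a b x by (simp add: hom_ring_simps)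
  also have "\<dots> = gsum V P W m (\<lambda>j. gmul V P (b j) (?S (\<lambda>i. gmul V P (a j i) (x i)) {..<n}))"
    by (rule gsum_eq_finsum[OF W, symmetric])
      (auto intro!: gmul_homs b a x Q.finsum_closed[unfolded hom_ring_simps])
  also have "\<dots> = gsum V P W m (\<lambda>j. gmul V P (b j) (gsum V P W n (\<lambda>i. gmul V P (a j i) (x i))))"
    by (rule gsum_cong, subst gsum_eq_finsum[OF W]) (auto intro!: gmul_homs x a)
  finally show ?thesis .
qed

lemma gsum_gadd:
  assumes W: "W \<in> Obj V" and f: "\<And>i. i < n \<Longrightarrow> f i \<in> homs V W U" and g: "\<And>i. i < n \<Longrightarrow> g i \<in> homs V W U"
  shows "gsum V P W n (\<lambda>i. gadd V P (f i) (g i)) = gadd V P (gsum V P W n f) (gsum V P W n g)"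
proof -
  interpret Q: semiring "hom_ring V W P" by (rule semiring_hom_ring[OF W])
  have "gsum V P W n (\<lambda>i. gadd V P (f i) (g i)) = finsum (hom_ring V W P) (\<lambda>i. gadd V P (f i) (g i)) {..<n}"
    by (rule gsum_eq_finsum[OF W]) (rule gadd_homs[OF f g])
  also have "\<dots> = gadd V P (finsum (hom_ring V W P) f {..<n}) (finsum (hom_ring V W P) g {..<n})"
    using Q.finsum_addf[of f "{..<n}" g] f g by (simp add: hom_ring_simps Pi_def)
  also have "finsum (hom_ring V W P) f {..<n} = gsum V P W n f"
    by (rule gsum_eq_finsum[OF W f, symmetric])
  also have "finsum (hom_ring V W P) g {..<n} = gsum V P W n g"
    by (rule gsum_eq_finsum[OF W g, symmetric])
  finally show ?thesis .
qed

lemma gsum_gmul_right: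
  assumes W: "W \<in> Obj V" and f: "\<And>i. i < n \<Longrightarrow> f i \<in> homs V W U" and g: "g \<in> homs V W U"
  shows "gsum V P W n (\<lambda>i. gmul V P (f i) g) = gmul V P (gsum V P W n f) g"
proof -
  interpret Q: semiring "hom_ring V W P" by (rule semiring_hom_ring[OF W])
  have "gsum V P W n (\<lambda>i. gmul V P (f i) g) = finsum (hom_ring V W P) (\<lambda>i. gmul V P (f i) g) {..<n}"
    by (rule gsum_eq_finsum[OF W]) (rule gmul_homs[OF f g])
  also have "\<dots> = gmul V P (finsum (hom_ring V W P) f {..<n}) g"
    using Q.finsum_ldistr[of "{..<n}" g f] f g by (simp add: hom_ring_simps Pi_def)
  also have "finsum (hom_ring V W P) f {..<n} = gsum V P W n f"
    by (rule gsum_eq_finsum[OF W f, symmetric])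
  finally show ?thesis .
qed

lemma gsum_delta:
  assumes W: "W \<in> Obj V" and x: "\<And>i. i < n \<Longrightarrow> x i \<in> homs V W U" and j: "j < n"
  shows "gsum V P W n (\<lambda>i. gmul V P (gdelta V P W j i) (x i)) = x j"
    and "gsum V P W n (\<lambda>i. gmul V P (gdelta V P W i j) (x i)) = x j"
    and "gsum V P W n (\<lambda>i. gmul V P (x i) (gdelta V P W j i)) = x j"
    and "gsum V P W n (\<lambda>i. gmul V P (x i) (gdelta V P W i j)) = x j"
    and "gsum V P W n (\<lambda>i. gdelta V P W j i) = gone V P W"
proof -
  interpret Q: semiring "hom_ring V W P" by (rule semiring_hom_ring[OF W])
  note d = Q.finsum_delta[where I = "{..<n}" and j = j, unfolded hom_ring_simps, folded gdelta_def]
  have e: "gsum V P W n f = y" if "\<And>i. i < n \<Longrightarrow> f i \<in> homs V W U" "finsum (hom_ring V W P) f {..<n} = y" for f y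
    using gsum_eq_finsum[where f = f, OF W that(1)] that(2) by simp
  show "gsum V P W n (\<lambda>i. gmul V P (gdelta V P W j i) (x i)) = x j"
    "gsum V P W n (\<lambda>i. gmul V P (gdelta V P W i j) (x i)) = x j"
    "gsum V P W n (\<lambda>i. gmul V P (x i) (gdelta V P W j i)) = x j"
    "gsum V P W n (\<lambda>i. gmul V P (x i) (gdelta V P W i j)) = x j"
    by (rule e, blast intro: gmul_homs gdelta_homs W x, rule d; use j x in simp)+
  have "gsum V P W n (\<lambda>i. gmul V P (gdelta V P W j i) (gone V P W)) = gone V P W"
    by (rule e, blast intro: gmul_homs gdelta_homs W gone_homs, rule d; use j in \<open>simp add: gone_homs W\<close>)
  moreover have "gmul V P (gdelta V P W j i) (gone V P W) = gdelta V P W j i" for i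
    using Q.r_one[of "gdelta V P W j i"] by (simp add: hom_ring_simps gdelta_homs W)
  ultimately show "gsum V P W n (\<lambda>i. gdelta V P W j i) = gone V P W" by simp
qed

lemma gadd_gzero:
  assumes x: "x \<in> homs V W U"
  shows "gadd V P x (gzero V P W) = x" "gadd V P (gzero V P W) x = x"
proof -
  interpret Q: semiring "hom_ring V W P" by (rule semiring_hom_ring[OF homs_Obj(1)[OF x]])
  show "gadd V P x (gzero V P W) = x" "gadd V P (gzero V P W) x = x"
    using Q.r_zero[of x] Q.l_zero[of x] x by (simp_all add: hom_ring_simps)
qed

text \<open>For \<open>f x = u\<^sub>0 + \<Sum>\<^sub>b x\<^sub>b u\<^sub>b\<close> and coefficients \<open>a\<^sub>i\<close> with sum \<open>1\<close> this reads
  \<open>\<Sum>\<^sub>i a\<^sub>i f(x\<^sub>i) = f(\<Sum>\<^sub>i a\<^sub>i x\<^sub>i)\<close>: the constant is preserved because \<open>\<Sum>\<^sub>i a\<^sub>i = 1\<close>, and the linear part by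
  associativity.\<close>

lemma affine_pointed_commute:
  assumes W: "W \<in> Obj V" and a: "\<And>i. i < n \<Longrightarrow> a i \<in> homs V W U" and sum: "gsum V P W n a = gone V P W"
    and x: "\<And>i b. \<lbrakk>i < n; b < k\<rbrakk> \<Longrightarrow> x i b \<in> homs V W U" and u0: "u0 \<in> homs V W U"
    and u: "\<And>b. b < k \<Longrightarrow> u b \<in> homs V W U"
  shows "gsum V P W n (\<lambda>i. gmul V P (a i) (gadd V P u0 (gsum V P W k (\<lambda>b. gmul V P (x i b) (u b)))))
    = gadd V P u0 (gsum V P W k (\<lambda>b. gmul V P (gsum V P W n (\<lambda>i. gmul V P (a i) (x i b))) (u b)))"
proof -
  interpret Q: semiring "hom_ring V W P" by (rule semiring_hom_ring[OF W])
  let ?g = "\<lambda>i. gsum V P W k (\<lambda>b. gmul V P (x i b) (u b))"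
  have g: "?g i \<in> homs V W U" if "i < n" for i by (intro gsum_homs W gmul_homs x that u)
  have "gsum V P W n (\<lambda>i. gmul V P (a i) (gadd V P u0 (?g i)))
    = gsum V P W n (\<lambda>i. gadd V P (gmul V P (a i) u0) (gmul V P (a i) (?g i)))"
    by (rule gsum_cong) (use Q.r_distr[unfolded hom_ring_simps] a u0 g in blast)
  also have "\<dots> = gadd V P (gsum V P W n (\<lambda>i. gmul V P (a i) u0)) (gsum V P W n (\<lambda>i. gmul V P (a i) (?g i)))"
    by (rule gsum_gadd[OF W]) (auto intro!: gmul_homs a u0 g)
  also have "gsum V P W n (\<lambda>i. gmul V P (a i) u0) = u0"
    using gsum_gmul_right[where f = a, OF W a u0] sum Q.l_one[of u0] u0 by (simp add: hom_ring_simps)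
  also have "gsum V P W n (\<lambda>i. gmul V P (a i) (?g i))
    = gsum V P W k (\<lambda>b. gmul V P (gsum V P W n (\<lambda>i. gmul V P (a i) (x i b))) (u b))"
    by (rule gsum_product_assoc[OF W a x u, symmetric])
  finally show ?thesis .
qed

end

section \<open>Matrices with rows summing to one\<close>

lemma (in category) factor_eq:
  assumes "m \<in> homs C A B" "h \<in> homs C W A" "m \<cdot> h = f"
    and "\<And>h'. \<lbrakk>h' \<in> homs C W A; m \<cdot> h' = f\<rbrakk> \<Longrightarrow> h' = h"
  shows "factor C m f = h"
proof -
  have "Dom C f = W" using homs_Dom[OF Cmp_homs[OF assms(2,1)]] assms(3) by simp
  then show ?thesis unfolding factor_def homs_Dom[OF assms(1)] using assms by blast
qed

context rig_object
begin

text \<open>A row sums to \<open>1\<close> if and only if it maps the vector of ones to \<open>1\<close>, a property that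
  products inherit.\<close>

lemma gsum_row_product:
  assumes W: "W \<in> Obj V" and b: "\<And>j. j < m \<Longrightarrow> b j \<in> homs V W U"
    and a: "\<And>j i. \<lbrakk>j < m; i < n\<rbrakk> \<Longrightarrow> a j i \<in> homs V W U"
    and sa: "\<And>j. j < m \<Longrightarrow> gsum V P W n (a j) = gone V P W" and sb: "gsum V P W m b = gone V P W"
  shows "gsum V P W n (\<lambda>i. gsum V P W m (\<lambda>j. gmul V P (b j) (a j i))) = gone V P W"
proof -
  interpret Q: semiring "hom_ring V W P" by (rule semiring_hom_ring[OF W])
  have r: "gmul V P x (gone V P W) = x" if "x \<in> homs V W U" for x
    using Q.r_one[of x] that by (simp add: hom_ring_simps)
  have "gsum V P W n (\<lambda>i. gsum V P W m (\<lambda>j. gmul V P (b j) (a j i)))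
    = gsum V P W n (\<lambda>i. gmul V P (gsum V P W m (\<lambda>j. gmul V P (b j) (a j i))) (gone V P W))"
    by (rule gsum_cong, rule r[symmetric]) (intro gsum_homs W gmul_homs a b)
  also have "\<dots> = gsum V P W m (\<lambda>j. gmul V P (b j) (gsum V P W n (\<lambda>i. gmul V P (a j i) (gone V P W))))"
    by (rule gsum_product_assoc[OF W b a gone_homs[OF W]])
  also have "\<dots> = gsum V P W m b"
  proof (rule gsum_cong)
    fix j assume j: "j < m"
    have "gsum V P W n (\<lambda>i. gmul V P (a j i) (gone V P W)) = gsum V P W n (a j)"
      by (rule gsum_cong) (rule r[OF a[OF j]])
    then show "gmul V P (b j) (gsum V P W n (\<lambda>i. gmul V P (a j i) (gone V P W))) = b j"
      using sa[OF j] r[OF b[OF j]] by simp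
  qed
  finally show ?thesis unfolding sb .
qed

lemma VHom_mat_theory: "VHom (mat_theory V P) n m = powers n m"
  by (simp add: mat_theory_def Let_def)

lemma vcomp_mat_theory:
  assumes b: "b \<in> homs V W (powers m l)" and a: "a \<in> homs V W (powers n m)"
  shows vcomp_mat_theory_homs: "vcomp V (mat_theory V P) n m l b a \<in> homs V W (powers n l)"
    and mat_entry_vcomp_mat_theory: "\<lbrakk>k < l; i < n\<rbrakk> \<Longrightarrow>
      mat_entry V U l n (vcomp V (mat_theory V P) n m l b a) k i
      = gsum V P W m (\<lambda>j. gmul V P (mat_entry V U l m b k j) (mat_entry V U m n a j i))"
    and vcomp_mat_theory_Cmp: "s \<in> homs V W' W \<Longrightarrow> vcomp V (mat_theory V P) n m l b a \<cdot> s
      = vcomp V (mat_theory V P) n m l (b \<cdot> s) (a \<cdot> s)"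
proof -
  let ?D = "Prd V [powers m l, powers n m]"
  let ?p = "Prj V [powers m l, powers n m] 0" and ?q = "Prj V [powers m l, powers n m] 1"
  note H = powers_Obj[of m l] powers_Obj[of n m]
  note D = Prd2_Obj[OF H] and p = Prj2_homs(1)[OF H] and q = Prj2_homs(2)[OF H]
  let ?b = "mat_entry V U l m ?p" and ?a = "mat_entry V U m n ?q"
  let ?c = "\<lambda>k i. gsum V P ?D m (\<lambda>j. gmul V P (?b k j) (?a j i))"
  have c: "?c k i \<in> homs V ?D U" if "k < l" "i < n" for k i
    by (intro gsum_homs gmul_homs D mat_entry_homs[OF p] mat_entry_homs[OF q] that)
  have C: "VComp (mat_theory V P) n m l = mat_of V ?D l n ?c"
    by (simp add: mat_theory_def Let_def)
  have C_homs: "VComp (mat_theory V P) n m l \<in> homs V ?D (powers n l)"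
    unfolding C by (rule mat_of_homs[OF D c])
  note ba = pair_homs[OF b a]
  show "vcomp V (mat_theory V P) n m l b a \<in> homs V W (powers n l)"
    unfolding vcomp_def by (rule Cmp_homs[OF ba C_homs])
  show "vcomp V (mat_theory V P) n m l b a \<cdot> s = vcomp V (mat_theory V P) n m l (b \<cdot> s) (a \<cdot> s)"
    if s: "s \<in> homs V W' W"
    unfolding vcomp_def Cmp_assoc[OF s ba C_homs] pair_Cmp[OF b a s] ..
  assume k: "k < l" and i: "i < n"
  have "mat_entry V U l n (vcomp V (mat_theory V P) n m l b a) k i = ?c k i \<cdot> pair V b a"
    unfolding vcomp_def C by (rule mat_entry_mat_of_Cmp[OF ba c k i])
  also have "\<dots> = gsum V P W m (\<lambda>j. gmul V P (?b k j) (?a j i) \<cdot> pair V b a)"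
    by (rule gsum_Cmp[OF ba]) (intro gmul_homs mat_entry_homs[OF p] mat_entry_homs[OF q] k i)
  also have "\<dots> = gsum V P W m (\<lambda>j. gmul V P (mat_entry V U l m b k j) (mat_entry V U m n a j i))"
  proof (rule gsum_cong)
    fix j assume j: "j < m"
    show "gmul V P (?b k j) (?a j i) \<cdot> pair V b a
      = gmul V P (mat_entry V U l m b k j) (mat_entry V U m n a j i)"
      unfolding gmul_Cmp[OF mat_entry_homs[OF p k j] mat_entry_homs[OF q j i] ba]
        mat_entry_Cmp[OF p k j ba] mat_entry_Cmp[OF q j i ba] Prj_pair[OF b a] ..
  qed
  finally show "mat_entry V U l n (vcomp V (mat_theory V P) n m l b a) k i
      = gsum V P W m (\<lambda>j. gmul V P (mat_entry V U l m b k j) (mat_entry V U m n a j i))" .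
qed

end

locale rig_with_equalizers = rig_object +
  assumes has_equalizers: "has_equalizers V"
begin

abbreviation aff :: "nat \<Rightarrow> nat \<Rightarrow> 'a" where
  "aff n m \<equiv> VHom (mat_aff V P) n m"

abbreviation aff_entry :: "nat \<Rightarrow> nat \<Rightarrow> 'b \<Rightarrow> nat \<Rightarrow> nat \<Rightarrow> 'b" where
  "aff_entry n m x \<equiv> mat_entry V U m n (aff_incl V P n m \<cdot> x)"

text \<open>The elements of \<open>Mat\<^sup>a\<^sup>f\<^sup>f(n, m)\<close> are the matrices with row sums \<open>1\<close>, since tuples are compared
  coordinate by coordinate.\<close>

lemma aff_incl_equalizer:
  shows aff_incl_homs: "aff_incl V P n m \<in> homs V (aff n m) (powers n m)"
    and aff_incl_mono: "\<lbrakk>x \<in> homs V W (aff n m); y \<in> homs V W (aff n m);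
      aff_incl V P n m \<cdot> x = aff_incl V P n m \<cdot> y\<rbrakk> \<Longrightarrow> x = y"
    and aff_row_sum: "\<lbrakk>x \<in> homs V W (aff n m); j < m\<rbrakk>
      \<Longrightarrow> gsum V P W n (aff_entry n m x j) = gone V P W"
    and aff_exists: "\<lbrakk>y \<in> homs V W (powers n m);
      \<And>j. j < m \<Longrightarrow> gsum V P W n (mat_entry V U m n y j) = gone V P W\<rbrakk>
      \<Longrightarrow> \<exists>x \<in> homs V W (aff n m). aff_incl V P n m \<cdot> x = y"
proof -
  let ?H = "powers n m" and ?e = "aff_incl V P n m"
  note H = powers_Obj[of n m]
  note I = Idn_homs[OF H]
  let ?a = "mat_entry V U m n (Idn V ?H)"
  let ?F = "tuple V ?H m (\<lambda>j. gsum V P ?H n (?a j))" and ?G = "tuple V ?H m (\<lambda>j. gone V P ?H)"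
  have s: "gsum V P ?H n (?a j) \<in> homs V ?H U" if "j < m" for j
    by (intro gsum_homs H mat_entry_homs[OF I] that)
  have F: "?F \<in> homs V ?H (vpow V U m)" by (rule tuple_homs[OF H s])
  have G: "?G \<in> homs V ?H (vpow V U m)" by (rule tuple_homs[OF H gone_homs[OF H]])
  have "?e = equalizer V ?F ?G" by (simp add: aff_incl_def VHom_mat_theory Let_def)
  then have eq: "is_equalizer V ?F ?G ?e"
    using has_equalizers F G unfolding has_equalizers_def equalizer_def by (metis someI_ex)
  have D: "aff n m = Dom V ?e" by (simp add: mat_aff_def Let_def)
  show e: "?e \<in> homs V (aff n m) ?H"
    using eq unfolding is_equalizer_def D by (simp add: homs_def homs_Dom[OF F])
  have Fe: "?F \<cdot> ?e = ?G \<cdot> ?e" using eq unfolding is_equalizer_def by blast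
  have univ: "\<exists>!h. h \<in> homs V W (aff n m) \<and> ?e \<cdot> h = x"
    if "x \<in> homs V W ?H" "?F \<cdot> x = ?G \<cdot> x" for W x
    using eq that unfolding is_equalizer_def D homs_Dom[OF F] by blast
  have Fy: "vpow_prj V U m j \<cdot> ?F \<cdot> y = gsum V P W n (mat_entry V U m n y j)"
    and Gy: "vpow_prj V U m j \<cdot> ?G \<cdot> y = gone V P W"
    if y: "y \<in> homs V W ?H" and j: "j < m" for W y j
  proof -
    note p = vpow_prj_homs[OF X j]
    have "vpow_prj V U m j \<cdot> ?F \<cdot> y = (vpow_prj V U m j \<cdot> ?F) \<cdot> y"
      by (rule Cmp_assoc[OF y F p, symmetric])
    also have "vpow_prj V U m j \<cdot> ?F = gsum V P ?H n (?a j)" by (rule prj_tuple[OF H s j])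
    also have "\<dots> \<cdot> y = gsum V P W n (\<lambda>i. ?a j i \<cdot> y)"
      by (rule gsum_Cmp[OF y]) (rule mat_entry_homs[OF I j])
    also have "\<dots> = gsum V P W n (mat_entry V U m n y j)"
      by (rule gsum_cong) (simp only: mat_entry_Cmp[OF I j _ y] Idn_Cmp[OF y])
    finally show "vpow_prj V U m j \<cdot> ?F \<cdot> y = gsum V P W n (mat_entry V U m n y j)" .
    have "vpow_prj V U m j \<cdot> ?G \<cdot> y = (vpow_prj V U m j \<cdot> ?G) \<cdot> y"
      by (rule Cmp_assoc[OF y G p, symmetric])
    also have "vpow_prj V U m j \<cdot> ?G = gone V P ?H" by (rule prj_tuple[OF H gone_homs[OF H] j])
    also have "\<dots> \<cdot> y = gone V P W" by (rule gone_Cmp[OF y])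
    finally show "vpow_prj V U m j \<cdot> ?G \<cdot> y = gone V P W" .
  qed
  have Fex: "?F \<cdot> ?e \<cdot> x = ?G \<cdot> ?e \<cdot> x" if "x \<in> homs V W (aff n m)" for W x
    unfolding Cmp_assoc[OF that e F, symmetric] Cmp_assoc[OF that e G, symmetric] Fe ..
  show "x = y" if x: "x \<in> homs V W (aff n m)" and "y \<in> homs V W (aff n m)" "?e \<cdot> x = ?e \<cdot> y"
    using univ[OF Cmp_homs[OF x e] Fex[OF x]] that by metis
  show "gsum V P W n (aff_entry n m x j) = gone V P W" if x: "x \<in> homs V W (aff n m)" and j: "j < m"
    using Fy[OF Cmp_homs[OF x e] j] Gy[OF Cmp_homs[OF x e] j] Fex[OF x] by simp
  show "\<exists>x \<in> homs V W (aff n m). ?e \<cdot> x = y" if y: "y \<in> homs V W ?H"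
    and sum: "\<And>j. j < m \<Longrightarrow> gsum V P W n (mat_entry V U m n y j) = gone V P W"
  proof -
    have "?F \<cdot> y = ?G \<cdot> y"
      by (rule vpow_eqI[OF X Cmp_homs[OF y F] Cmp_homs[OF y G]]) (simp only: Fy[OF y] Gy[OF y] sum)
    then show ?thesis using univ[OF y] by blast
  qed
qed

lemma aff_entry_homs:
  "\<lbrakk>x \<in> homs V W (aff n m); j < m; i < n\<rbrakk> \<Longrightarrow> aff_entry n m x j i \<in> homs V W U"
  by (rule mat_entry_homs[OF Cmp_homs[OF _ aff_incl_homs]])

lemma aff_entry_Cmp:
  assumes x: "x \<in> homs V W (aff n m)" and j: "j < m" and i: "i < n" and s: "s \<in> homs V W' W"
  shows "aff_entry n m x j i \<cdot> s = aff_entry n m (x \<cdot> s) j i"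
  unfolding mat_entry_Cmp[OF Cmp_homs[OF x aff_incl_homs] j i s] Cmp_assoc[OF s x aff_incl_homs] ..

lemma aff_eqI:
  assumes x: "x \<in> homs V W (aff n m)" and y: "y \<in> homs V W (aff n m)"
    and "\<And>j i. \<lbrakk>j < m; i < n\<rbrakk> \<Longrightarrow> aff_entry n m x j i = aff_entry n m y j i"
  shows "x = y"
  by (rule aff_incl_mono[OF x y], rule mat_eqI[OF Cmp_homs[OF x aff_incl_homs] Cmp_homs[OF y aff_incl_homs]])
    (rule assms(3))

lemma aff_of_entries:
  assumes W: "W \<in> Obj V" and a: "\<And>j i. \<lbrakk>j < m; i < n\<rbrakk> \<Longrightarrow> a j i \<in> homs V W U"
    and sum: "\<And>j. j < m \<Longrightarrow> gsum V P W n (a j) = gone V P W"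
  shows "\<exists>x \<in> homs V W (aff n m). \<forall>j < m. \<forall>i < n. aff_entry n m x j i = a j i"
proof -
  have e: "mat_entry V U m n (mat_of V W m n a) j i = a j i" if "j < m" "i < n" for j i
    by (rule mat_entry_mat_of[OF W a that])
  have "\<exists>x \<in> homs V W (aff n m). aff_incl V P n m \<cdot> x = mat_of V W m n a"
  proof (rule aff_exists[OF mat_of_homs[OF W a]])
    fix j assume j: "j < m"
    have "gsum V P W n (mat_entry V U m n (mat_of V W m n a) j) = gsum V P W n (a j)"
      by (rule gsum_cong) (rule e[OF j])
    then show "gsum V P W n (mat_entry V U m n (mat_of V W m n a) j) = gone V P W"
      using sum[OF j] by simp
  qed
  with e show ?thesis by force
qed

lemma aff_factor:
  assumes y: "y \<in> homs V W (powers n m)"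
    and sum: "\<And>j. j < m \<Longrightarrow> gsum V P W n (mat_entry V U m n y j) = gone V P W"
  shows aff_factor_homs: "factor V (aff_incl V P n m) y \<in> homs V W (aff n m)"
    and aff_incl_factor: "aff_incl V P n m \<cdot> factor V (aff_incl V P n m) y = y"
proof -
  obtain x where x: "x \<in> homs V W (aff n m)" and xy: "aff_incl V P n m \<cdot> x = y"
    using aff_exists[OF y sum] by blast
  have "factor V (aff_incl V P n m) y = x"
    by (rule factor_eq[OF aff_incl_homs x xy], rule aff_incl_mono[OF _ x], assumption) (simp only: xy)
  with x xy show "factor V (aff_incl V P n m) y \<in> homs V W (aff n m)"
    "aff_incl V P n m \<cdot> factor V (aff_incl V P n m) y = y" by simp_all
qed

lemma mat_aff_over:
  shows mat_aff_over_homs: "mat_aff_over V P n m \<in> homs V (aff n m) (operations n m)"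
    and act_mat_aff_over: "\<lbrakk>x \<in> homs V W (aff n m); \<And>i. i < n \<Longrightarrow> z i \<in> homs V W U; j < m\<rbrakk> \<Longrightarrow>
      act n m (mat_aff_over V P n m \<cdot> x) z j
      = gsum V P W n (\<lambda>i. gmul V P (aff_entry n m x j i) (z i))"
proof -
  let ?H = "aff n m" and ?Y = "vpow V U n"
  let ?D = "Prd V [?H, ?Y]" and ?p = "Prj V [aff n m, vpow V U n] 0" and ?q = "Prj V [aff n m, vpow V U n] 1"
  note H = homs_Obj(1)[OF aff_incl_homs[of n m]] and Y = vpow_Obj[OF X, of n]
  note D = Prd2_Obj[OF H Y] and p = Prj2_homs(1)[OF H Y] and q = Prj2_homs(2)[OF H Y]
  let ?f = "\<lambda>j i. gmul V P (aff_entry n m ?p j i) (vpow_prj V U n i \<cdot> ?q)"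
  let ?F = "\<lambda>j. gsum V P ?D n (?f j)"
  have f: "?f j i \<in> homs V ?D U" if "j < m" "i < n" for j i
    by (intro gmul_homs aff_entry_homs p prj_homs[OF q X] that)
  have F: "?F j \<in> homs V ?D U" if "j < m" for j by (intro gsum_homs D f that)
  have c: "mat_aff_over V P n m = Cur V ?H ?Y (vpow V U m) (tuple V ?D m ?F)"
    by (simp add: mat_aff_over_def Let_def)
  show "mat_aff_over V P n m \<in> homs V (aff n m) (operations n m)"
    unfolding c by (rule Cur_tuple_homs[OF H F])
  assume x: "x \<in> homs V W (aff n m)" and z: "\<And>i. i < n \<Longrightarrow> z i \<in> homs V W U" and j: "j < m"
  have tz: "tuple V W n z \<in> homs V W (vpow V U n)" by (rule tuple_homs[OF homs_Obj(1)[OF x] z])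
  note xz = pair_homs[OF x tz]
  have "act n m (mat_aff_over V P n m \<cdot> x) z j = ?F j \<cdot> pair V x (tuple V W n z)"
    unfolding c by (rule act_Cur_tuple[OF H F x z j])
  also have "\<dots> = gsum V P W n (\<lambda>i. ?f j i \<cdot> pair V x (tuple V W n z))"
    by (rule gsum_Cmp[OF xz f[OF j]])
  also have "\<dots> = gsum V P W n (\<lambda>i. gmul V P (aff_entry n m x j i) (z i))"
  proof (rule gsum_cong)
    fix i assume i: "i < n"
    have zi: "(vpow_prj V U n i \<cdot> ?q) \<cdot> pair V x (tuple V W n z) = z i"
      by (rule prj_Prj_pair_tuple[OF x z i])
    show "?f j i \<cdot> pair V x (tuple V W n z) = gmul V P (aff_entry n m x j i) (z i)"
      unfolding gmul_Cmp[OF aff_entry_homs[OF p j i] prj_homs[OF q X i] xz] zi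
        aff_entry_Cmp[OF p j i xz] Prj_pair[OF x tz] ..
  qed
  finally show "act n m (mat_aff_over V P n m \<cdot> x) z j
      = gsum V P W n (\<lambda>i. gmul V P (aff_entry n m x j i) (z i))" .
qed

text \<open>Identities and projections are both matrices whose \<open>j\<close>-th row is a unit vector, with position
  \<open>p j\<close>.\<close>

lemma aff_delta_factor:
  assumes p: "\<And>j. j < m \<Longrightarrow> p j < n"
  defines "d \<equiv> factor V (aff_incl V P n m) (mat_of V (One V) m n (\<lambda>j. gdelta V P (One V) (p j)))"
  shows aff_delta_factor_homs: "d \<in> homs V (One V) (aff n m)"
    and aff_delta_factor_entry: "\<lbrakk>s \<in> homs V W (One V); j < m; i < n\<rbrakk>
      \<Longrightarrow> aff_entry n m (d \<cdot> s) j i = gdelta V P W (p j) i"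
proof -
  let ?y = "mat_of V (One V) m n (\<lambda>j. gdelta V P (One V) (p j))"
  note \<delta> = gdelta_homs[OF One_Obj]
  have y: "?y \<in> homs V (One V) (powers n m)" by (rule mat_of_homs[OF One_Obj \<delta>])
  have e: "mat_entry V U m n ?y j i = gdelta V P (One V) (p j) i" if "j < m" "i < n" for j i
    by (rule mat_entry_mat_of[OF One_Obj \<delta> that])
  have sum: "gsum V P (One V) n (mat_entry V U m n ?y j) = gone V P (One V)" if j: "j < m" for j
  proof -
    have "gsum V P (One V) n (mat_entry V U m n ?y j) = gsum V P (One V) n (\<lambda>i. gdelta V P (One V) (p j) i)"
      by (rule gsum_cong) (rule e[OF j])
    also have "\<dots> = gone V P (One V)"
      by (rule gsum_delta(5)[OF One_Obj gzero_homs[OF One_Obj] p[OF j]])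
    finally show ?thesis .
  qed
  show h: "d \<in> homs V (One V) (aff n m)"
    unfolding d_def by (rule aff_factor_homs[OF y sum])
  assume s: "s \<in> homs V W (One V)" and j: "j < m" and i: "i < n"
  have "aff_entry n m d j i = gdelta V P (One V) (p j) i"
    unfolding d_def using aff_incl_factor[OF y sum] e[OF j i] by simp
  then show "aff_entry n m (d \<cdot> s) j i = gdelta V P W (p j) i"
    using aff_entry_Cmp[OF h j i s] gdelta_Cmp[OF s] by simp
qed

lemma mat_aff_VId:
  shows mat_aff_VId_homs: "VId (mat_aff V P) n \<in> homs V (One V) (aff n n)"
    and mat_aff_VId_entry: "\<lbrakk>s \<in> homs V W (One V); j < n; i < n\<rbrakk>
      \<Longrightarrow> aff_entry n n (VId (mat_aff V P) n \<cdot> s) j i = gdelta V P W j i"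
proof -
  have c: "VId (mat_aff V P) n = factor V (aff_incl V P n n) (mat_of V (One V) n n (\<lambda>j. gdelta V P (One V) j))"
    by (simp add: mat_aff_def mat_theory_def Let_def)
  show "VId (mat_aff V P) n \<in> homs V (One V) (aff n n)"
    unfolding c by (rule aff_delta_factor_homs)
  show "aff_entry n n (VId (mat_aff V P) n \<cdot> s) j i = gdelta V P W j i"
    if "s \<in> homs V W (One V)" "j < n" "i < n"
    unfolding c by (rule aff_delta_factor_entry[OF _ that])
qed

lemma mat_aff_TPrj:
  assumes k: "k < n"
  shows mat_aff_TPrj_homs: "TPrj (mat_aff V P) n k \<in> homs V (One V) (aff n 1)"
    and mat_aff_TPrj_entry: "\<lbrakk>s \<in> homs V W (One V); i < n\<rbrakk>
      \<Longrightarrow> aff_entry n 1 (TPrj (mat_aff V P) n k \<cdot> s) 0 i = gdelta V P W k i"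
proof -
  have c: "TPrj (mat_aff V P) n k
      = factor V (aff_incl V P n 1) (mat_of V (One V) 1 n (\<lambda>_. gdelta V P (One V) k))"
    by (simp add: mat_aff_def mat_theory_def Let_def)
  show "TPrj (mat_aff V P) n k \<in> homs V (One V) (aff n 1)"
    unfolding c by (rule aff_delta_factor_homs[where p = "\<lambda>_. k", OF k])
  show "aff_entry n 1 (TPrj (mat_aff V P) n k \<cdot> s) 0 i = gdelta V P W k i"
    if "s \<in> homs V W (One V)" "i < n"
    unfolding c by (rule aff_delta_factor_entry[where p = "\<lambda>_. k", OF k that(1) _ that(2)]) simp_all
qed

lemma mat_aff_VComp:
  shows mat_aff_VComp_homs: "VComp (mat_aff V P) n m l \<in> homs V (Prd V [aff m l, aff n m]) (aff n l)"
    and mat_aff_vcomp_entry: "\<lbrakk>x \<in> homs V W (aff m l); y \<in> homs V W (aff n m); k < l; i < n\<rbrakk> \<Longrightarrow>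
      aff_entry n l (vcomp V (mat_aff V P) n m l x y) k i
      = gsum V P W m (\<lambda>j. gmul V P (aff_entry m l x k j) (aff_entry n m y j i))"
proof -
  let ?D = "Prd V [aff m l, aff n m]"
  let ?p = "Prj V [aff m l, aff n m] 0" and ?q = "Prj V [aff m l, aff n m] 1"
  note H = homs_Obj(1)[OF aff_incl_homs[of m l]] homs_Obj(1)[OF aff_incl_homs[of n m]]
  note D = Prd2_Obj[OF H] and p = Prj2_homs(1)[OF H] and q = Prj2_homs(2)[OF H]
  note ip = Cmp_homs[OF p aff_incl_homs] and iq = Cmp_homs[OF q aff_incl_homs]
  let ?y = "vcomp V (mat_theory V P) n m l (aff_incl V P m l \<cdot> ?p) (aff_incl V P n m \<cdot> ?q)"
  note y = vcomp_mat_theory_homs[OF ip iq]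
  have sum: "gsum V P ?D n (mat_entry V U l n ?y k) = gone V P ?D" if k: "k < l" for k
  proof -
    have "gsum V P ?D n (mat_entry V U l n ?y k)
      = gsum V P ?D n (\<lambda>i. gsum V P ?D m (\<lambda>j. gmul V P (aff_entry m l ?p k j) (aff_entry n m ?q j i)))"
      by (rule gsum_cong) (rule mat_entry_vcomp_mat_theory[OF ip iq k])
    also have "\<dots> = gone V P ?D"
      by (rule gsum_row_product[OF D aff_entry_homs[OF p k] aff_entry_homs[OF q]
            aff_row_sum[OF q] aff_row_sum[OF p k]])
    finally show ?thesis .
  qed
  have c: "VComp (mat_aff V P) n m l = factor V (aff_incl V P n l) ?y"
    by (simp add: mat_aff_def Let_def)
  show h: "VComp (mat_aff V P) n m l \<in> homs V ?D (aff n l)"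
    unfolding c by (rule aff_factor_homs[OF y sum])
  assume x: "x \<in> homs V W (aff m l)" and z: "y \<in> homs V W (aff n m)" and k: "k < l" and i: "i < n"
  note xz = pair_homs[OF x z]
  have "aff_incl V P n l \<cdot> vcomp V (mat_aff V P) n m l x y = (aff_incl V P n l \<cdot> VComp (mat_aff V P) n m l) \<cdot> pair V x y"
    unfolding vcomp_def[of V "mat_aff V P"] by (rule Cmp_assoc[OF xz h aff_incl_homs, symmetric])
  also have "aff_incl V P n l \<cdot> VComp (mat_aff V P) n m l = ?y"
    unfolding c by (rule aff_incl_factor[OF y sum])
  also have "?y \<cdot> pair V x y = vcomp V (mat_theory V P) n m l (aff_incl V P m l \<cdot> x) (aff_incl V P n m \<cdot> y)"
    unfolding vcomp_mat_theory_Cmp[OF ip iq xz] Cmp_assoc[OF xz p aff_incl_homs]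
      Cmp_assoc[OF xz q aff_incl_homs] Prj_pair[OF x z] ..
  finally show "aff_entry n l (vcomp V (mat_aff V P) n m l x y) k i
      = gsum V P W m (\<lambda>j. gmul V P (aff_entry m l x k j) (aff_entry n m y j i))"
    using mat_entry_vcomp_mat_theory[OF Cmp_homs[OF x aff_incl_homs] Cmp_homs[OF z aff_incl_homs] k i] by simp
qed

text \<open>The action is faithful because the \<open>i\<close>-th column of a matrix is its value at the \<open>i\<close>-th unit
  vector.\<close>

lemma mat_aff_operation_theory: "operation_theory V U (mat_aff V P) (mat_aff_over V P)"
proof unfold_locales
  show "VOb (mat_aff V P) = UNIV" by (simp add: mat_aff_def Let_def)
  show "aff n m \<in> Obj V" for n m by (rule homs_Obj(1)[OF aff_incl_homs])
  show "VId (mat_aff V P) n \<in> homs V (One V) (aff n n)" for n by (rule mat_aff_VId_homs)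
  show VC: "VComp (mat_aff V P) n m k \<in> homs V (Prd V [aff m k, aff n m]) (aff n k)" for n m k
    by (rule mat_aff_VComp_homs)
  show "TPrj (mat_aff V P) n i \<in> homs V (One V) (aff n 1)" if "i < n" for i n
    by (rule mat_aff_TPrj_homs[OF that])
  show B: "mat_aff_over V P n m \<in> homs V (aff n m) (operations n m)" for n m by (rule mat_aff_over_homs)
  show "x = y" if x: "x \<in> homs V W (aff n m)" and y: "y \<in> homs V W (aff n m)"
    and eq: "mat_aff_over V P n m \<cdot> x = mat_aff_over V P n m \<cdot> y" for x W n m y
  proof (rule aff_eqI[OF x y])
    note W = homs_Obj(1)[OF x]
    have ent: "act n m (mat_aff_over V P n m \<cdot> w) (\<lambda>i'. gdelta V P W i i') j = aff_entry n m w j i"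
      if w: "w \<in> homs V W (aff n m)" and j: "j < m" and i: "i < n" for w j i
      unfolding act_mat_aff_over[where z = "\<lambda>i'. gdelta V P W i i'", OF w gdelta_homs[OF W] j]
      by (rule gsum_delta(3)[OF W aff_entry_homs[OF w j] i])
    fix j i assume "j < m" "i < n"
    then show "aff_entry n m x j i = aff_entry n m y j i" using ent[OF x] ent[OF y] eq by metis
  qed
  show "mat_aff_over V P n n \<cdot> VId (mat_aff V P) n = name_of V (Idn V (vpow V U n))" for n
  proof (rule act_eqI[OF Cmp_homs[OF mat_aff_VId_homs B] name_of_homs[OF Idn_homs[OF vpow_Obj[OF X]]]])
    fix W s z j assume s: "s \<in> homs V W (One V)" and z: "\<And>i. i < n \<Longrightarrow> z i \<in> homs V W U" and j: "j < n"
    note W = homs_Obj(1)[OF s]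
    have "act n n ((mat_aff_over V P n n \<cdot> VId (mat_aff V P) n) \<cdot> s) z j
      = gsum V P W n (\<lambda>i. gmul V P (aff_entry n n (VId (mat_aff V P) n \<cdot> s) j i) (z i))"
      unfolding Cmp_assoc[OF s mat_aff_VId_homs B]
      by (rule act_mat_aff_over[OF Cmp_homs[OF s mat_aff_VId_homs] z j])
    also have "\<dots> = gsum V P W n (\<lambda>i. gmul V P (gdelta V P W j i) (z i))"
      by (rule gsum_cong) (simp only: mat_aff_VId_entry[OF s j])
    also have "\<dots> = z j" by (rule gsum_delta(1)[OF W z j])
    also have "\<dots> = act n n (name_of V (Idn V (vpow V U n)) \<cdot> s) z j"
      unfolding Cmp_One_eq_at_stage[OF s] by (rule act_name_of_Idn[OF W z j, symmetric])
    finally show "act n n ((mat_aff_over V P n n \<cdot> VId (mat_aff V P) n) \<cdot> s) z j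
      = act n n (name_of V (Idn V (vpow V U n)) \<cdot> s) z j" .
  qed
  show "mat_aff_over V P n 1 \<cdot> TPrj (mat_aff V P) n i = name_of V (vpow_prj V U n i)" if i: "i < n" for n i
  proof (rule act_eqI[OF Cmp_homs[OF mat_aff_TPrj_homs[OF i] B]])
    show "name_of V (vpow_prj V U n i) \<in> homs V (One V) (operations n 1)"
      using name_of_homs[OF vpow_prj_homs[OF X i]] by (simp add: X1)
    fix W s z and j :: nat
    assume s: "s \<in> homs V W (One V)" and z: "\<And>i. i < n \<Longrightarrow> z i \<in> homs V W U" and "j < 1"
    then have j: "j = 0" by simp
    note W = homs_Obj(1)[OF s]
    have "act n 1 ((mat_aff_over V P n 1 \<cdot> TPrj (mat_aff V P) n i) \<cdot> s) z 0
      = gsum V P W n (\<lambda>i'. gmul V P (aff_entry n 1 (TPrj (mat_aff V P) n i \<cdot> s) 0 i') (z i'))"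
      unfolding Cmp_assoc[OF s mat_aff_TPrj_homs[OF i] B]
      by (rule act_mat_aff_over[OF Cmp_homs[OF s mat_aff_TPrj_homs[OF i]] z]) simp_all
    also have "\<dots> = gsum V P W n (\<lambda>i'. gmul V P (gdelta V P W i i') (z i'))"
      by (rule gsum_cong) (simp only: mat_aff_TPrj_entry[OF i s])
    also have "\<dots> = z i" by (rule gsum_delta(1)[OF W z i])
    also have "\<dots> = act n 1 (name_of V (vpow_prj V U n i) \<cdot> s) z 0"
      unfolding Cmp_One_eq_at_stage[OF s] by (rule act_name_of_prj[OF W z i, symmetric])
    finally show "act n 1 ((mat_aff_over V P n 1 \<cdot> TPrj (mat_aff V P) n i) \<cdot> s) z j
      = act n 1 (name_of V (vpow_prj V U n i) \<cdot> s) z j" unfolding j .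
  qed
  show "mat_aff_over V P n k \<cdot> vcomp V (mat_aff V P) n m k x y
    = vcomp V (self_enriched V) (vpow V U n) (vpow V U m) (vpow V U k)
        (mat_aff_over V P m k \<cdot> x) (mat_aff_over V P n m \<cdot> y)"
    if x: "x \<in> homs V W (aff m k)" and y: "y \<in> homs V W (aff n m)" for x W m k y n
  proof (rule act_eqI[OF Cmp_homs[OF vcomp_homs[OF VC x y] B]
        self_vcomp_homs[OF vpow_Obj[OF X] vpow_Obj[OF X] vpow_Obj[OF X] Cmp_homs[OF x B] Cmp_homs[OF y B]]])
    fix W' s z l assume s: "s \<in> homs V W' W" and z: "\<And>i. i < n \<Longrightarrow> z i \<in> homs V W' U" and l: "l < k"
    note W' = homs_Obj(1)[OF s] and xs = Cmp_homs[OF s x] and ys = Cmp_homs[OF s y]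
    note O = vpow_Obj[OF X, of n] vpow_Obj[OF X, of m] vpow_Obj[OF X, of k]
    let ?b = "aff_entry m k (x \<cdot> s) l" and ?a = "aff_entry n m (y \<cdot> s)"
    have yz: "act n m (mat_aff_over V P n m \<cdot> y \<cdot> s) z j = gsum V P W' n (\<lambda>i. gmul V P (?a j i) (z i))"
      if "j < m" for j
      by (rule act_mat_aff_over[OF ys z that])
    have "act n k ((mat_aff_over V P n k \<cdot> vcomp V (mat_aff V P) n m k x y) \<cdot> s) z l
      = gsum V P W' n (\<lambda>i. gmul V P (aff_entry n k (vcomp V (mat_aff V P) n m k (x \<cdot> s) (y \<cdot> s)) l i) (z i))"
      unfolding Cmp_assoc[OF s vcomp_homs[OF VC x y] B] vcomp_restrict[OF VC x y s]
      by (rule act_mat_aff_over[OF vcomp_homs[OF VC xs ys] z l])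
    also have "\<dots> = gsum V P W' n (\<lambda>i. gmul V P (gsum V P W' m (\<lambda>j. gmul V P (?b j) (?a j i))) (z i))"
      by (rule gsum_cong) (simp only: mat_aff_vcomp_entry[OF xs ys l])
    also have "\<dots> = gsum V P W' m (\<lambda>j. gmul V P (?b j) (gsum V P W' n (\<lambda>i. gmul V P (?a j i) (z i))))"
      by (rule gsum_product_assoc[OF W' aff_entry_homs[OF xs l] aff_entry_homs[OF ys] z])
    also have "\<dots> = gsum V P W' m (\<lambda>j. gmul V P (?b j) (act n m (mat_aff_over V P n m \<cdot> y \<cdot> s) z j))"
      by (rule gsum_cong) (simp only: yz)
    also have "\<dots> = act m k (mat_aff_over V P m k \<cdot> x \<cdot> s) (act n m (mat_aff_over V P n m \<cdot> y \<cdot> s) z) l"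
      by (rule act_mat_aff_over[OF xs _ l, symmetric]) (rule act_homs[OF Cmp_homs[OF ys B] z])
    also have "\<dots> = act n k (vcomp V (self_enriched V) (vpow V U n) (vpow V U m) (vpow V U k)
        (mat_aff_over V P m k \<cdot> x) (mat_aff_over V P n m \<cdot> y) \<cdot> s) z l"
      unfolding self_vcomp_Cmp[OF O Cmp_homs[OF x B] Cmp_homs[OF y B] s] Cmp_assoc[OF s x B] Cmp_assoc[OF s y B]
      by (rule act_self_vcomp[OF Cmp_homs[OF xs B] Cmp_homs[OF ys B] z, symmetric])
    finally show "act n k ((mat_aff_over V P n k \<cdot> vcomp V (mat_aff V P) n m k x y) \<cdot> s) z l
      = act n k (vcomp V (self_enriched V) (vpow V U n) (vpow V U m) (vpow V U k)
        (mat_aff_over V P m k \<cdot> x) (mat_aff_over V P n m \<cdot> y) \<cdot> s) z l" .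
  qed
qed

end

section \<open>Operations of pointed modules\<close>

context rig_object
begin

text \<open>Substituting \<open>u\<^sub>j\<^sub>0 + \<Sum>\<^sub>i z\<^sub>i u\<^sub>j\<^sub>i\<close> for the \<open>j\<close>-th variable of \<open>v\<^sub>0 + \<Sum>\<^sub>j y\<^sub>j v\<^sub>j\<close>: the left hand side has
  the coefficients that define composition of pointed module operations.\<close>

lemma pointed_substitution:
  assumes W: "W \<in> Obj V" and v0: "v0 \<in> homs V W U" and v: "\<And>j. j < m \<Longrightarrow> v j \<in> homs V W U"
    and u0: "\<And>j. j < m \<Longrightarrow> u0 j \<in> homs V W U"
    and u: "\<And>j i. \<lbrakk>j < m; i < n\<rbrakk> \<Longrightarrow> u j i \<in> homs V W U" and z: "\<And>i. i < n \<Longrightarrow> z i \<in> homs V W U"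
  shows "gadd V P (gadd V P v0 (gsum V P W m (\<lambda>j. gmul V P (u0 j) (v j))))
      (gsum V P W n (\<lambda>i. gmul V P (z i) (gsum V P W m (\<lambda>j. gmul V P (u j i) (v j)))))
    = gadd V P v0 (gsum V P W m (\<lambda>j. gmul V P
        (gadd V P (u0 j) (gsum V P W n (\<lambda>i. gmul V P (z i) (u j i)))) (v j)))"
proof -
  interpret Q: semiring "hom_ring V W P" by (rule semiring_hom_ring[OF W])
  let ?S0 = "gsum V P W m (\<lambda>j. gmul V P (u0 j) (v j))"
  let ?r = "\<lambda>j. gsum V P W n (\<lambda>i. gmul V P (z i) (u j i))"
  have S0: "?S0 \<in> homs V W U" by (intro gsum_homs W gmul_homs u0 v)
  have r: "?r j \<in> homs V W U" if "j < m" for j by (intro gsum_homs W gmul_homs z u that)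
  have S1: "gsum V P W m (\<lambda>j. gmul V P (?r j) (v j)) \<in> homs V W U" by (intro gsum_homs W gmul_homs r v)
  have "gsum V P W m (\<lambda>j. gmul V P (gadd V P (u0 j) (?r j)) (v j))
    = gsum V P W m (\<lambda>j. gadd V P (gmul V P (u0 j) (v j)) (gmul V P (?r j) (v j)))"
    by (rule gsum_cong) (use Q.l_distr[unfolded hom_ring_simps] u0 r v in blast)
  also have "\<dots> = gadd V P ?S0 (gsum V P W m (\<lambda>j. gmul V P (?r j) (v j)))"
    by (rule gsum_gadd[OF W]) (auto intro!: gmul_homs u0 v r)
  finally have "gadd V P v0 (gsum V P W m (\<lambda>j. gmul V P (gadd V P (u0 j) (?r j)) (v j)))
    = gadd V P (gadd V P v0 ?S0) (gsum V P W m (\<lambda>j. gmul V P (?r j) (v j)))"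
    using Q.a_assoc[of v0 ?S0 "gsum V P W m (\<lambda>j. gmul V P (?r j) (v j))"] v0 S0 S1
    by (simp add: hom_ring_simps)
  also have "gsum V P W m (\<lambda>j. gmul V P (?r j) (v j))
    = gsum V P W n (\<lambda>i. gmul V P (z i) (gsum V P W m (\<lambda>j. gmul V P (u j i) (v j))))"
    by (rule gsum_product_assoc[OF W z u v])
  finally show ?thesis by simp
qed

abbreviation ptd :: "nat \<Rightarrow> nat \<Rightarrow> 'o" where
  "ptd n m \<equiv> VHom (mat_op_pointed V P) n m"

abbreviation ptd_entry :: "nat \<Rightarrow> nat \<Rightarrow> 'a \<Rightarrow> nat \<Rightarrow> nat \<Rightarrow> 'a" where
  "ptd_entry n m \<equiv> mat_entry V U m (1 + n)"

lemma ptd_eq: "ptd n m = powers (1 + n) m"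
  by (simp add: mat_op_pointed_def Let_def)

lemma ptd_Obj: "ptd n m \<in> Obj V"
  unfolding ptd_eq by (rule powers_Obj)

lemma ptd_entry_homs: "\<lbrakk>x \<in> homs V W (ptd n m); j < m; i < 1 + n\<rbrakk> \<Longrightarrow> ptd_entry n m x j i \<in> homs V W U"
  unfolding ptd_eq by (rule mat_entry_homs)

lemma ptd_entry_Cmp:
  "\<lbrakk>x \<in> homs V W (ptd n m); j < m; i < 1 + n; s \<in> homs V W' W\<rbrakk>
    \<Longrightarrow> ptd_entry n m x j i \<cdot> s = ptd_entry n m (x \<cdot> s) j i"
  unfolding ptd_eq by (rule mat_entry_Cmp)

lemma ptd_of_entries:
  assumes W: "W \<in> Obj V" and a: "\<And>j i. \<lbrakk>j < m; i < 1 + n\<rbrakk> \<Longrightarrow> a j i \<in> homs V W U"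
  shows "\<exists>x \<in> homs V W (ptd n m). \<forall>j < m. \<forall>i < 1 + n. ptd_entry n m x j i = a j i"
proof (intro bexI allI impI)
  show "mat_of V W m (1 + n) a \<in> homs V W (ptd n m)" unfolding ptd_eq by (rule mat_of_homs[OF W a])
  show "ptd_entry n m (mat_of V W m (1 + n) a) j i = a j i" if "j < m" "i < 1 + n" for j i
    by (rule mat_entry_mat_of[OF W a that])
qed

lemma mat_op_pointed_over:
  shows mat_op_pointed_over_homs: "mat_op_pointed_over V P n m \<in> homs V (ptd n m) (operations n m)"
    and act_mat_op_pointed_over: "\<lbrakk>x \<in> homs V W (ptd n m); \<And>i. i < n \<Longrightarrow> z i \<in> homs V W U; j < m\<rbrakk> \<Longrightarrow>
      act n m (mat_op_pointed_over V P n m \<cdot> x) z j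
      = gadd V P (ptd_entry n m x j 0) (gsum V P W n (\<lambda>i. gmul V P (z i) (ptd_entry n m x j (Suc i))))"
proof -
  let ?H = "ptd n m" and ?Y = "vpow V U n"
  let ?D = "Prd V [?H, ?Y]" and ?p = "Prj V [ptd n m, vpow V U n] 0" and ?q = "Prj V [ptd n m, vpow V U n] 1"
  note H = ptd_Obj[of n m] and Y = vpow_Obj[OF X, of n]
  note D = Prd2_Obj[OF H Y] and p = Prj2_homs(1)[OF H Y] and q = Prj2_homs(2)[OF H Y]
  let ?f = "\<lambda>j i. gmul V P (vpow_prj V U n i \<cdot> ?q) (ptd_entry n m ?p j (Suc i))"
  let ?F = "\<lambda>j. gadd V P (ptd_entry n m ?p j 0) (gsum V P ?D n (?f j))"
  have f: "?f j i \<in> homs V ?D U" if "j < m" "i < n" for j i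
    by (intro gmul_homs ptd_entry_homs p prj_homs[OF q X]) (use that in simp_all)
  have S: "gsum V P ?D n (?f j) \<in> homs V ?D U" if "j < m" for j by (intro gsum_homs D f that)
  have z0: "ptd_entry n m ?p j 0 \<in> homs V ?D U" if "j < m" for j
    by (rule ptd_entry_homs[OF p that]) simp
  have F: "?F j \<in> homs V ?D U" if "j < m" for j by (intro gadd_homs S z0 that)
  have c: "mat_op_pointed_over V P n m = Cur V ?H ?Y (vpow V U m) (tuple V ?D m ?F)"
    by (simp add: mat_op_pointed_over_def Let_def)
  show "mat_op_pointed_over V P n m \<in> homs V (ptd n m) (operations n m)"
    unfolding c by (rule Cur_tuple_homs[OF H F])
  assume x: "x \<in> homs V W (ptd n m)" and z: "\<And>i. i < n \<Longrightarrow> z i \<in> homs V W U" and j: "j < m"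
  have tz: "tuple V W n z \<in> homs V W (vpow V U n)" by (rule tuple_homs[OF homs_Obj(1)[OF x] z])
  note xz = pair_homs[OF x tz]
  have "act n m (mat_op_pointed_over V P n m \<cdot> x) z j = ?F j \<cdot> pair V x (tuple V W n z)"
    unfolding c by (rule act_Cur_tuple[OF H F x z j])
  also have "\<dots> = gadd V P (ptd_entry n m ?p j 0 \<cdot> pair V x (tuple V W n z))
      (gsum V P ?D n (?f j) \<cdot> pair V x (tuple V W n z))"
    by (rule gadd_Cmp[OF z0[OF j] S[OF j] xz])
  also have "ptd_entry n m ?p j 0 \<cdot> pair V x (tuple V W n z) = ptd_entry n m x j 0"
    using ptd_entry_Cmp[OF p j _ xz, of 0] Prj_pair[OF x tz] by simp
  also have "gsum V P ?D n (?f j) \<cdot> pair V x (tuple V W n z)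
    = gsum V P W n (\<lambda>i. ?f j i \<cdot> pair V x (tuple V W n z))"
    by (rule gsum_Cmp[OF xz f[OF j]])
  also have "\<dots> = gsum V P W n (\<lambda>i. gmul V P (z i) (ptd_entry n m x j (Suc i)))"
  proof (rule gsum_cong)
    fix i assume i: "i < n"
    then have i': "Suc i < 1 + n" by simp
    have zi: "(vpow_prj V U n i \<cdot> ?q) \<cdot> pair V x (tuple V W n z) = z i"
      by (rule prj_Prj_pair_tuple[OF x z i])
    show "?f j i \<cdot> pair V x (tuple V W n z) = gmul V P (z i) (ptd_entry n m x j (Suc i))"
      unfolding gmul_Cmp[OF prj_homs[OF q X i] ptd_entry_homs[OF p j i'] xz] zi
        ptd_entry_Cmp[OF p j i' xz] Prj_pair[OF x tz] ..
  qed
  finally show "act n m (mat_op_pointed_over V P n m \<cdot> x) z j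
      = gadd V P (ptd_entry n m x j 0) (gsum V P W n (\<lambda>i. gmul V P (z i) (ptd_entry n m x j (Suc i))))" .
qed

lemma mat_op_pointed_VId:
  shows mat_op_pointed_VId_homs: "VId (mat_op_pointed V P) n \<in> homs V (One V) (ptd n n)"
    and mat_op_pointed_VId_entry: "\<lbrakk>s \<in> homs V W (One V); j < n; i < 1 + n\<rbrakk>
      \<Longrightarrow> ptd_entry n n (VId (mat_op_pointed V P) n \<cdot> s) j i = gdelta V P W (Suc j) i"
proof -
  have c: "VId (mat_op_pointed V P) n = mat_of V (One V) n (1 + n) (\<lambda>j. gdelta V P (One V) (Suc j))"
    by (simp add: mat_op_pointed_def Let_def)
  show "VId (mat_op_pointed V P) n \<in> homs V (One V) (ptd n n)"
    unfolding c ptd_eq by (rule mat_of_homs[OF One_Obj gdelta_homs[OF One_Obj]])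
  assume s: "s \<in> homs V W (One V)" and ji: "j < n" "i < 1 + n"
  show "ptd_entry n n (VId (mat_op_pointed V P) n \<cdot> s) j i = gdelta V P W (Suc j) i"
    unfolding c gdelta_Cmp[OF s, symmetric] by (rule mat_entry_mat_of_Cmp[OF s gdelta_homs[OF One_Obj] ji])
qed

lemma mat_op_pointed_TPrj:
  shows mat_op_pointed_TPrj_homs: "TPrj (mat_op_pointed V P) n k \<in> homs V (One V) (ptd n 1)"
    and mat_op_pointed_TPrj_entry: "\<lbrakk>s \<in> homs V W (One V); i < 1 + n\<rbrakk>
      \<Longrightarrow> ptd_entry n 1 (TPrj (mat_op_pointed V P) n k \<cdot> s) 0 i = gdelta V P W (Suc k) i"
proof -
  have c: "TPrj (mat_op_pointed V P) n k = mat_of V (One V) 1 (1 + n) (\<lambda>_. gdelta V P (One V) (Suc k))"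
    by (simp add: mat_op_pointed_def Let_def)
  show "TPrj (mat_op_pointed V P) n k \<in> homs V (One V) (ptd n 1)"
    unfolding c ptd_eq by (rule mat_of_homs[OF One_Obj gdelta_homs[OF One_Obj]])
  assume s: "s \<in> homs V W (One V)" and i: "i < 1 + n"
  show "ptd_entry n 1 (TPrj (mat_op_pointed V P) n k \<cdot> s) 0 i = gdelta V P W (Suc k) i"
    unfolding c gdelta_Cmp[OF s, symmetric]
    by (rule mat_entry_mat_of_Cmp[OF s gdelta_homs[OF One_Obj] _ i]) simp
qed

lemma mat_op_pointed_VComp:
  shows mat_op_pointed_VComp_homs:
      "VComp (mat_op_pointed V P) n m l \<in> homs V (Prd V [ptd m l, ptd n m]) (ptd n l)"
    and mat_op_pointed_vcomp_entry: "\<lbrakk>x \<in> homs V W (ptd m l); y \<in> homs V W (ptd n m); k < l; i < 1 + n\<rbrakk> \<Longrightarrow>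
      ptd_entry n l (vcomp V (mat_op_pointed V P) n m l x y) k i
      = (let s = gsum V P W m (\<lambda>j. gmul V P (ptd_entry n m y j i) (ptd_entry m l x k (Suc j)))
         in if i = 0 then gadd V P (ptd_entry m l x k 0) s else s)"
proof -
  let ?D = "Prd V [ptd m l, ptd n m]"
  let ?p = "Prj V [ptd m l, ptd n m] 0" and ?q = "Prj V [ptd m l, ptd n m] 1"
  note H = ptd_Obj[of m l] ptd_Obj[of n m]
  note D = Prd2_Obj[OF H] and p = Prj2_homs(1)[OF H] and q = Prj2_homs(2)[OF H]
  let ?v = "ptd_entry m l ?p" and ?u = "ptd_entry n m ?q"
  let ?s = "\<lambda>k i. gsum V P ?D m (\<lambda>j. gmul V P (?u j i) (?v k (Suc j)))"
  let ?c = "\<lambda>k i. let s = ?s k i in if i = 0 then gadd V P (?v k 0) s else s"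
  have s: "?s k i \<in> homs V ?D U" if "k < l" "i < 1 + n" for k i
    by (intro gsum_homs gmul_homs D ptd_entry_homs[OF p] ptd_entry_homs[OF q]) (use that in simp_all)
  have v0: "?v k 0 \<in> homs V ?D U" if "k < l" for k by (rule ptd_entry_homs[OF p that]) simp
  have c: "?c k i \<in> homs V ?D U" if "k < l" "i < 1 + n" for k i
    using s[OF that] gadd_homs[OF v0[OF that(1)] s[OF that]]
    by (cases "i = 0") (simp_all only: Let_def if_True if_False simp_thms)
  have C: "VComp (mat_op_pointed V P) n m l = mat_of V ?D l (1 + n) ?c"
    by (simp add: mat_op_pointed_def Let_def cong: if_cong)
  show C_homs: "VComp (mat_op_pointed V P) n m l \<in> homs V ?D (ptd n l)"
    unfolding C ptd_eq[of n l] by (rule mat_of_homs[OF D c])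
  assume x: "x \<in> homs V W (ptd m l)" and y: "y \<in> homs V W (ptd n m)" and k: "k < l" and i: "i < 1 + n"
  note xy = pair_homs[OF x y]
  have "?s k i \<cdot> pair V x y = gsum V P W m (\<lambda>j. gmul V P (?u j i) (?v k (Suc j)) \<cdot> pair V x y)"
    by (rule gsum_Cmp[OF xy]) (rule gmul_homs[OF ptd_entry_homs[OF q _ i] ptd_entry_homs[OF p k]], simp_all)
  also have "\<dots> = gsum V P W m (\<lambda>j. gmul V P (ptd_entry n m y j i) (ptd_entry m l x k (Suc j)))"
  proof (rule gsum_cong)
    fix j assume j: "j < m"
    then have j': "Suc j < 1 + m" by simp
    show "gmul V P (?u j i) (?v k (Suc j)) \<cdot> pair V x y
      = gmul V P (ptd_entry n m y j i) (ptd_entry m l x k (Suc j))"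
      unfolding gmul_Cmp[OF ptd_entry_homs[OF q j i] ptd_entry_homs[OF p k j'] xy]
        ptd_entry_Cmp[OF q j i xy] ptd_entry_Cmp[OF p k j' xy] Prj_pair[OF x y] ..
  qed
  finally have sxy: "?s k i \<cdot> pair V x y = gsum V P W m (\<lambda>j. gmul V P (ptd_entry n m y j i) (ptd_entry m l x k (Suc j)))" .
  have v0xy: "?v k 0 \<cdot> pair V x y = ptd_entry m l x k 0"
    using ptd_entry_Cmp[OF p k _ xy, of 0] Prj_pair[OF x y] by simp
  have "ptd_entry n l (vcomp V (mat_op_pointed V P) n m l x y) k i = ?c k i \<cdot> pair V x y"
    unfolding vcomp_def C by (rule mat_entry_mat_of_Cmp[OF xy c k i])
  also have "\<dots> = (let s = gsum V P W m (\<lambda>j. gmul V P (ptd_entry n m y j i) (ptd_entry m l x k (Suc j)))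
         in if i = 0 then gadd V P (ptd_entry m l x k 0) s else s)"
    using sxy v0xy gadd_Cmp[OF v0[OF k] s[OF k i] xy]
    by (cases "i = 0") (simp_all only: Let_def if_True if_False simp_thms)
  finally show "ptd_entry n l (vcomp V (mat_op_pointed V P) n m l x y) k i
      = (let s = gsum V P W m (\<lambda>j. gmul V P (ptd_entry n m y j i) (ptd_entry m l x k (Suc j)))
         in if i = 0 then gadd V P (ptd_entry m l x k 0) s else s)" .
qed

lemma gmul_gzero_sum:
  assumes W: "W \<in> Obj V" and f: "\<And>i. i < n \<Longrightarrow> f i \<in> homs V W U"
  shows "gsum V P W n (\<lambda>i. gmul V P (gzero V P W) (f i)) = gzero V P W"
    "gsum V P W n (\<lambda>i. gmul V P (f i) (gzero V P W)) = gzero V P W"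
proof -
  interpret Q: semiring "hom_ring V W P" by (rule semiring_hom_ring[OF W])
  show "gsum V P W n (\<lambda>i. gmul V P (gzero V P W) (f i)) = gzero V P W"
    "gsum V P W n (\<lambda>i. gmul V P (f i) (gzero V P W)) = gzero V P W"
    using f Q.l_null[unfolded hom_ring_simps] Q.r_null[unfolded hom_ring_simps]
    by (induction n) (simp_all add: gadd_gzero gzero_homs W)
qed

end

text \<open>The values of \<open>x \<mapsto> u\<^sub>0 + \<Sum>\<^sub>i x\<^sub>i u\<^sub>i\<close> at \<open>0\<close> and at the unit vectors are \<open>u\<^sub>0\<close> and \<open>u\<^sub>0 + u\<^sub>i\<close>. They
  determine the coefficients if addition is cancellative, so that pointed module operations embed
  into operations.\<close>

locale cancellative_rig = rig_with_equalizers +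
  assumes cancel: "\<lbrakk>x \<in> homs V W U; y \<in> homs V W U; z \<in> homs V W U; gadd V P x y = gadd V P x z\<rbrakk> \<Longrightarrow> y = z"
begin

lemma mat_op_pointed_operation_theory:
  "operation_theory V U (mat_op_pointed V P) (mat_op_pointed_over V P)"
proof unfold_locales
  let ?B = "mat_op_pointed_over V P" and ?S = "mat_op_pointed V P"
  show "VOb ?S = UNIV" by (simp add: mat_op_pointed_def Let_def)
  show "ptd n m \<in> Obj V" for n m by (rule ptd_Obj)
  show "VId ?S n \<in> homs V (One V) (ptd n n)" for n by (rule mat_op_pointed_VId_homs)
  show VC: "VComp ?S n m k \<in> homs V (Prd V [ptd m k, ptd n m]) (ptd n k)" for n m k
    by (rule mat_op_pointed_VComp_homs)
  show "TPrj ?S n i \<in> homs V (One V) (ptd n 1)" if "i < n" for i n by (rule mat_op_pointed_TPrj_homs)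
  show B: "?B n m \<in> homs V (ptd n m) (operations n m)" for n m by (rule mat_op_pointed_over_homs)
  show "x = y" if x: "x \<in> homs V W (ptd n m)" and y: "y \<in> homs V W (ptd n m)"
    and eq: "?B n m \<cdot> x = ?B n m \<cdot> y" for x W n m y
  proof (rule mat_eqI[OF x[unfolded ptd_eq] y[unfolded ptd_eq]])
    note W = homs_Obj(1)[OF x]
    have zero: "act n m (?B n m \<cdot> w) (\<lambda>_. gzero V P W) j = ptd_entry n m w j 0"
      if w: "w \<in> homs V W (ptd n m)" and j: "j < m" for w j
    proof -
      have w0: "ptd_entry n m w j 0 \<in> homs V W U" by (rule ptd_entry_homs[OF w j]) simp
      have "gsum V P W n (\<lambda>i. gmul V P (gzero V P W) (ptd_entry n m w j (Suc i))) = gzero V P W"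
        by (rule gmul_gzero_sum[OF W]) (rule ptd_entry_homs[OF w j], simp)
      then show ?thesis
        unfolding act_mat_op_pointed_over[where z = "\<lambda>_. gzero V P W", OF w gzero_homs[OF W] j]
        by (simp only: gadd_gzero(1)[OF w0])
    qed
    have delta: "act n m (?B n m \<cdot> w) (\<lambda>i'. gdelta V P W i i') j
        = gadd V P (ptd_entry n m w j 0) (ptd_entry n m w j (Suc i))"
      if w: "w \<in> homs V W (ptd n m)" and j: "j < m" and i: "i < n" for w j i
    proof -
      have "gsum V P W n (\<lambda>i'. gmul V P (gdelta V P W i i') (ptd_entry n m w j (Suc i')))
        = ptd_entry n m w j (Suc i)"
        by (rule gsum_delta(1)[OF W _ i]) (rule ptd_entry_homs[OF w j], simp)
      then show ?thesis
        unfolding act_mat_op_pointed_over[where z = "\<lambda>i'. gdelta V P W i i'", OF w gdelta_homs[OF W] j]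
        by simp
    qed
    fix j i assume j: "j < m" and i: "i < 1 + n"
    have eq0: "ptd_entry n m x j 0 = ptd_entry n m y j 0"
      using zero[OF x j] zero[OF y j] eq by simp
    show "ptd_entry n m x j i = ptd_entry n m y j i"
    proof (cases i)
      case 0
      with eq0 show ?thesis by simp
    next
      case (Suc i')
      then have i': "i' < n" using i by simp
      have i'': "Suc i' < 1 + n" using i' by simp
      show ?thesis
        unfolding Suc
      proof (rule cancel[OF _ ptd_entry_homs[OF x j i''] ptd_entry_homs[OF y j i'']])
        show "ptd_entry n m x j 0 \<in> homs V W U" by (rule ptd_entry_homs[OF x j]) simp
        show "gadd V P (ptd_entry n m x j 0) (ptd_entry n m x j (Suc i'))
          = gadd V P (ptd_entry n m x j 0) (ptd_entry n m y j (Suc i'))"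
          using delta[OF x j i'] delta[OF y j i'] eq eq0 by simp
      qed
    qed
  qed
  have proj: "gadd V P (gdelta V P W (Suc k) 0) (gsum V P W n (\<lambda>i. gmul V P (z i) (gdelta V P W (Suc k) (Suc i)))) = z k"
    if W: "W \<in> Obj V" and z: "\<And>i. i < n \<Longrightarrow> z i \<in> homs V W U" and k: "k < n" for W z k n
  proof -
    have "gdelta V P W (Suc k) (Suc i) = gdelta V P W k i" for i by (simp add: gdelta_def)
    then show ?thesis
      using gsum_delta(3)[where x = z, OF W z k] gadd_gzero(2)[OF z[OF k]] by (simp add: gdelta_def)
  qed
  show "?B n n \<cdot> VId ?S n = name_of V (Idn V (vpow V U n))" for n
  proof (rule act_eqI[OF Cmp_homs[OF mat_op_pointed_VId_homs B] name_of_homs[OF Idn_homs[OF vpow_Obj[OF X]]]])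
    fix W s z j assume s: "s \<in> homs V W (One V)" and z: "\<And>i. i < n \<Longrightarrow> z i \<in> homs V W U" and j: "j < n"
    note W = homs_Obj(1)[OF s]
    let ?x = "VId ?S n \<cdot> s"
    have "act n n ((?B n n \<cdot> VId ?S n) \<cdot> s) z j
      = gadd V P (ptd_entry n n ?x j 0) (gsum V P W n (\<lambda>i. gmul V P (z i) (ptd_entry n n ?x j (Suc i))))"
      unfolding Cmp_assoc[OF s mat_op_pointed_VId_homs B]
      by (rule act_mat_op_pointed_over[OF Cmp_homs[OF s mat_op_pointed_VId_homs] z j])
    also have "ptd_entry n n ?x j 0 = gdelta V P W (Suc j) 0"
      by (rule mat_op_pointed_VId_entry[OF s j]) simp
    also have "gsum V P W n (\<lambda>i. gmul V P (z i) (ptd_entry n n ?x j (Suc i)))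
      = gsum V P W n (\<lambda>i. gmul V P (z i) (gdelta V P W (Suc j) (Suc i)))"
      by (rule gsum_cong, rule arg_cong, rule mat_op_pointed_VId_entry[OF s j]) simp
    also have "gadd V P (gdelta V P W (Suc j) 0) \<dots> = z j" by (rule proj[OF W z j])
    also have "\<dots> = act n n (name_of V (Idn V (vpow V U n)) \<cdot> s) z j"
      unfolding Cmp_One_eq_at_stage[OF s] by (rule act_name_of_Idn[OF W z j, symmetric])
    finally show "act n n ((?B n n \<cdot> VId ?S n) \<cdot> s) z j
      = act n n (name_of V (Idn V (vpow V U n)) \<cdot> s) z j" .
  qed
  show "?B n 1 \<cdot> TPrj ?S n i = name_of V (vpow_prj V U n i)" if i: "i < n" for n i
  proof (rule act_eqI[OF Cmp_homs[OF mat_op_pointed_TPrj_homs B]])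
    show "name_of V (vpow_prj V U n i) \<in> homs V (One V) (operations n 1)"
      using name_of_homs[OF vpow_prj_homs[OF X i]] by (simp add: X1)
    fix W s z and j :: nat
    assume s: "s \<in> homs V W (One V)" and z: "\<And>i. i < n \<Longrightarrow> z i \<in> homs V W U" and "j < 1"
    then have j: "j = 0" by simp
    note W = homs_Obj(1)[OF s]
    let ?x = "TPrj ?S n i \<cdot> s"
    have "act n 1 ((?B n 1 \<cdot> TPrj ?S n i) \<cdot> s) z 0
      = gadd V P (ptd_entry n 1 ?x 0 0) (gsum V P W n (\<lambda>k. gmul V P (z k) (ptd_entry n 1 ?x 0 (Suc k))))"
      unfolding Cmp_assoc[OF s mat_op_pointed_TPrj_homs B]
      by (rule act_mat_op_pointed_over[OF Cmp_homs[OF s mat_op_pointed_TPrj_homs] z]) simp_all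
    also have "ptd_entry n 1 ?x 0 0 = gdelta V P W (Suc i) 0"
      by (rule mat_op_pointed_TPrj_entry[OF s]) simp
    also have "gsum V P W n (\<lambda>k. gmul V P (z k) (ptd_entry n 1 ?x 0 (Suc k)))
      = gsum V P W n (\<lambda>k. gmul V P (z k) (gdelta V P W (Suc i) (Suc k)))"
      by (rule gsum_cong, rule arg_cong, rule mat_op_pointed_TPrj_entry[OF s]) simp
    also have "gadd V P (gdelta V P W (Suc i) 0) \<dots> = z i" by (rule proj[OF W z i])
    also have "\<dots> = act n 1 (name_of V (vpow_prj V U n i) \<cdot> s) z 0"
      unfolding Cmp_One_eq_at_stage[OF s] by (rule act_name_of_prj[OF W z i, symmetric])
    finally show "act n 1 ((?B n 1 \<cdot> TPrj ?S n i) \<cdot> s) z j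
      = act n 1 (name_of V (vpow_prj V U n i) \<cdot> s) z j" unfolding j .
  qed
  show "?B n k \<cdot> vcomp V ?S n m k x y
    = vcomp V (self_enriched V) (vpow V U n) (vpow V U m) (vpow V U k) (?B m k \<cdot> x) (?B n m \<cdot> y)"
    if x: "x \<in> homs V W (ptd m k)" and y: "y \<in> homs V W (ptd n m)" for x W m k y n
  proof (rule act_eqI[OF Cmp_homs[OF vcomp_homs[OF VC x y] B]
        self_vcomp_homs[OF vpow_Obj[OF X] vpow_Obj[OF X] vpow_Obj[OF X] Cmp_homs[OF x B] Cmp_homs[OF y B]]])
    fix W' s z l assume s: "s \<in> homs V W' W" and z: "\<And>i. i < n \<Longrightarrow> z i \<in> homs V W' U" and l: "l < k"
    note W' = homs_Obj(1)[OF s] and xs = Cmp_homs[OF s x] and ys = Cmp_homs[OF s y]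
    note O = vpow_Obj[OF X, of n] vpow_Obj[OF X, of m] vpow_Obj[OF X, of k]
    let ?v = "ptd_entry m k (x \<cdot> s) l" and ?u = "ptd_entry n m (y \<cdot> s)"
    let ?c = "ptd_entry n k (vcomp V ?S n m k (x \<cdot> s) (y \<cdot> s)) l"
    have v: "?v i \<in> homs V W' U" if "i < 1 + m" for i by (rule ptd_entry_homs[OF xs l that])
    have u: "?u j i \<in> homs V W' U" if "j < m" "i < 1 + n" for j i by (rule ptd_entry_homs[OF ys that])
    have yz: "act n m (?B n m \<cdot> y \<cdot> s) z j
        = gadd V P (?u j 0) (gsum V P W' n (\<lambda>i. gmul V P (z i) (?u j (Suc i))))"
      if "j < m" for j
      by (rule act_mat_op_pointed_over[OF ys z that])
    have c0: "?c 0 = gadd V P (?v 0) (gsum V P W' m (\<lambda>j. gmul V P (?u j 0) (?v (Suc j))))"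
      using mat_op_pointed_vcomp_entry[OF xs ys l, of 0] by (simp add: Let_def)
    have cS: "?c (Suc i) = gsum V P W' m (\<lambda>j. gmul V P (?u j (Suc i)) (?v (Suc j)))" if "i < n" for i
      using mat_op_pointed_vcomp_entry[OF xs ys l, of "Suc i"] that by (simp add: Let_def)
    have "act n k ((?B n k \<cdot> vcomp V ?S n m k x y) \<cdot> s) z l
      = gadd V P (?c 0) (gsum V P W' n (\<lambda>i. gmul V P (z i) (?c (Suc i))))"
      unfolding Cmp_assoc[OF s vcomp_homs[OF VC x y] B] vcomp_restrict[OF VC x y s]
      by (rule act_mat_op_pointed_over[OF vcomp_homs[OF VC xs ys] z l])
    also have "gsum V P W' n (\<lambda>i. gmul V P (z i) (?c (Suc i)))
      = gsum V P W' n (\<lambda>i. gmul V P (z i) (gsum V P W' m (\<lambda>j. gmul V P (?u j (Suc i)) (?v (Suc j)))))"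
      by (rule gsum_cong) (simp only: cS)
    also have "gadd V P (?c 0) \<dots> = gadd V P (?v 0) (gsum V P W' m (\<lambda>j. gmul V P
        (gadd V P (?u j 0) (gsum V P W' n (\<lambda>i. gmul V P (z i) (?u j (Suc i))))) (?v (Suc j))))"
      unfolding c0 by (rule pointed_substitution[OF W'], (rule v u z; simp)+)
    also have "\<dots> = gadd V P (?v 0) (gsum V P W' m (\<lambda>j. gmul V P (act n m (?B n m \<cdot> y \<cdot> s) z j) (?v (Suc j))))"
      by (rule arg_cong, rule gsum_cong) (simp only: yz)
    also have "\<dots> = act m k (?B m k \<cdot> x \<cdot> s) (act n m (?B n m \<cdot> y \<cdot> s) z) l"
      by (rule act_mat_op_pointed_over[OF xs _ l, symmetric]) (rule act_homs[OF Cmp_homs[OF ys B] z])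
    also have "\<dots> = act n k (vcomp V (self_enriched V) (vpow V U n) (vpow V U m) (vpow V U k)
        (?B m k \<cdot> x) (?B n m \<cdot> y) \<cdot> s) z l"
      unfolding self_vcomp_Cmp[OF O Cmp_homs[OF x B] Cmp_homs[OF y B] s] Cmp_assoc[OF s x B] Cmp_assoc[OF s y B]
      by (rule act_self_vcomp[OF Cmp_homs[OF xs B] Cmp_homs[OF ys B] z, symmetric])
    finally show "act n k ((?B n k \<cdot> vcomp V ?S n m k x y) \<cdot> s) z l
      = act n k (vcomp V (self_enriched V) (vpow V U n) (vpow V U m) (vpow V U k)
        (?B m k \<cdot> x) (?B n m \<cdot> y) \<cdot> s) z l" .
  qed
qed

end

section \<open>Affine maps on the positive cone of an archimedean ring\<close>

lemma dyadic_carrier: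
  "of_int a / 2 ^ k \<in> carrier dyadic_ring" "of_nat n \<in> carrier dyadic_ring"
  "(2::rat) ^ k \<in> carrier dyadic_ring" "1 / (2::rat) ^ k \<in> carrier dyadic_ring"
  "1 - 1 / (2::rat) ^ k \<in> carrier dyadic_ring"
  "(0::rat) \<in> carrier dyadic_ring" "(1::rat) \<in> carrier dyadic_ring"
proof -
  show *: "of_int a / 2 ^ k \<in> carrier dyadic_ring" for a k by (auto simp: dyadic_ring_def)
  show "of_nat n \<in> carrier dyadic_ring" using *[of "int n" 0] by simp
  show "(2::rat) ^ k \<in> carrier dyadic_ring" using *[of "2 ^ k" 0] by simp
  show "1 / (2::rat) ^ k \<in> carrier dyadic_ring" using *[of 1 k] by simp
  show "1 - 1 / (2::rat) ^ k \<in> carrier dyadic_ring"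
    using *[of "2 ^ k - 1" k] by (simp add: diff_divide_distrib)
  show "(0::rat) \<in> carrier dyadic_ring" using *[of 0 0] by simp
  show "(1::rat) \<in> carrier dyadic_ring" using *[of 1 0] by simp
qed

text \<open>The scale is \<open>N = 2\<^sup>n\<close>, where \<open>s \<le> n \<cdot> 1\<close> by firmness, with \<open>c = 2\<^sup>-\<^sup>n\<close>, \<open>c' = 1 - c\<close> and \<open>y = N - s\<close>.
  Powers of two are used because they and their inverses are images of dyadic rationals.\<close>

lemma dyadic_scale:
  assumes firm: "firmly_archimedean Q Qp" and dyadic: "preordered_dyadic_algebra Q Qp" and s: "s \<in> Qp"
  obtains N c c' y where "N \<in> Qp" "c \<in> Qp" "c' \<in> Qp" "y \<in> Qp" "N \<otimes>\<^bsub>Q\<^esub> c = \<one>\<^bsub>Q\<^esub>" "c \<otimes>\<^bsub>Q\<^esub> N = \<one>\<^bsub>Q\<^esub>"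
    "c \<oplus>\<^bsub>Q\<^esub> c' = \<one>\<^bsub>Q\<^esub>" "s \<oplus>\<^bsub>Q\<^esub> y = N"
proof -
  have pre: "set_preordered_ring Q Qp" using dyadic by (simp add: preordered_dyadic_algebra_def)
  then interpret ring Q by (simp add: set_preordered_ring_def)
  have QpQ: "x \<in> carrier Q" if "x \<in> Qp" for x using pre that by (auto simp: set_preordered_ring_def)
  have Qp_add: "x \<oplus>\<^bsub>Q\<^esub> y \<in> Qp" if "x \<in> Qp" "y \<in> Qp" for x y
    using pre that by (auto simp: set_preordered_ring_def)
  obtain h where h: "h \<in> ring_hom dyadic_ring Q"
    and mono: "\<And>x y. \<lbrakk>x \<in> carrier dyadic_ring; y \<in> carrier dyadic_ring; x \<le> y\<rbrakk> \<Longrightarrow> h y \<ominus>\<^bsub>Q\<^esub> h x \<in> Qp"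
    using dyadic unfolding preordered_dyadic_algebra_def ring_le_def by blast
  have hc: "h x \<in> carrier Q" if "x \<in> carrier dyadic_ring" for x using ring_hom_closed[OF h that] .
  have hadd: "h (x + y) = h x \<oplus>\<^bsub>Q\<^esub> h y" if "x \<in> carrier dyadic_ring" "y \<in> carrier dyadic_ring" for x y
    using ring_hom_add[OF h that] by (simp add: dyadic_ring_def)
  have hmult: "h (x * y) = h x \<otimes>\<^bsub>Q\<^esub> h y" if "x \<in> carrier dyadic_ring" "y \<in> carrier dyadic_ring" for x y
    using ring_hom_mult[OF h that] by (simp add: dyadic_ring_def)
  have h1: "h 1 = \<one>\<^bsub>Q\<^esub>" using ring_hom_one[OF h] by (simp add: dyadic_ring_def)
  have h0: "h 0 = \<zero>\<^bsub>Q\<^esub>"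
    using hadd[OF dyadic_carrier(6,6)] hc[OF dyadic_carrier(6)] add.l_cancel_one' by simp
  have pos: "h x \<in> Qp" if "x \<in> carrier dyadic_ring" "0 \<le> x" for x
    using mono[OF dyadic_carrier(6) that] hc[OF that(1)] h0 by (simp add: a_minus_def)
  have hn: "h (of_nat n) = [n] \<cdot>\<^bsub>Q\<^esub> \<one>\<^bsub>Q\<^esub>" for n
  proof (induction n)
    case 0
    show ?case using h0 by simp
  next
    case (Suc n)
    have "h (of_nat (Suc n)) = h (of_nat n) \<oplus>\<^bsub>Q\<^esub> h 1"
      using hadd[OF dyadic_carrier(2,7), of n] by (simp add: add.commute)
    then show ?case using Suc h1 by simp
  qed
  obtain n :: nat where n: "[n] \<cdot>\<^bsub>Q\<^esub> \<one>\<^bsub>Q\<^esub> \<ominus>\<^bsub>Q\<^esub> s \<in> Qp"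
    using firm s unfolding firmly_archimedean_def ring_le_def by blast
  let ?N = "h (2 ^ n)" and ?c = "h (1 / 2 ^ n)" and ?c' = "h (1 - 1 / 2 ^ n)"
  have "(of_nat n :: rat) \<le> 2 ^ n"
    by (metis less_exp of_nat_less_iff of_nat_numeral of_nat_power order_less_imp_le)
  then have N: "?N \<ominus>\<^bsub>Q\<^esub> [n] \<cdot>\<^bsub>Q\<^esub> \<one>\<^bsub>Q\<^esub> \<in> Qp"
    using mono[OF dyadic_carrier(2,3)] hn by metis
  have sQ: "s \<in> carrier Q" and NQ: "?N \<in> carrier Q" using QpQ s hc dyadic_carrier by auto
  have "?N \<ominus>\<^bsub>Q\<^esub> s = ([n] \<cdot>\<^bsub>Q\<^esub> \<one>\<^bsub>Q\<^esub> \<ominus>\<^bsub>Q\<^esub> s) \<oplus>\<^bsub>Q\<^esub> (?N \<ominus>\<^bsub>Q\<^esub> [n] \<cdot>\<^bsub>Q\<^esub> \<one>\<^bsub>Q\<^esub>)"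
    using sQ NQ add.nat_pow_closed[OF one_closed, of n] by algebra
  then have y: "?N \<ominus>\<^bsub>Q\<^esub> s \<in> Qp" using Qp_add[OF n N] by simp
  show ?thesis
  proof (rule that[of ?N ?c ?c' "?N \<ominus>\<^bsub>Q\<^esub> s"])
    show "?N \<in> Qp" by (rule pos[OF dyadic_carrier(3)]) simp
    show "?c \<in> Qp" by (rule pos[OF dyadic_carrier(4)]) simp
    show "?c' \<in> Qp" by (rule pos[OF dyadic_carrier(5)]) simp
    show "?N \<ominus>\<^bsub>Q\<^esub> s \<in> Qp" by (rule y)
    show "?N \<otimes>\<^bsub>Q\<^esub> ?c = \<one>\<^bsub>Q\<^esub>" using hmult[OF dyadic_carrier(3,4), of n n] h1 by simp
    show "?c \<otimes>\<^bsub>Q\<^esub> ?N = \<one>\<^bsub>Q\<^esub>" using hmult[OF dyadic_carrier(4,3), of n n] h1 by simp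
    show "?c \<oplus>\<^bsub>Q\<^esub> ?c' = \<one>\<^bsub>Q\<^esub>" using hadd[OF dyadic_carrier(4,5), of n n] h1 by simp
    show "s \<oplus>\<^bsub>Q\<^esub> (?N \<ominus>\<^bsub>Q\<^esub> s) = ?N" using sQ NQ by algebra
  qed
qed

text \<open>With \<open>N\<close>, \<open>c\<close>, \<open>c'\<close> and \<open>y\<close> as above for \<open>s = \<Sum>\<^sub>i x\<^sub>i\<close>, the two evaluations of \<open>g\<close> at \<open>c x\<close> give
  \<open>c g(x) + c' g(0) = \<Sum>\<^sub>i c x\<^sub>i g(e\<^sub>i) + c y g(0)\<close>, and multiplication by \<open>N\<close> yields the expansion. Its
  slopes \<open>d\<^sub>i\<close> are positive: as \<open>g(0) + m d\<^sub>i = g(m e\<^sub>i)\<close> is positive for all \<open>m\<close>, the multiples of \<open>- d\<^sub>i\<close>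
  are bounded above by \<open>g(0)\<close>.\<close>

lemma affine_map_on_cone:
  fixes Q :: "('b, 'm) ring_scheme" (structure) and n :: nat and g :: "(nat \<Rightarrow> 'b) \<Rightarrow> 'b"
  assumes firm: "firmly_archimedean Q Qp" and dyadic: "preordered_dyadic_algebra Q Qp"
    and g: "\<And>x. (\<And>i. i < n \<Longrightarrow> x i \<in> Qp) \<Longrightarrow> g x \<in> Qp"
    and cong: "\<And>x y. (\<And>i. i < n \<Longrightarrow> x i = y i) \<Longrightarrow> g x = g y"
    and affine: "\<And>(k :: nat) a x. \<lbrakk>\<And>b. b < k \<Longrightarrow> a b \<in> Qp; (\<Oplus>b\<in>{..<k}. a b) = \<one>;
      \<And>b i. \<lbrakk>b < k; i < n\<rbrakk> \<Longrightarrow> x b i \<in> Qp\<rbrakk> \<Longrightarrow>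
      g (\<lambda>i. \<Oplus>b\<in>{..<k}. a b \<otimes> x b i) = (\<Oplus>b\<in>{..<k}. a b \<otimes> g (x b))"
  shows affine_map_on_cone_expansion: "(\<And>i. i < n \<Longrightarrow> x i \<in> Qp) \<Longrightarrow>
      g x = g (\<lambda>_. \<zero>) \<oplus>
        (\<Oplus>i\<in>{..<n}. x i \<otimes> (g (\<lambda>i'. if i = i' then \<one> else \<zero>) \<ominus> g (\<lambda>_. \<zero>)))"
    and affine_map_on_cone_slope: "i < n \<Longrightarrow>
      g (\<lambda>i'. if i = i' then \<one> else \<zero>) \<ominus> g (\<lambda>_. \<zero>) \<in> Qp"
proof -
  have pre: "set_preordered_ring Q Qp" using dyadic by (simp add: preordered_dyadic_algebra_def)
  then interpret ring Q by (simp add: set_preordered_ring_def)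
  have QpQ: "x \<in> carrier Q" if "x \<in> Qp" for x using pre that by (auto simp: set_preordered_ring_def)
  have Qp0: "\<zero> \<in> Qp" and Qp1: "\<one> \<in> Qp" using pre by (auto simp: set_preordered_ring_def)
  have Qp_add: "x \<oplus> y \<in> Qp" and Qp_mult: "x \<otimes> y \<in> Qp" if "x \<in> Qp" "y \<in> Qp" for x y
    using pre that by (auto simp: set_preordered_ring_def)
  have Qp_sum: "(\<Oplus>i\<in>{..<m}. f i) \<in> Qp" if "\<And>i. i < m \<Longrightarrow> f i \<in> Qp" for f :: "nat \<Rightarrow> 'b" and m :: nat
    using that
  proof (induction m)
    case 0
    show ?case by (simp add: Qp0)
  next
    case (Suc m)
    have "(\<Oplus>i\<in>{..<Suc m}. f i) = f m \<oplus> (\<Oplus>i\<in>{..<m}. f i)"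
      unfolding lessThan_Suc by (rule finsum_insert) (use Suc.prems QpQ in auto)
    then show ?case using Suc by (simp add: Qp_add)
  qed
  let ?\<delta> = "\<lambda>i i'. if i = i' then \<one> else \<zero>"
  define o' where "o' = g (\<lambda>_. \<zero>)"
  define d where "d i = g (?\<delta> i) \<ominus> o'" for i
  have o': "o' \<in> Qp" unfolding o'_def by (rule g) (rule Qp0)
  note oQ = QpQ[OF o']
  have g\<delta>: "g (?\<delta> i) \<in> carrier Q" for i by (rule QpQ, rule g) (auto simp: Qp0 Qp1)
  have dQ: "d i \<in> carrier Q" for i unfolding d_def using g\<delta> oQ by simp
  have g\<delta>_eq: "g (?\<delta> i) = d i \<oplus> o'" for i 
    unfolding d_def a_minus_def using g\<delta>[of i] oQ by (simp add: a_assoc l_neg)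
  have expansion: "g x = o' \<oplus> (\<Oplus>i\<in>{..<n}. x i \<otimes> d i)" if x: "\<And>i. i < n \<Longrightarrow> x i \<in> Qp" for x
  proof -
    let ?S = "\<Oplus>i\<in>{..<n}. x i" and ?E = "\<Oplus>i\<in>{..<n}. x i \<otimes> d i"
    have S: "?S \<in> Qp" by (rule Qp_sum[OF x])
    have xQ: "x i \<in> carrier Q" if "i < n" for i by (rule QpQ[OF x[OF that]])
    have E: "?E \<in> carrier Q" by (rule finsum_closed) (use xQ dQ in auto)
    obtain N c c' y where pos: "N \<in> Qp" "c \<in> Qp" "c' \<in> Qp" "y \<in> Qp"
      and Nc: "N \<otimes> c = \<one>" and cN: "c \<otimes> N = \<one>" and cc': "c \<oplus> c' = \<one>" and Sy: "?S \<oplus> y = N"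
      by (rule dyadic_scale[OF firm dyadic S])
    note Q = pos[THEN QpQ]
    have gx: "g x \<in> carrier Q" by (rule QpQ[OF g[OF x]])
    \<comment> \<open>The point \<open>c x\<close> lies on the segment from \<open>0\<close> to \<open>x\<close>.\<close>
    have 1: "g (\<lambda>i. c \<otimes> x i) = c \<otimes> g x \<oplus> c' \<otimes> o'"
    proof -
      let ?a = "\<lambda>b::nat. if b = 0 then c else c'" and ?x = "\<lambda>b::nat. if b = 0 then x else (\<lambda>_. \<zero>)"
      have two: "(\<Oplus>b\<in>{..<2}. f b) = f 0 \<oplus> f 1" if "f 0 \<in> carrier Q" "f 1 \<in> carrier Q" for f :: "nat \<Rightarrow> 'b"
      proof -
        have "{..<2::nat} = {0, 1}" by auto
        then show ?thesis using that by (simp add: finsum_insert)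
      qed
      have "g (\<lambda>i. c \<otimes> x i) = g (\<lambda>i. \<Oplus>b\<in>{..<2}. ?a b \<otimes> ?x b i)"
        by (rule cong, subst two) (use Q xQ in simp_all)
      also have "\<dots> = (\<Oplus>b\<in>{..<2}. ?a b \<otimes> g (?x b))"
      proof (rule affine)
        show "(\<Oplus>b\<in>{..<2}. ?a b) = \<one>" by (subst two) (use Q cc' in simp_all)
      qed (use pos x Qp0 in auto)
      also have "\<dots> = c \<otimes> g x \<oplus> c' \<otimes> o'"
        by (subst two) (use Q gx oQ in \<open>simp_all add: o'_def\<close>)
      finally show ?thesis .
    qed
    \<comment> \<open>It is also a convex combination of \<open>0\<close> and the basis vectors.\<close>
    have 2: "g (\<lambda>i. c \<otimes> x i) = c \<otimes> (?E \<oplus> N \<otimes> o')"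
    proof -
      let ?a = "\<lambda>b. if b < n then c \<otimes> x b else c \<otimes> y"
      let ?x = "\<lambda>b. if b < n then ?\<delta> b else (\<lambda>_. \<zero>)"
      have split: "(\<Oplus>b\<in>{..<Suc n}. f b) = (\<Oplus>b\<in>{..<n}. f' b) \<oplus> f n"
        if "\<And>b. b < n \<Longrightarrow> f b = f' b" "\<And>b. b < n \<Longrightarrow> f' b \<in> carrier Q" "f n \<in> carrier Q" for f f' :: "nat \<Rightarrow> 'b"
      proof -
        have "(\<Oplus>b\<in>{..<Suc n}. f b) = f n \<oplus> (\<Oplus>b\<in>{..<n}. f b)"
          unfolding lessThan_Suc by (rule finsum_insert) (use that in auto)
        also have "(\<Oplus>b\<in>{..<n}. f b) = (\<Oplus>b\<in>{..<n}. f' b)"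
          by (rule finsum_cong') (use that in auto)
        also have "f n \<oplus> (\<Oplus>b\<in>{..<n}. f' b) = (\<Oplus>b\<in>{..<n}. f' b) \<oplus> f n"
          by (rule a_comm) (use that in \<open>auto intro!: finsum_closed\<close>)
        finally show ?thesis .
      qed
      have "g (\<lambda>i. c \<otimes> x i) = g (\<lambda>i. \<Oplus>b\<in>{..<Suc n}. ?a b \<otimes> ?x b i)"
      proof (rule cong)
        fix i assume i: "i < n"
        have "(\<Oplus>b\<in>{..<Suc n}. ?a b \<otimes> ?x b i) = (\<Oplus>b\<in>{..<n}. (c \<otimes> x b) \<otimes> ?\<delta> b i) \<oplus> ?a n \<otimes> ?x n i"
          by (rule split) (use Q xQ in auto)
        also have "(\<Oplus>b\<in>{..<n}. (c \<otimes> x b) \<otimes> ?\<delta> b i) = c \<otimes> x i"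
          by (rule finsum_delta(4)) (use Q xQ i in auto)
        finally show "c \<otimes> x i = (\<Oplus>b\<in>{..<Suc n}. ?a b \<otimes> ?x b i)" using Q xQ[OF i] by simp
      qed
      also have "\<dots> = (\<Oplus>b\<in>{..<Suc n}. ?a b \<otimes> g (?x b))"
      proof (rule affine)
        have "(\<Oplus>b\<in>{..<Suc n}. ?a b) = (\<Oplus>b\<in>{..<n}. c \<otimes> x b) \<oplus> ?a n"
          by (rule split) (use Q xQ in auto)
        also have "(\<Oplus>b\<in>{..<n}. c \<otimes> x b) = c \<otimes> ?S"
          by (rule finsum_rdistr[symmetric]) (use Q xQ in auto)
        also have "c \<otimes> ?S \<oplus> ?a n = c \<otimes> (?S \<oplus> y)" using Q QpQ[OF S] by (simp add: r_distr)
        finally show "(\<Oplus>b\<in>{..<Suc n}. ?a b) = \<one>" unfolding Sy cN .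
      qed (use pos x Qp0 Qp1 Qp_mult in auto)
      also have "\<dots> = (\<Oplus>b\<in>{..<n}. (c \<otimes> x b) \<otimes> (d b \<oplus> o')) \<oplus> ?a n \<otimes> g (?x n)"
        by (rule split) (use Q xQ dQ oQ g\<delta>_eq in \<open>auto simp: o'_def[symmetric]\<close>)
      also have "(\<Oplus>b\<in>{..<n}. (c \<otimes> x b) \<otimes> (d b \<oplus> o')) = (\<Oplus>b\<in>{..<n}. c \<otimes> (x b \<otimes> d b \<oplus> x b \<otimes> o'))"
        by (rule finsum_cong') (use Q xQ dQ oQ in \<open>auto simp: m_assoc r_distr\<close>)
      also have "\<dots> = c \<otimes> (\<Oplus>b\<in>{..<n}. x b \<otimes> d b \<oplus> x b \<otimes> o')"
        by (rule finsum_rdistr[symmetric]) (use Q xQ dQ oQ in auto)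
      also have "(\<Oplus>b\<in>{..<n}. x b \<otimes> d b \<oplus> x b \<otimes> o') = ?E \<oplus> (\<Oplus>b\<in>{..<n}. x b \<otimes> o')"
        by (rule finsum_addf) (use xQ dQ oQ in auto)
      also have "(\<Oplus>b\<in>{..<n}. x b \<otimes> o') = ?S \<otimes> o'"
        by (rule finsum_ldistr[symmetric]) (use xQ oQ in auto)
      also have "c \<otimes> (?E \<oplus> ?S \<otimes> o') \<oplus> ?a n \<otimes> g (?x n) = c \<otimes> (?E \<oplus> (?S \<oplus> y) \<otimes> o')"
        using Q QpQ[OF S] E oQ by (simp add: o'_def[symmetric] l_distr r_distr m_assoc a_assoc)
      finally show ?thesis unfolding Sy .
    qed
    have "c \<otimes> g x \<oplus> o' = c \<otimes> g x \<oplus> (c \<oplus> c') \<otimes> o'" unfolding cc' using oQ by simp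
    also have "\<dots> = (c \<otimes> g x \<oplus> c' \<otimes> o') \<oplus> c \<otimes> o'" using Q gx oQ by (simp add: l_distr a_ac)
    also have "\<dots> = (c \<otimes> ?E \<oplus> (c \<otimes> N) \<otimes> o') \<oplus> c \<otimes> o'"
      using 1 2 Q E oQ by (simp add: r_distr m_assoc)
    also have "\<dots> = c \<otimes> (o' \<oplus> ?E) \<oplus> o'" unfolding cN using Q E oQ by (simp add: r_distr a_ac)
    finally have "c \<otimes> g x = c \<otimes> (o' \<oplus> ?E)" using Q gx oQ E by simp
    then have "(N \<otimes> c) \<otimes> g x = (N \<otimes> c) \<otimes> (o' \<oplus> ?E)" using Q gx oQ E by (simp only: m_assoc a_closed)
    then show ?thesis unfolding Nc using gx oQ E by simp
  qed
  then show "(\<And>i. i < n \<Longrightarrow> x i \<in> Qp) \<Longrightarrow> g x = g (\<lambda>_. \<zero>) \<oplus>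
        (\<Oplus>i\<in>{..<n}. x i \<otimes> (g (?\<delta> i) \<ominus> g (\<lambda>_. \<zero>)))"
    unfolding d_def o'_def .
  have "d i \<in> Qp" if i: "i < n"
  proof -
    \<comment> \<open>The bound required by the archimedean property, from the value at \<open>m\<close> times a unit vector.\<close>
    have "o' \<ominus> [m] \<cdot> (\<ominus> d i) \<in> Qp" for m :: nat
    proof -
      let ?x = "\<lambda>i'. if i = i' then [m] \<cdot> \<one> else \<zero>"
      have m1: "[m] \<cdot> \<one> \<in> Qp" by (induction m) (simp_all add: Qp0 Qp1 Qp_add)
      have "(\<Oplus>i'\<in>{..<n}. ?x i' \<otimes> d i') = (\<Oplus>i'\<in>{..<n}. if i = i' then [m] \<cdot> \<one> \<otimes> d i' else \<zero>)"
        by (rule finsum_cong') (use dQ QpQ[OF m1] in auto)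
      also have "\<dots> = [m] \<cdot> \<one> \<otimes> d i"
        by (rule finsum_singleton) (use i dQ QpQ[OF m1] in auto)
      also have "\<dots> = [m] \<cdot> d i" using add_pow_ldistr[of \<one> "d i" m] dQ by simp
      finally have "g ?x = o' \<oplus> [m] \<cdot> d i" using expansion[of ?x] m1 Qp0 by simp
      moreover have "g ?x \<in> Qp" by (rule g) (use m1 Qp0 in auto)
      moreover have "[m] \<cdot> (\<ominus> d i) = \<ominus> ([m] \<cdot> d i)" using add.nat_pow_inv[OF dQ[of i], of m] by simp
      ultimately show ?thesis using dQ by (simp add: a_minus_def)
    qed
    then have "\<zero> \<ominus> (\<ominus> d i) \<in> Qp"
      using firm oQ dQ[of i] unfolding firmly_archimedean_def archimedean_def ring_le_def by blast
    then show ?thesis using dQ[of i] by (simp add: a_minus_def)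
  qed
  then show "i < n \<Longrightarrow> g (?\<delta> i) \<ominus> g (\<lambda>_. \<zero>) \<in> Qp"
    unfolding d_def o'_def .
qed

section \<open>Convex combinations and pointed modules determine each other\<close>

context cancellative_rig
begin

lemma aff_entries_at:
  assumes x: "x \<in> homs V W (aff n m)" and s: "s \<in> homs V W' W" and z: "\<And>i. i < n \<Longrightarrow> z i \<in> homs V W' U"
    and j: "j < m"
  shows "act n m ((mat_aff_over V P n m \<cdot> x) \<cdot> s) z j
    = gsum V P W' n (\<lambda>i. gmul V P (aff_entry n m (x \<cdot> s) j i) (z i))"
  unfolding Cmp_assoc[OF s x mat_aff_over_homs] by (rule act_mat_aff_over[OF Cmp_homs[OF s x] z j])

lemma ptd_entries_at:
  assumes x: "x \<in> homs V W (ptd n m)" and s: "s \<in> homs V W' W" and z: "\<And>i. i < n \<Longrightarrow> z i \<in> homs V W' U"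
    and j: "j < m"
  shows "act n m ((mat_op_pointed_over V P n m \<cdot> x) \<cdot> s) z j
    = gadd V P (ptd_entry n m (x \<cdot> s) j 0)
        (gsum V P W' n (\<lambda>i. gmul V P (z i) (ptd_entry n m (x \<cdot> s) j (Suc i))))"
  unfolding Cmp_assoc[OF s x mat_op_pointed_over_homs]
  by (rule act_mat_op_pointed_over[OF Cmp_homs[OF s x] z j])

text \<open>This and the next lemma are the two readings of \<open>affine_pointed_commute\<close>.\<close>

lemma mat_aff_commutes_with_pointed:
  assumes x: "x \<in> homs V W (aff n m)"
  shows "commutes_with (mat_op_pointed V P) (mat_op_pointed_over V P) n m (mat_aff_over V P n m \<cdot> x)"
  unfolding commutes_with_def homs_Dom[OF Cmp_homs[OF x mat_aff_over_homs]]
proof (intro allI impI)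
  fix W' s k t z j
  assume s: "s \<in> homs V W' W" and t: "t \<in> homs V W' (ptd k 1)"
    and "\<forall>i<n. \<forall>b<k. z i b \<in> homs V W' U" and j: "j < m"
  then have z: "\<And>i b. \<lbrakk>i < n; b < k\<rbrakk> \<Longrightarrow> z i b \<in> homs V W' U" by blast
  note W' = homs_Obj(1)[OF s] and xs = Cmp_homs[OF s x]
  let ?a = "aff_entry n m (x \<cdot> s) j" and ?u = "ptd_entry k 1 t 0"
  let ?A = "mat_aff_over V P n m \<cdot> x" and ?T = "mat_op_pointed_over V P k 1 \<cdot> t"
  have T: "act k 1 ?T w 0 = gadd V P (?u 0) (gsum V P W' k (\<lambda>b. gmul V P (w b) (?u (Suc b))))"
    if "\<And>b. b < k \<Longrightarrow> w b \<in> homs V W' U" for w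
    by (rule act_mat_op_pointed_over[OF t that]) simp_all
  have T_homs: "act k 1 ?T w 0 \<in> homs V W' U" if "\<And>b. b < k \<Longrightarrow> w b \<in> homs V W' U" for w
    by (rule act_homs[OF Cmp_homs[OF t mat_op_pointed_over_homs] that]) simp_all
  have u: "?u b \<in> homs V W' U" if "b < 1 + k" for b by (rule ptd_entry_homs[OF t _ that]) simp
  have "act n m (?A \<cdot> s) (\<lambda>i. act k 1 ?T (z i) 0) j
    = gsum V P W' n (\<lambda>i. gmul V P (?a i) (act k 1 ?T (z i) 0))"
    by (rule aff_entries_at[OF x s T_homs[OF z] j])
  also have "\<dots> = gsum V P W' n (\<lambda>i. gmul V P (?a i)
      (gadd V P (?u 0) (gsum V P W' k (\<lambda>b. gmul V P (z i b) (?u (Suc b))))))"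
    by (rule gsum_cong, rule arg_cong, rule T, rule z)
  also have "\<dots> = gadd V P (?u 0) (gsum V P W' k (\<lambda>b. gmul V P (gsum V P W' n (\<lambda>i. gmul V P (?a i) (z i b))) (?u (Suc b))))"
    by (rule affine_pointed_commute[OF W' aff_entry_homs[OF xs j] aff_row_sum[OF xs j] z]) ((rule u)?, simp)+
  also have "\<dots> = gadd V P (?u 0) (gsum V P W' k (\<lambda>b. gmul V P (act n m (?A \<cdot> s) (\<lambda>i. z i b) j) (?u (Suc b))))"
    by (rule arg_cong, rule gsum_cong, rule arg_cong[where f = "\<lambda>y. gmul V P y _"],
        rule aff_entries_at[OF x s z j, symmetric])
  also have "\<dots> = act k 1 ?T (\<lambda>b. act n m (?A \<cdot> s) (\<lambda>i. z i b) j) 0"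
    by (rule T[symmetric])
      (rule act_homs[OF Cmp_homs[OF s Cmp_homs[OF x mat_aff_over_homs]] z j])
  finally show "act n m (?A \<cdot> s) (\<lambda>i. act k 1 ?T (z i) 0) j
    = act k 1 ?T (\<lambda>b. act n m (?A \<cdot> s) (\<lambda>i. z i b) j) 0" .
qed

lemma mat_op_pointed_commutes_with_aff:
  assumes x: "x \<in> homs V W (ptd n m)"
  shows "commutes_with (mat_aff V P) (mat_aff_over V P) n m (mat_op_pointed_over V P n m \<cdot> x)"
  unfolding commutes_with_def homs_Dom[OF Cmp_homs[OF x mat_op_pointed_over_homs]]
proof (intro allI impI)
  fix W' s k t z j
  assume s: "s \<in> homs V W' W" and t: "t \<in> homs V W' (aff k 1)"
    and "\<forall>i<n. \<forall>b<k. z i b \<in> homs V W' U" and j: "j < m"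
  then have z: "\<And>i b. \<lbrakk>i < n; b < k\<rbrakk> \<Longrightarrow> z i b \<in> homs V W' U" by blast
  note W' = homs_Obj(1)[OF s] and xs = Cmp_homs[OF s x]
  let ?a = "aff_entry k 1 t 0" and ?u = "ptd_entry n m (x \<cdot> s) j"
  let ?A = "mat_op_pointed_over V P n m \<cdot> x" and ?T = "mat_aff_over V P k 1 \<cdot> t"
  have T: "act k 1 ?T w 0 = gsum V P W' k (\<lambda>b. gmul V P (?a b) (w b))"
    if "\<And>b. b < k \<Longrightarrow> w b \<in> homs V W' U" for w
    by (rule act_mat_aff_over[OF t that]) simp_all
  have T_homs: "act k 1 ?T w 0 \<in> homs V W' U" if "\<And>b. b < k \<Longrightarrow> w b \<in> homs V W' U" for w
    by (rule act_homs[OF Cmp_homs[OF t mat_aff_over_homs] that]) simp_all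
  have u: "?u i \<in> homs V W' U" if "i < 1 + n" for i by (rule ptd_entry_homs[OF xs j that])
  have a: "?a b \<in> homs V W' U" if "b < k" for b by (rule aff_entry_homs[OF t _ that]) simp
  have "act n m (?A \<cdot> s) (\<lambda>i. act k 1 ?T (z i) 0) j
    = gadd V P (?u 0) (gsum V P W' n (\<lambda>i. gmul V P (act k 1 ?T (z i) 0) (?u (Suc i))))"
    by (rule ptd_entries_at[OF x s T_homs[OF z] j])
  also have "\<dots> = gadd V P (?u 0) (gsum V P W' n (\<lambda>i. gmul V P
      (gsum V P W' k (\<lambda>b. gmul V P (?a b) (z i b))) (?u (Suc i))))"
    by (rule arg_cong, rule gsum_cong, rule arg_cong[where f = "\<lambda>y. gmul V P y _"], rule T, rule z)
  also have "\<dots> = gsum V P W' k (\<lambda>b. gmul V P (?a b)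
      (gadd V P (?u 0) (gsum V P W' n (\<lambda>i. gmul V P (z i b) (?u (Suc i))))))"
    by (rule affine_pointed_commute[OF W' a aff_row_sum[OF t] z, symmetric]) ((rule u)?, simp)+
  also have "\<dots> = gsum V P W' k (\<lambda>b. gmul V P (?a b) (act n m (?A \<cdot> s) (\<lambda>i. z i b) j))"
    by (rule gsum_cong, rule arg_cong, rule ptd_entries_at[OF x s z j, symmetric])
  also have "\<dots> = act k 1 ?T (\<lambda>b. act n m (?A \<cdot> s) (\<lambda>i. z i b) j) 0"
    by (rule T[symmetric])
      (rule act_homs[OF Cmp_homs[OF s Cmp_homs[OF x mat_op_pointed_over_homs]] z j])
  finally show "act n m (?A \<cdot> s) (\<lambda>i. act k 1 ?T (z i) 0) j
    = act k 1 ?T (\<lambda>b. act n m (?A \<cdot> s) (\<lambda>i. z i b) j) 0" .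
qed

text \<open>Commuting with pointed module operations makes \<open>h\<close> right linear, so that it acts by the matrix
  of its values at the unit vectors, and makes it preserve the point, so that the rows of this matrix
  sum to \<open>1\<close>.\<close>

lemma commutes_with_pointed_imp_affine:
  assumes h: "h \<in> homs V W (operations n m)"
    and com: "commutes_with (mat_op_pointed V P) (mat_op_pointed_over V P) n m h"
  obtains x where "x \<in> homs V W (aff n m)" "mat_aff_over V P n m \<cdot> x = h"
proof -
  note W = homs_Obj(1)[OF h]
  have com: "act n m (h \<cdot> s) (\<lambda>i. act k 1 (mat_op_pointed_over V P k 1 \<cdot> t) (z i) 0) j
      = act k 1 (mat_op_pointed_over V P k 1 \<cdot> t) (\<lambda>b. act n m (h \<cdot> s) (\<lambda>i. z i b) j) 0"
    if "s \<in> homs V W' W" "t \<in> homs V W' (ptd k 1)"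
      "\<And>i b. \<lbrakk>i < n; b < k\<rbrakk> \<Longrightarrow> z i b \<in> homs V W' U" "j < m" for W' s k t z j
    using com that unfolding commutes_with_def homs_Dom[OF h] by blast
  let ?a = "\<lambda>j i. act n m h (\<lambda>i'. gdelta V P W i' i) j"
  have a: "?a j i \<in> homs V W U" if "j < m" for j i by (rule act_homs[OF h gdelta_homs[OF W] that])
  \<comment> \<open>The module operation with coefficients \<open>z\<close> and constant \<open>0\<close> sends the unit vectors to \<open>z\<close>.\<close>
  have matrix: "act n m (h \<cdot> s) z j = gsum V P W' n (\<lambda>i. gmul V P (?a j i \<cdot> s) (z i))"
    if s: "s \<in> homs V W' W" and z: "\<And>i. i < n \<Longrightarrow> z i \<in> homs V W' U" and j: "j < m" for W' s z j
  proof -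
    note W' = homs_Obj(1)[OF s]
    have "\<exists>t \<in> homs V W' (ptd n 1). \<forall>j' < 1. \<forall>i < 1 + n. ptd_entry n 1 t j' i
        = (case i of 0 \<Rightarrow> gzero V P W' | Suc i' \<Rightarrow> z i')"
      by (rule ptd_of_entries[OF W']) (auto split: nat.splits intro: gzero_homs[OF W'] z)
    then obtain t where t: "t \<in> homs V W' (ptd n 1)"
      and tz: "\<And>j' i. \<lbrakk>j' < 1; i < 1 + n\<rbrakk> \<Longrightarrow> ptd_entry n 1 t j' i = (case i of 0 \<Rightarrow> gzero V P W' | Suc i' \<Rightarrow> z i')"
      by blast
    have T: "act n 1 (mat_op_pointed_over V P n 1 \<cdot> t) w 0 = gsum V P W' n (\<lambda>i. gmul V P (w i) (z i))"
      if w: "\<And>i. i < n \<Longrightarrow> w i \<in> homs V W' U" for w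
    proof -
      have "act n 1 (mat_op_pointed_over V P n 1 \<cdot> t) w 0
        = gadd V P (ptd_entry n 1 t 0 0) (gsum V P W' n (\<lambda>i. gmul V P (w i) (ptd_entry n 1 t 0 (Suc i))))"
        by (rule act_mat_op_pointed_over[OF t w]) simp_all
      also have "ptd_entry n 1 t 0 0 = gzero V P W'" using tz[of 0 0] by simp
      also have "gsum V P W' n (\<lambda>i. gmul V P (w i) (ptd_entry n 1 t 0 (Suc i)))
        = gsum V P W' n (\<lambda>i. gmul V P (w i) (z i))"
        by (rule gsum_cong) (use tz[of 0 "Suc _"] in simp)
      also have "gadd V P (gzero V P W') \<dots> = \<dots>"
        by (rule gadd_gzero(2)) (intro gsum_homs gmul_homs w z W')
      finally show ?thesis .
    qed
    have "act n m (h \<cdot> s) z j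
      = act n m (h \<cdot> s) (\<lambda>i. act n 1 (mat_op_pointed_over V P n 1 \<cdot> t) (\<lambda>b. gdelta V P W' i b) 0) j"
    proof (rule act_cong)
      fix i assume i: "i < n"
      have "act n 1 (mat_op_pointed_over V P n 1 \<cdot> t) (\<lambda>b. gdelta V P W' i b) 0
        = gsum V P W' n (\<lambda>b. gmul V P (gdelta V P W' i b) (z b))"
        by (rule T) (rule gdelta_homs[OF W'])
      also have "\<dots> = z i" by (rule gsum_delta(1)[OF W' z i])
      finally show "z i = act n 1 (mat_op_pointed_over V P n 1 \<cdot> t) (\<lambda>b. gdelta V P W' i b) 0" ..
    qed
    also have "\<dots> = act n 1 (mat_op_pointed_over V P n 1 \<cdot> t)
        (\<lambda>b. act n m (h \<cdot> s) (\<lambda>i. gdelta V P W' i b) j) 0"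
      by (rule com[OF s t gdelta_homs[OF W'] j])
    also have "\<dots> = gsum V P W' n (\<lambda>b. gmul V P (act n m (h \<cdot> s) (\<lambda>i. gdelta V P W' i b) j) (z b))"
      by (rule T) (rule act_homs[OF Cmp_homs[OF s h] gdelta_homs[OF W'] j])
    also have "\<dots> = gsum V P W' n (\<lambda>i. gmul V P (?a j i \<cdot> s) (z i))"
    proof (rule gsum_cong)
      fix b assume "b < n"
      have "?a j b \<cdot> s = act n m (h \<cdot> s) (\<lambda>i. gdelta V P W i b \<cdot> s) j"
        by (rule act_Cmp[OF h gdelta_homs[OF W] j s])
      then show "gmul V P (act n m (h \<cdot> s) (\<lambda>i. gdelta V P W' i b) j) (z b) = gmul V P (?a j b \<cdot> s) (z b)"
        by (simp only: gdelta_Cmp[OF s])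
    qed
    finally show ?thesis .
  qed
  have row: "gsum V P W n (?a j) = gone V P W" if j: "j < m" for j
  proof -
    interpret Q: semiring "hom_ring V W P" by (rule semiring_hom_ring[OF W])
    note I = Idn_homs[OF W]
    \<comment> \<open>Commutation with the nullary operation \<open>1\<close>, whose value is the point.\<close>
    have "\<exists>t \<in> homs V W (ptd 0 1). \<forall>j' < 1. \<forall>i < 1 + 0. ptd_entry 0 1 t j' i = gone V P W"
      by (rule ptd_of_entries[OF W gone_homs[OF W]])
    then obtain t where t: "t \<in> homs V W (ptd 0 1)"
      and te: "\<And>j' i. \<lbrakk>j' < 1; i < 1 + 0\<rbrakk> \<Longrightarrow> ptd_entry 0 1 t j' i = gone V P W"
      by blast
    have T: "act 0 1 (mat_op_pointed_over V P 0 1 \<cdot> t) w 0 = gone V P W" for w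
      using act_mat_op_pointed_over[OF t, of w 0] te[of 0 0] gadd_gzero(1)[OF gone_homs[OF W]] by simp
    have "gsum V P W n (?a j) = gsum V P W n (\<lambda>i. gmul V P (?a j i \<cdot> Idn V W) (gone V P W))"
      by (rule gsum_cong) (use Q.r_one[unfolded hom_ring_simps, OF a[OF j]] Cmp_Idn[OF a[OF j]] in simp)
    also have "\<dots> = act n m (h \<cdot> Idn V W) (\<lambda>_. gone V P W) j"
      by (rule matrix[OF I gone_homs[OF W] j, symmetric])
    also have "\<dots> = gone V P W"
      using com[where z = "\<lambda>_ _. gone V P W", OF I t _ j] T by simp
    finally show ?thesis .
  qed
  have "\<exists>x \<in> homs V W (aff n m). \<forall>j < m. \<forall>i < n. aff_entry n m x j i = ?a j i"
    by (rule aff_of_entries[OF W a row])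
  then obtain x where x: "x \<in> homs V W (aff n m)"
    and xa: "\<And>j i. \<lbrakk>j < m; i < n\<rbrakk> \<Longrightarrow> aff_entry n m x j i = ?a j i"
    by blast
  have "mat_aff_over V P n m \<cdot> x = h"
  proof (rule act_eqI[OF Cmp_homs[OF x mat_aff_over_homs] h])
    fix W' s z j assume s: "s \<in> homs V W' W" and z: "\<And>i. i < n \<Longrightarrow> z i \<in> homs V W' U" and j: "j < m"
    have "act n m ((mat_aff_over V P n m \<cdot> x) \<cdot> s) z j
      = gsum V P W' n (\<lambda>i. gmul V P (aff_entry n m (x \<cdot> s) j i) (z i))"
      by (rule aff_entries_at[OF x s z j])
    also have "\<dots> = gsum V P W' n (\<lambda>i. gmul V P (?a j i \<cdot> s) (z i))"
      by (rule gsum_cong) (simp only: aff_entry_Cmp[OF x j _ s, symmetric] xa[OF j])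
    also have "\<dots> = act n m (h \<cdot> s) z j" by (rule matrix[OF s z j, symmetric])
    finally show "act n m ((mat_aff_over V P n m \<cdot> x) \<cdot> s) z j = act n m (h \<cdot> s) z j" .
  qed
  with x show ?thesis by (rule that)
qed

lemma mat_aff_iso_commutant:
  "iso_over V U (mat_aff V P, mat_aff_over V P)
    (commutant V U (mat_op_pointed V P) (mat_op_pointed_over V P),
     commutant_forget V U (mat_op_pointed V P) (mat_op_pointed_over V P))"
proof (rule commutant_of_operations.iso_over_commutant, intro commutant_of_operations.intro
    ccc_object_axioms mat_aff_operation_theory mat_op_pointed_operation_theory
    commutant_of_operations_axioms.intro)
  fix h W n m assume h: "h \<in> homs V W (operations n m)"
  show "commutes_with (mat_op_pointed V P) (mat_op_pointed_over V P) n m h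
    \<longleftrightarrow> (\<exists>x \<in> homs V W (aff n m). mat_aff_over V P n m \<cdot> x = h)"
    using mat_aff_commutes_with_pointed commutes_with_pointed_imp_affine[OF h] by metis
qed

end

section \<open>Positive parts of strong preordered rings\<close>

locale archimedean_stages = cartesian_closed V for V :: "('o, 'a) ccc" (structure) +
  fixes R Rp :: "('o, 'a) rig" and \<iota> :: 'a and \<G> :: "'o set"
  assumes has_eq: "has_equalizers V"
    and strong: "is_strong_preordered_ring V R Rp \<iota>"
    and generating: "is_generating_class V \<G>"
    and arch: "G \<in> \<G> \<Longrightarrow> firmly_archimedean (hom_ring V G R) (hom_pos V G R \<iota>)"
    and dyadic: "G \<in> \<G> \<Longrightarrow> preordered_dyadic_algebra (hom_ring V G R) (hom_pos V G R \<iota>)"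
begin

sublocale R: rig_object V R
  by unfold_locales
    (use strong in \<open>simp add: is_strong_preordered_ring_def is_preordered_ring_def is_ring_def\<close>)

lemma \<iota>_homs: "\<iota> \<in> homs V (Rob Rp) (Rob R)"
  using strong by (simp add: is_strong_preordered_ring_def is_preordered_ring_def is_rig_morphism_def)

lemma \<iota>_el: "x \<in> homs V W (Rob Rp) \<Longrightarrow> \<iota> \<cdot> x \<in> homs V W (Rob R)"
  by (rule Cmp_homs[OF _ \<iota>_homs])

lemma \<iota>_mono: "\<lbrakk>x \<in> homs V W (Rob Rp); y \<in> homs V W (Rob Rp); \<iota> \<cdot> x = \<iota> \<cdot> y\<rbrakk> \<Longrightarrow> x = y"
  using strong \<iota>_homs
  unfolding is_strong_preordered_ring_def is_preordered_ring_def is_mono_def homs_Dom[OF \<iota>_homs] by blast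

lemma \<iota>_morphism:
  "\<lbrakk>x \<in> homs V W (Rob Rp); y \<in> homs V W (Rob Rp)\<rbrakk> \<Longrightarrow> \<iota> \<cdot> gadd V Rp x y = gadd V R (\<iota> \<cdot> x) (\<iota> \<cdot> y)"
  "\<lbrakk>x \<in> homs V W (Rob Rp); y \<in> homs V W (Rob Rp)\<rbrakk> \<Longrightarrow> \<iota> \<cdot> gmul V Rp x y = gmul V R (\<iota> \<cdot> x) (\<iota> \<cdot> y)"
  "\<iota> \<cdot> Rzero Rp = Rzero R" "\<iota> \<cdot> Rone Rp = Rone R"
  using strong
  unfolding is_strong_preordered_ring_def is_preordered_ring_def is_rig_morphism_def by blast+

lemma ring_difference:
  assumes x: "x \<in> homs V W (Rob R)" and y: "y \<in> homs V W (Rob R)"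
  obtains d where "d \<in> homs V W (Rob R)" "gadd V R y d = x"
proof -
  interpret Q: semiring "hom_ring V W R" by (rule R.semiring_hom_ring[OF homs_Obj(1)[OF x]])
  obtain neg where neg: "neg \<in> homs V (Rob R) (Rob R)"
    and z: "\<And>W x. x \<in> homs V W (Rob R) \<Longrightarrow> gadd V R x (neg \<cdot> x) = gzero V R W"
    using strong unfolding is_strong_preordered_ring_def is_preordered_ring_def is_ring_def by blast
  note ny = Cmp_homs[OF y neg]
  have "gadd V R y (gadd V R (neg \<cdot> y) x) = gadd V R (gadd V R y (neg \<cdot> y)) x"
    using Q.a_assoc[of y "neg \<cdot> y" x] x y ny by (simp add: hom_ring_simps)
  also have "\<dots> = x" unfolding z[OF y] by (rule R.gadd_gzero(2)[OF x])
  finally show ?thesis using that R.gadd_homs[OF ny x] by blast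
qed

lemma ring_cancel:
  assumes x: "x \<in> homs V W (Rob R)" and y: "y \<in> homs V W (Rob R)" and z: "z \<in> homs V W (Rob R)"
    and eq: "gadd V R x y = gadd V R x z"
  shows "y = z"
proof -
  interpret Q: semiring "hom_ring V W R" by (rule R.semiring_hom_ring[OF homs_Obj(1)[OF x]])
  obtain d where d: "d \<in> homs V W (Rob R)" and xd: "gadd V R x d = gzero V R W"
    by (rule ring_difference[OF R.gzero_homs[OF homs_Obj(1)[OF x]] x])
  have "gadd V R d (gadd V R x w) = w" if w: "w \<in> homs V W (Rob R)" for w
  proof -
    have "gadd V R d (gadd V R x w) = gadd V R (gadd V R d x) w"
      by (rule Q.a_assoc[unfolded hom_ring_simps, OF d x w, symmetric])
    also have "gadd V R d x = gzero V R W" unfolding xd[symmetric]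
      by (rule Q.a_comm[unfolded hom_ring_simps, OF d x])
    also have "gadd V R (gzero V R W) w = w" by (rule R.gadd_gzero(2)[OF w])
    finally show ?thesis .
  qed
  then show ?thesis using y z eq by metis
qed

sublocale cancellative_rig V Rp
proof unfold_locales
  show rig: "is_rig V Rp"
    using strong by (simp add: is_strong_preordered_ring_def is_preordered_ring_def)
  show "has_equalizers V" by (rule has_eq)
  fix x y z W assume x: "x \<in> homs V W (Rob Rp)" and y: "y \<in> homs V W (Rob Rp)" and z: "z \<in> homs V W (Rob Rp)"
    and "gadd V Rp x y = gadd V Rp x z"
  then have "gadd V R (\<iota> \<cdot> x) (\<iota> \<cdot> y) = gadd V R (\<iota> \<cdot> x) (\<iota> \<cdot> z)"
    by (simp only: \<iota>_morphism(1)[symmetric])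
  then show "y = z"
    by (rule \<iota>_mono[OF y z ring_cancel[OF \<iota>_el[OF x] \<iota>_el[OF y] \<iota>_el[OF z]]])
qed

lemma \<iota>_gzero:
  assumes W: "W \<in> Obj V"
  shows "\<iota> \<cdot> gzero V Rp W = gzero V R W"
  unfolding gzero_def Cmp_at_stage[OF W rig_homs(3) \<iota>_homs] \<iota>_morphism(3) ..

lemma \<iota>_gone:
  assumes W: "W \<in> Obj V"
  shows "\<iota> \<cdot> gone V Rp W = gone V R W"
  unfolding gone_def Cmp_at_stage[OF W rig_homs(4) \<iota>_homs] \<iota>_morphism(4) ..

lemma \<iota>_gsum:
  assumes W: "W \<in> Obj V" and f: "\<And>i. i < n \<Longrightarrow> f i \<in> homs V W U"
  shows "\<iota> \<cdot> gsum V Rp W n f = gsum V R W n (\<lambda>i. \<iota> \<cdot> f i)"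
  using f
proof (induction n)
  case 0
  show ?case by (simp add: \<iota>_gzero[OF W])
next
  case (Suc n)
  have "gsum V Rp W n f \<in> homs V W U" by (rule gsum_homs[OF W]) (use Suc.prems in auto)
  then show ?case using Suc by (simp add: \<iota>_morphism(1))
qed

lemma hom_pos_iff: "f \<in> hom_pos V W R \<iota> \<longleftrightarrow> (\<exists>u \<in> homs V W U. f = \<iota> \<cdot> u)"
proof
  assume "f \<in> hom_pos V W R \<iota>"
  then have "f \<in> homs V W (Rob R)" "factors_through V f \<iota>" by (simp_all add: hom_pos_def)
  then show "\<exists>u \<in> homs V W U. f = \<iota> \<cdot> u"
    unfolding factors_through_def homs_Dom[OF \<iota>_homs] by (auto simp: homs_Dom)
next
  assume "\<exists>u \<in> homs V W U. f = \<iota> \<cdot> u"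
  then obtain u where u: "u \<in> homs V W U" "f = \<iota> \<cdot> u" by blast
  then show "f \<in> hom_pos V W R \<iota>"
    unfolding hom_pos_def factors_through_def homs_Dom[OF \<iota>_homs]
    using \<iota>_el[OF u(1)] homs_Dom[OF \<iota>_el[OF u(1)]] by auto
qed

lemma factor_\<iota>: "u \<in> homs V W U \<Longrightarrow> factor V \<iota> (\<iota> \<cdot> u) = u"
  by (rule factor_eq[OF \<iota>_homs _ refl]) (auto intro: \<iota>_mono)

text \<open>Positivity can be tested on the generating class: the pullback of the positive part along an
  element that is positive at every generating stage is an epimorphism, against which the strong
  monomorphism \<open>\<iota>\<close> lifts.\<close>

lemma positive_if_positive_at_generators:
  assumes r: "r \<in> homs V W (Rob R)"
    and pos: "\<And>G s. \<lbrakk>G \<in> \<G>; s \<in> homs V G W\<rbrakk> \<Longrightarrow> r \<cdot> s \<in> hom_pos V G R \<iota>"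
  obtains u where "u \<in> homs V W U" "\<iota> \<cdot> u = r"
proof -
  note O = homs_Obj(1)[OF r] X
  let ?p = "Prj V [W, U] 0" and ?q = "Prj V [W, U] 1"
  note p = Prj2_homs(1)[OF O] and q = Prj2_homs(2)[OF O]
  note rp = Cmp_homs[OF p r] and iq = Cmp_homs[OF q \<iota>_homs]
  obtain e where e: "is_equalizer V (r \<cdot> ?p) (\<iota> \<cdot> ?q) e"
    using has_eq rp iq unfolding has_equalizers_def by blast
  define S where "S = Dom V e"
  have eh: "e \<in> homs V S (Prd V [W, U])"
    using e unfolding is_equalizer_def S_def by (simp add: homs_def homs_Dom[OF rp])
  have ee: "(r \<cdot> ?p) \<cdot> e = (\<iota> \<cdot> ?q) \<cdot> e" using e unfolding is_equalizer_def by blast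
  have lift: "\<exists>h \<in> homs V G S. e \<cdot> h = x" if "x \<in> homs V G (Prd V [W, U])" "(r \<cdot> ?p) \<cdot> x = (\<iota> \<cdot> ?q) \<cdot> x" for G x
    using e that unfolding is_equalizer_def S_def homs_Dom[OF rp] by blast
  let ?m = "?p \<cdot> e" and ?u = "?q \<cdot> e"
  note m = Cmp_homs[OF eh p] and u = Cmp_homs[OF eh q]
  have mu: "\<iota> \<cdot> ?u = r \<cdot> ?m" using ee by (simp only: Cmp_assoc[OF eh p r] Cmp_assoc[OF eh q \<iota>_homs])
  have "x = y" if x: "x \<in> homs V W Z" and y: "y \<in> homs V W Z" and eq: "x \<cdot> ?m = y \<cdot> ?m" for Z x y
  proof -
    have "x \<cdot> s = y \<cdot> s" if G: "G \<in> \<G>" and s: "s \<in> homs V G W" for G s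
    proof -
      obtain v where v: "v \<in> homs V G U" and rs: "r \<cdot> s = \<iota> \<cdot> v"
        using pos[OF G s] unfolding hom_pos_iff by blast
      note sv = pair_homs[OF s v]
      have "(r \<cdot> ?p) \<cdot> pair V s v = (\<iota> \<cdot> ?q) \<cdot> pair V s v"
        unfolding Cmp_assoc[OF sv p r] Cmp_assoc[OF sv q \<iota>_homs] Prj_pair[OF s v] by (rule rs)
      then obtain h where h: "h \<in> homs V G S" and eh': "e \<cdot> h = pair V s v" using lift[OF sv] by blast
      have "?m \<cdot> h = s" unfolding Cmp_assoc[OF h eh p] eh' by (rule Prj_pair(1)[OF s v])
      then show ?thesis
        using eq Cmp_assoc[OF h m x] Cmp_assoc[OF h m y] by simp
    qed
    then show ?thesis using generating x y unfolding is_generating_class_def by blast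
  qed
  then have epi: "is_epi V ?m"
    unfolding is_epi_def homs_Cod[OF m] using homs_Arr[OF m] by blast
  have strong_lift: "\<exists>d \<in> homs V (Cod V q) (Dom V \<iota>). d \<cdot> q = v \<and> \<iota> \<cdot> d = w"
    if "is_epi V q" "v \<in> homs V (Dom V q) (Dom V \<iota>)" "w \<in> homs V (Cod V q) (Cod V \<iota>)" "\<iota> \<cdot> v = w \<cdot> q"
    for q v w
    using strong that unfolding is_strong_preordered_ring_def is_strong_mono_def by blast
  have "\<exists>d \<in> homs V W U. d \<cdot> ?m = ?u \<and> \<iota> \<cdot> d = r"
    by (rule strong_lift[OF epi, unfolded homs_Dom[OF m] homs_Cod[OF m] homs_Dom[OF \<iota>_homs]
          homs_Cod[OF \<iota>_homs], OF u r mu])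
  then show ?thesis using that by blast
qed

text \<open>At a stage in the generating class the elements of \<open>U\<close> are identified by \<open>\<iota>\<close> with the positive
  elements of a firmly archimedean ring, and each coordinate of \<open>h\<close> with an affine map on its positive
  cone.\<close>

lemma affine_operation_at_generator:
  assumes G: "G \<in> \<G>" and h: "h \<in> homs V G (operations n m)" and j: "j < m"
    and com: "commutes_with (mat_aff V Rp) (mat_aff_over V Rp) n m h"
  shows affine_operation_expansion: "(\<And>i. i < n \<Longrightarrow> z i \<in> homs V G U) \<Longrightarrow>
      \<iota> \<cdot> act n m h z j = gadd V R (\<iota> \<cdot> act n m h (\<lambda>_. gzero V Rp G) j)
        (gsum V R G n (\<lambda>i. gmul V R (\<iota> \<cdot> z i)
          (a_minus (hom_ring V G R) (\<iota> \<cdot> act n m h (gdelta V Rp G i) j) (\<iota> \<cdot> act n m h (\<lambda>_. gzero V Rp G) j))))"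
    and affine_operation_slope: "i < n \<Longrightarrow>
      a_minus (hom_ring V G R) (\<iota> \<cdot> act n m h (gdelta V Rp G i) j) (\<iota> \<cdot> act n m h (\<lambda>_. gzero V Rp G) j)
        \<in> hom_pos V G R \<iota>"
proof -
  note W = homs_Obj(1)[OF h]
  let ?Q = "hom_ring V G R" and ?Qp = "hom_pos V G R \<iota>"
  have pre: "set_preordered_ring ?Q ?Qp" using dyadic[OF G] by (simp add: preordered_dyadic_algebra_def)
  then interpret Q: ring ?Q by (simp add: set_preordered_ring_def)
  define g where "g x = \<iota> \<cdot> act n m h (\<lambda>i. factor V \<iota> (x i)) j" for x
  have g\<iota>: "g x = \<iota> \<cdot> act n m h z j" if "\<And>i. i < n \<Longrightarrow> x i = \<iota> \<cdot> z i" "\<And>i. i < n \<Longrightarrow> z i \<in> homs V G U" for x z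
    unfolding g_def by (rule arg_cong, rule act_cong) (simp only: that(1) factor_\<iota>[OF that(2)])
  have fac: "factor V \<iota> x \<in> homs V G U \<and> \<iota> \<cdot> factor V \<iota> x = x" if "x \<in> ?Qp" for x
    using that factor_\<iota> unfolding hom_pos_iff by auto
  have g_pos: "g x \<in> ?Qp" if "\<And>i. i < n \<Longrightarrow> x i \<in> ?Qp" for x
  proof -
    have "act n m h (\<lambda>i. factor V \<iota> (x i)) j \<in> homs V G U"
      by (rule act_homs[OF h _ j]) (simp add: fac that)
    then show ?thesis unfolding g_def hom_pos_iff by blast
  qed
  have g_cong: "g x = g y" if "\<And>i. i < n \<Longrightarrow> x i = y i" for x y
    unfolding g_def by (rule arg_cong, rule act_cong) (simp only: that)
  have com': "act n m (h \<cdot> s) (\<lambda>i. act k 1 (mat_aff_over V Rp k 1 \<cdot> t) (z i) 0) j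
      = act k 1 (mat_aff_over V Rp k 1 \<cdot> t) (\<lambda>b. act n m (h \<cdot> s) (\<lambda>i. z i b) j) 0"
    if "s \<in> homs V W' G" "t \<in> homs V W' (aff k 1)"
      "\<And>i b. \<lbrakk>i < n; b < k\<rbrakk> \<Longrightarrow> z i b \<in> homs V W' U" "j < m" for W' s k t z j
    using com that unfolding commutes_with_def homs_Dom[OF h] by blast
  have gsum_fin: "gsum V R G k f = finsum ?Q f {..<k}" if "\<And>i. i < k \<Longrightarrow> f i \<in> homs V G (Rob R)" for k f
    by (rule R.gsum_eq_finsum[OF W that])
  have g_affine: "g (\<lambda>i. finsum ?Q (\<lambda>b. a b \<otimes>\<^bsub>?Q\<^esub> x b i) {..<k}) = finsum ?Q (\<lambda>b. a b \<otimes>\<^bsub>?Q\<^esub> g (x b)) {..<k}"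
    if a: "\<And>b. b < k \<Longrightarrow> a b \<in> ?Qp" and sum: "finsum ?Q a {..<k} = \<one>\<^bsub>?Q\<^esub>"
      and x: "\<And>b i. \<lbrakk>b < k; i < n\<rbrakk> \<Longrightarrow> x b i \<in> ?Qp" for k :: nat and a x
  proof -
    let ?a = "\<lambda>b. factor V \<iota> (a b)" and ?x = "\<lambda>b i. factor V \<iota> (x b i)"
    have a': "?a b \<in> homs V G U" "\<iota> \<cdot> ?a b = a b" if "b < k" for b using fac[OF a[OF that]] by auto
    have x': "?x b i \<in> homs V G U" "\<iota> \<cdot> ?x b i = x b i" if "b < k" "i < n" for b i using fac[OF x[OF that]] by auto
    have aR: "a b \<in> homs V G (Rob R)" if "b < k" for b using \<iota>_el[OF a'(1)[OF that]] a'(2)[OF that] by simp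
    have lin: "\<iota> \<cdot> gsum V Rp G k (\<lambda>b. gmul V Rp (?a b) (w b)) = finsum ?Q (\<lambda>b. a b \<otimes>\<^bsub>?Q\<^esub> (\<iota> \<cdot> w b)) {..<k}"
      if w: "\<And>b. b < k \<Longrightarrow> w b \<in> homs V G U" for w
    proof -
      have "\<iota> \<cdot> gsum V Rp G k (\<lambda>b. gmul V Rp (?a b) (w b)) = gsum V R G k (\<lambda>b. \<iota> \<cdot> gmul V Rp (?a b) (w b))"
        by (rule \<iota>_gsum[OF W]) (intro gmul_homs a' w)
      also have "\<dots> = gsum V R G k (\<lambda>b. gmul V R (a b) (\<iota> \<cdot> w b))"
        by (rule R.gsum_cong) (simp only: \<iota>_morphism(2)[OF a'(1) w] a'(2))
      also have "\<dots> = finsum ?Q (\<lambda>b. gmul V R (a b) (\<iota> \<cdot> w b)) {..<k}"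
        by (rule gsum_fin) (intro R.gmul_homs aR \<iota>_el w)
      finally show ?thesis by (simp only: hom_ring_simps)
    qed
    have sum_homs: "gsum V Rp G k ?a \<in> homs V G U" by (rule gsum_homs[OF W a'(1)])
    have "\<iota> \<cdot> gsum V Rp G k ?a = gsum V R G k (\<lambda>b. \<iota> \<cdot> ?a b)" by (rule \<iota>_gsum[OF W a'(1)])
    also have "\<dots> = gsum V R G k a" by (rule R.gsum_cong) (rule a'(2))
    also have "\<dots> = \<iota> \<cdot> gone V Rp G"
      using gsum_fin[of k a, OF aR] sum \<iota>_gone[OF W] by (simp add: hom_ring_simps)
    finally have sum': "gsum V Rp G k ?a = gone V Rp G"
      by (rule \<iota>_mono[OF sum_homs gone_homs[OF W]])
    have "\<exists>t \<in> homs V G (aff k 1). \<forall>j < 1. \<forall>i < k. aff_entry k 1 t j i = ?a i"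
      by (rule aff_of_entries[OF W a'(1) sum'])
    then obtain t where t: "t \<in> homs V G (aff k 1)"
      and ta: "\<And>j i. \<lbrakk>j < 1; i < k\<rbrakk> \<Longrightarrow> aff_entry k 1 t j i = ?a i"
      by blast
    have T: "act k 1 (mat_aff_over V Rp k 1 \<cdot> t) w 0 = gsum V Rp G k (\<lambda>b. gmul V Rp (?a b) (w b))"
      if w: "\<And>b. b < k \<Longrightarrow> w b \<in> homs V G U" for w
    proof -
      have "act k 1 (mat_aff_over V Rp k 1 \<cdot> t) w 0 = gsum V Rp G k (\<lambda>b. gmul V Rp (aff_entry k 1 t 0 b) (w b))"
        by (rule act_mat_aff_over[OF t w]) simp_all
      also have "\<dots> = gsum V Rp G k (\<lambda>b. gmul V Rp (?a b) (w b))"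
        by (rule gsum_cong) (use ta[of 0] in simp)
      finally show ?thesis .
    qed
    have hI: "h \<cdot> Idn V G = h" by (rule Cmp_Idn[OF h])
    have c: "act n m h (\<lambda>i. act k 1 (mat_aff_over V Rp k 1 \<cdot> t) (\<lambda>b. ?x b i) 0) j
      = act k 1 (mat_aff_over V Rp k 1 \<cdot> t) (\<lambda>b. act n m h (?x b) j) 0"
      using com'[where z = "\<lambda>i b. ?x b i", OF Idn_homs[OF W] t x'(1) j] unfolding hI by simp
    have "g (\<lambda>i. finsum ?Q (\<lambda>b. a b \<otimes>\<^bsub>?Q\<^esub> x b i) {..<k})
      = \<iota> \<cdot> act n m h (\<lambda>i. act k 1 (mat_aff_over V Rp k 1 \<cdot> t) (\<lambda>b. ?x b i) 0) j"
    proof (rule g\<iota>)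
      fix i assume i: "i < n"
      have "\<iota> \<cdot> act k 1 (mat_aff_over V Rp k 1 \<cdot> t) (\<lambda>b. ?x b i) 0
        = finsum ?Q (\<lambda>b. a b \<otimes>\<^bsub>?Q\<^esub> (\<iota> \<cdot> ?x b i)) {..<k}"
        using T[of "\<lambda>b. ?x b i"] lin[of "\<lambda>b. ?x b i"] x'(1)[OF _ i] by simp
      also have "\<dots> = finsum ?Q (\<lambda>b. a b \<otimes>\<^bsub>?Q\<^esub> x b i) {..<k}"
        by (rule Q.finsum_cong')
          (use x'(2)[OF _ i] aR \<iota>_el[OF x'(1)[OF _ i]] in \<open>auto simp: hom_ring_simps intro!: R.gmul_homs\<close>)
      finally show "finsum ?Q (\<lambda>b. a b \<otimes>\<^bsub>?Q\<^esub> x b i) {..<k}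
        = \<iota> \<cdot> act k 1 (mat_aff_over V Rp k 1 \<cdot> t) (\<lambda>b. ?x b i) 0" ..
      show "act k 1 (mat_aff_over V Rp k 1 \<cdot> t) (\<lambda>b. ?x b i) 0 \<in> homs V G U"
        by (rule act_homs[OF Cmp_homs[OF t mat_aff_over_homs] x'(1)[OF _ i]]) simp_all
    qed
    also have "\<dots> = \<iota> \<cdot> gsum V Rp G k (\<lambda>b. gmul V Rp (?a b) (act n m h (?x b) j))"
      unfolding c by (rule arg_cong, rule T) (rule act_homs[OF h x'(1) j])
    also have "\<dots> = finsum ?Q (\<lambda>b. a b \<otimes>\<^bsub>?Q\<^esub> (\<iota> \<cdot> act n m h (?x b) j)) {..<k}"
      by (rule lin) (rule act_homs[OF h x'(1) j])
    finally show ?thesis unfolding g_def .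
  qed
  have g0: "g (\<lambda>_. \<zero>\<^bsub>?Q\<^esub>) = \<iota> \<cdot> act n m h (\<lambda>_. gzero V Rp G) j"
    by (rule g\<iota>) (simp_all add: hom_ring_simps \<iota>_gzero[OF W] gzero_homs[OF W])
  have g\<delta>: "g (\<lambda>i'. if i = i' then \<one>\<^bsub>?Q\<^esub> else \<zero>\<^bsub>?Q\<^esub>) = \<iota> \<cdot> act n m h (gdelta V Rp G i) j" for i
    by (rule g\<iota>) (simp_all add: hom_ring_simps gdelta_def \<iota>_gzero[OF W] \<iota>_gone[OF W] gzero_homs[OF W] gone_homs[OF W])
  show "a_minus ?Q (\<iota> \<cdot> act n m h (gdelta V Rp G i) j) (\<iota> \<cdot> act n m h (\<lambda>_. gzero V Rp G) j) \<in> ?Qp"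
    if i: "i < n"
    unfolding g0[symmetric] g\<delta>[symmetric]
    by (rule affine_map_on_cone_slope[where n = n, OF arch[OF G] dyadic[OF G]])
      (rule g_pos, blast, rule g_cong, blast, rule g_affine, blast, blast, blast, rule i)
  show "\<iota> \<cdot> act n m h z j = gadd V R (\<iota> \<cdot> act n m h (\<lambda>_. gzero V Rp G) j)
      (gsum V R G n (\<lambda>i. gmul V R (\<iota> \<cdot> z i)
        (a_minus ?Q (\<iota> \<cdot> act n m h (gdelta V Rp G i) j) (\<iota> \<cdot> act n m h (\<lambda>_. gzero V Rp G) j))))"
    if z: "\<And>i. i < n \<Longrightarrow> z i \<in> homs V G U"
  proof -
    have zp: "\<iota> \<cdot> z i \<in> ?Qp" if "i < n" for i using z[OF that] unfolding hom_pos_iff by blast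
    let ?d = "\<lambda>i. a_minus ?Q (g (\<lambda>i'. if i = i' then \<one>\<^bsub>?Q\<^esub> else \<zero>\<^bsub>?Q\<^esub>)) (g (\<lambda>_. \<zero>\<^bsub>?Q\<^esub>))"
    have gc: "g x \<in> carrier ?Q" if "\<And>i. i < n \<Longrightarrow> x i \<in> ?Qp" for x
      using g_pos[OF that] by (simp add: hom_pos_def hom_ring_simps)
    have d: "?d i \<in> homs V G (Rob R)" for i
    proof -
      have "?d i \<in> carrier ?Q"
        by (rule Q.minus_closed; rule gc) (use pre in \<open>auto simp: set_preordered_ring_def\<close>)
      then show ?thesis by (simp only: hom_ring_simps)
    qed
    have "\<iota> \<cdot> act n m h z j = g (\<lambda>i. \<iota> \<cdot> z i)" by (rule g\<iota>[symmetric]) (simp_all add: z)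
    also have "\<dots> = g (\<lambda>_. \<zero>\<^bsub>?Q\<^esub>) \<oplus>\<^bsub>?Q\<^esub> finsum ?Q (\<lambda>i. (\<iota> \<cdot> z i) \<otimes>\<^bsub>?Q\<^esub> ?d i) {..<n}"
      by (rule affine_map_on_cone_expansion[where n = n, OF arch[OF G] dyadic[OF G]])
        (rule g_pos, blast, rule g_cong, blast, rule g_affine, blast, blast, blast, rule zp)
    also have "finsum ?Q (\<lambda>i. (\<iota> \<cdot> z i) \<otimes>\<^bsub>?Q\<^esub> ?d i) {..<n} = gsum V R G n (\<lambda>i. gmul V R (\<iota> \<cdot> z i) (?d i))"
      unfolding hom_ring_simps
      by (rule gsum_fin[symmetric, unfolded hom_ring_simps]) (intro R.gmul_homs \<iota>_el z d[unfolded hom_ring_simps])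
    finally show ?thesis 
      unfolding g0[unfolded hom_ring_simps] g\<delta>[unfolded hom_ring_simps] hom_ring_simps .
  qed
qed

lemma commutes_with_Cmp:
  assumes h: "h \<in> homs V W (operations n m)" and com: "commutes_with T A n m h" and r: "r \<in> homs V W' W"
  shows "commutes_with T A n m (h \<cdot> r)"
  unfolding commutes_with_def homs_Dom[OF Cmp_homs[OF r h]]
proof (intro allI impI)
  fix W'' s k t x j
  assume s: "s \<in> homs V W'' W'" and t: "t \<in> homs V W'' (VHom T k 1)"
    and x: "\<forall>i<n. \<forall>a<k. x i a \<in> homs V W'' U" and j: "j < m"
  show "act n m ((h \<cdot> r) \<cdot> s) (\<lambda>i. act k 1 (A k 1 \<cdot> t) (x i) 0) j
    = act k 1 (A k 1 \<cdot> t) (\<lambda>a. act n m ((h \<cdot> r) \<cdot> s) (\<lambda>i. x i a) j) 0"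
    unfolding Cmp_assoc[OF s r h]
    using com Cmp_homs[OF s r] t x j unfolding commutes_with_def homs_Dom[OF h] by blast
qed

text \<open>The constant coefficient is \<open>h 0\<close>. The difference \<open>h e\<^sub>i - h 0\<close> exists in \<open>R\<close> at the given stage,
  is positive at the generating stages by \<open>affine_operation_slope\<close>, and hence lifts to \<open>U\<close>. The resulting
  expansion of \<open>h\<close> is an equation, which may be tested on the generating class.\<close>

lemma commutes_with_affine_imp_pointed:
  assumes h: "h \<in> homs V W (operations n m)"
    and com: "commutes_with (mat_aff V Rp) (mat_aff_over V Rp) n m h"
  obtains x where "x \<in> homs V W (ptd n m)" "mat_op_pointed_over V Rp n m \<cdot> x = h"
proof -
  note W = homs_Obj(1)[OF h]
  let ?o = "\<lambda>j. act n m h (\<lambda>_. gzero V Rp W) j" and ?e = "\<lambda>j i. act n m h (gdelta V Rp W i) j"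
  have o: "?o j \<in> homs V W U" if "j < m" for j by (rule act_homs[OF h gzero_homs[OF W] that])
  have e: "?e j i \<in> homs V W U" if "j < m" for j i by (rule act_homs[OF h gdelta_homs[OF W] that])
  have o_Cmp: "?o j \<cdot> s = act n m (h \<cdot> s) (\<lambda>_. gzero V Rp W') j"
    and e_Cmp: "?e j i \<cdot> s = act n m (h \<cdot> s) (gdelta V Rp W' i) j"
    if s: "s \<in> homs V W' W" and j: "j < m" for W' s j i
    using act_Cmp[where x = "\<lambda>_. gzero V Rp W", OF h gzero_homs[OF W] j s]
      act_Cmp[where x = "gdelta V Rp W i", OF h gdelta_homs[OF W] j s]
    by (simp_all only: gzero_Cmp[OF s] gdelta_Cmp[OF s])
  \<comment> \<open>Restriction of the difference to a generating stage.\<close>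
  have slope: "d \<cdot> s = a_minus (hom_ring V G R) (\<iota> \<cdot> act n m (h \<cdot> s) (gdelta V Rp G i) j)
      (\<iota> \<cdot> act n m (h \<cdot> s) (\<lambda>_. gzero V Rp G) j)"
    if G: "G \<in> \<G>" and s: "s \<in> homs V G W" and j: "j < m" and d: "d \<in> homs V W (Rob R)"
      and sum: "gadd V R (\<iota> \<cdot> ?o j) d = \<iota> \<cdot> ?e j i" for G s j i d
  proof -
    interpret Q: ring "hom_ring V G R"
      using dyadic[OF G] by (simp add: preordered_dyadic_algebra_def set_preordered_ring_def)
    let ?b = "\<iota> \<cdot> act n m (h \<cdot> s) (\<lambda>_. gzero V Rp G) j"
    let ?a = "\<iota> \<cdot> act n m (h \<cdot> s) (gdelta V Rp G i) j"
    have b: "?b = (\<iota> \<cdot> ?o j) \<cdot> s" and a: "?a = (\<iota> \<cdot> ?e j i) \<cdot> s"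
      unfolding Cmp_assoc[OF s o[OF j] \<iota>_homs] Cmp_assoc[OF s e[OF j] \<iota>_homs]
        o_Cmp[OF s j] e_Cmp[OF s j] by (rule refl)+
    have ab: "?a = gadd V R ?b (d \<cdot> s)"
      unfolding a b sum[symmetric] by (rule R.gadd_Cmp[OF \<iota>_el[OF o[OF j]] d s])
    have bR: "?b \<in> homs V G (Rob R)" unfolding b by (rule Cmp_homs[OF s \<iota>_el[OF o[OF j]]])
    note dR = Cmp_homs[OF s d]
    have "(y \<oplus>\<^bsub>hom_ring V G R\<^esub> x) \<ominus>\<^bsub>hom_ring V G R\<^esub> y = x"
      if "x \<in> carrier (hom_ring V G R)" "y \<in> carrier (hom_ring V G R)" for x y
      using that by (simp add: a_minus_def Q.a_ac Q.r_neg Q.r_neg1)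
    from this[unfolded hom_ring_simps, OF dR bR] show ?thesis unfolding ab by simp
  qed
  have "\<exists>u. u \<in> homs V W U \<and> gadd V R (\<iota> \<cdot> ?o j) (\<iota> \<cdot> u) = \<iota> \<cdot> ?e j i"
    if j: "j < m" and i: "i < n" for j i
  proof -
    obtain d where d: "d \<in> homs V W (Rob R)" and sum: "gadd V R (\<iota> \<cdot> ?o j) d = \<iota> \<cdot> ?e j i"
      by (rule ring_difference[OF \<iota>_el[OF e[OF j]] \<iota>_el[OF o[OF j]]])
    have pos: "d \<cdot> s \<in> hom_pos V G R \<iota>" if G: "G \<in> \<G>" and s: "s \<in> homs V G W" for G s
      unfolding slope[OF G s j d sum]
      by (rule affine_operation_slope[OF G Cmp_homs[OF s h] j commutes_with_Cmp[OF h com s] i])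
    obtain u where u: "u \<in> homs V W U" and du: "\<iota> \<cdot> u = d"
      by (rule positive_if_positive_at_generators[OF d pos])
    from u sum[folded du] show ?thesis by blast
  qed
  then obtain u where u: "\<And>j i. \<lbrakk>j < m; i < n\<rbrakk> \<Longrightarrow> u j i \<in> homs V W U"
    and u_sum: "\<And>j i. \<lbrakk>j < m; i < n\<rbrakk> \<Longrightarrow> gadd V R (\<iota> \<cdot> ?o j) (\<iota> \<cdot> u j i) = \<iota> \<cdot> ?e j i"
    by metis
  have expansion: "act n m (h \<cdot> s) z j
      = gadd V Rp (?o j \<cdot> s) (gsum V Rp W' n (\<lambda>i. gmul V Rp (z i) (u j i \<cdot> s)))"
    (is "?l = ?r")
    if s: "s \<in> homs V W' W" and z: "\<And>i. i < n \<Longrightarrow> z i \<in> homs V W' U" and j: "j < m" for W' s z j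
  proof -
    note W' = homs_Obj(1)[OF s] and hs = Cmp_homs[OF s h] and os = Cmp_homs[OF s o[OF j]]
    have us: "u j i \<cdot> s \<in> homs V W' U" if "i < n" for i by (rule Cmp_homs[OF s u[OF j that]])
    have sum: "gsum V Rp W' n (\<lambda>i. gmul V Rp (z i) (u j i \<cdot> s)) \<in> homs V W' U"
      by (intro gsum_homs gmul_homs W' z us)
    have l: "?l \<in> homs V W' U" by (rule act_homs[OF hs z j])
    have r: "?r \<in> homs V W' U" by (rule gadd_homs[OF os sum])
    have "?l \<cdot> q = ?r \<cdot> q" if G: "G \<in> \<G>" and q: "q \<in> homs V G W'" for G q
    proof (rule \<iota>_mono[OF Cmp_homs[OF q l] Cmp_homs[OF q r]])
      note sq = Cmp_homs[OF q s] and O = homs_Obj(1)[OF q]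
      note hsq = Cmp_homs[OF sq h]
      let ?z = "\<lambda>i. z i \<cdot> q"
      have zq: "?z i \<in> homs V G U" if "i < n" for i by (rule Cmp_homs[OF q z[OF that]])
      have usq: "u j i \<cdot> s \<cdot> q \<in> homs V G U" if "i < n" for i by (rule Cmp_homs[OF sq u[OF j that]])
      let ?d = "\<lambda>i. a_minus (hom_ring V G R) (\<iota> \<cdot> act n m (h \<cdot> s \<cdot> q) (gdelta V Rp G i) j)
        (\<iota> \<cdot> act n m (h \<cdot> s \<cdot> q) (\<lambda>_. gzero V Rp G) j)"
      have du: "?d i = \<iota> \<cdot> u j i \<cdot> s \<cdot> q" if i: "i < n" for i
        unfolding slope[OF G sq j \<iota>_el[OF u[OF j i]] u_sum[OF j i], symmetric]
        by (rule Cmp_assoc[OF sq u[OF j i] \<iota>_homs])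
      have "?l \<cdot> q = act n m (h \<cdot> s \<cdot> q) ?z j"
        using act_Cmp[OF hs z j q] by (simp only: Cmp_assoc[OF q s h])
      then have "\<iota> \<cdot> ?l \<cdot> q = gadd V R (\<iota> \<cdot> act n m (h \<cdot> s \<cdot> q) (\<lambda>_. gzero V Rp G) j)
          (gsum V R G n (\<lambda>i. gmul V R (\<iota> \<cdot> ?z i) (?d i)))"
        using affine_operation_expansion[where z = ?z, OF G hsq j commutes_with_Cmp[OF h com sq] zq] by simp
      also have "gsum V R G n (\<lambda>i. gmul V R (\<iota> \<cdot> ?z i) (?d i))
        = gsum V R G n (\<lambda>i. \<iota> \<cdot> gmul V Rp (?z i) (u j i \<cdot> s \<cdot> q))"
        by (rule R.gsum_cong) (simp only: du \<iota>_morphism(2)[OF zq usq])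
      also have "\<dots> = \<iota> \<cdot> gsum V Rp G n (\<lambda>i. gmul V Rp (?z i) (u j i \<cdot> s \<cdot> q))"
        by (rule \<iota>_gsum[OF O, symmetric]) (rule gmul_homs[OF zq usq])
      also have "gsum V Rp G n (\<lambda>i. gmul V Rp (?z i) (u j i \<cdot> s \<cdot> q))
        = gsum V Rp G n (\<lambda>i. gmul V Rp (z i) (u j i \<cdot> s) \<cdot> q)"
        by (rule gsum_cong) (simp only: gmul_Cmp[OF z us q] Cmp_assoc[OF q s u[OF j]])
      also have "\<dots> = gsum V Rp W' n (\<lambda>i. gmul V Rp (z i) (u j i \<cdot> s)) \<cdot> q"
        by (rule gsum_Cmp[OF q, symmetric]) (rule gmul_homs[OF z us])
      also have "act n m (h \<cdot> s \<cdot> q) (\<lambda>_. gzero V Rp G) j = (?o j \<cdot> s) \<cdot> q"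
        unfolding o_Cmp[OF sq j, symmetric] by (rule Cmp_assoc[OF q s o[OF j], symmetric])
      also have "gadd V R (\<iota> \<cdot> (?o j \<cdot> s) \<cdot> q) (\<iota> \<cdot> gsum V Rp W' n (\<lambda>i. gmul V Rp (z i) (u j i \<cdot> s)) \<cdot> q)
        = \<iota> \<cdot> ?r \<cdot> q"
        unfolding gadd_Cmp[OF os sum q]
        by (rule \<iota>_morphism(1)[OF Cmp_homs[OF q os] Cmp_homs[OF q sum], symmetric])
      finally show "\<iota> \<cdot> ?l \<cdot> q = \<iota> \<cdot> ?r \<cdot> q" .
    qed
    then show ?thesis using generating l r unfolding is_generating_class_def by blast
  qed
  have "\<exists>x \<in> homs V W (ptd n m). \<forall>j < m. \<forall>i < 1 + n. ptd_entry n m x j i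
      = (case i of 0 \<Rightarrow> ?o j | Suc i' \<Rightarrow> u j i')"
    by (rule ptd_of_entries[OF W]) (auto split: nat.splits intro: o u)
  then obtain x where x: "x \<in> homs V W (ptd n m)"
    and xe: "\<And>j i. \<lbrakk>j < m; i < 1 + n\<rbrakk> \<Longrightarrow> ptd_entry n m x j i = (case i of 0 \<Rightarrow> ?o j | Suc i' \<Rightarrow> u j i')"
    by blast
  have "mat_op_pointed_over V Rp n m \<cdot> x = h"
  proof (rule act_eqI[OF Cmp_homs[OF x mat_op_pointed_over_homs] h])
    fix W' s z j assume s: "s \<in> homs V W' W" and z: "\<And>i. i < n \<Longrightarrow> z i \<in> homs V W' U" and j: "j < m"
    have x0: "ptd_entry n m (x \<cdot> s) j 0 = ?o j \<cdot> s"
      using ptd_entry_Cmp[OF x j _ s, of 0] xe[OF j, of 0] by simp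
    have xS: "ptd_entry n m (x \<cdot> s) j (Suc i) = u j i \<cdot> s" if "i < n" for i
      using ptd_entry_Cmp[OF x j _ s, of "Suc i"] xe[OF j, of "Suc i"] that by simp
    have "act n m ((mat_op_pointed_over V Rp n m \<cdot> x) \<cdot> s) z j
      = gadd V Rp (ptd_entry n m (x \<cdot> s) j 0)
          (gsum V Rp W' n (\<lambda>i. gmul V Rp (z i) (ptd_entry n m (x \<cdot> s) j (Suc i))))"
      by (rule ptd_entries_at[OF x s z j])
    also have "gsum V Rp W' n (\<lambda>i. gmul V Rp (z i) (ptd_entry n m (x \<cdot> s) j (Suc i)))
      = gsum V Rp W' n (\<lambda>i. gmul V Rp (z i) (u j i \<cdot> s))"
      by (rule gsum_cong) (simp only: xS)
    also have "gadd V Rp (ptd_entry n m (x \<cdot> s) j 0) \<dots> = act n m (h \<cdot> s) z j"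
      unfolding x0 by (rule expansion[OF s z j, symmetric])
    finally show "act n m ((mat_op_pointed_over V Rp n m \<cdot> x) \<cdot> s) z j = act n m (h \<cdot> s) z j" .
  qed
  with x show ?thesis by (rule that)
qed

lemma mat_op_pointed_iso_commutant:
  "iso_over V U (mat_op_pointed V Rp, mat_op_pointed_over V Rp)
    (commutant V U (mat_aff V Rp) (mat_aff_over V Rp), commutant_forget V U (mat_aff V Rp) (mat_aff_over V Rp))"
proof (rule commutant_of_operations.iso_over_commutant, intro commutant_of_operations.intro
    ccc_object_axioms mat_aff_operation_theory mat_op_pointed_operation_theory
    commutant_of_operations_axioms.intro)
  fix h W n m assume h: "h \<in> homs V W (operations n m)"
  show "commutes_with (mat_aff V Rp) (mat_aff_over V Rp) n m h
    \<longleftrightarrow> (\<exists>x \<in> homs V W (ptd n m). mat_op_pointed_over V Rp n m \<cdot> x = h)"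
    using mat_op_pointed_commutes_with_aff commutes_with_affine_imp_pointed[OF h] by metis
qed

end

theorem theorem10p6:
  fixes V :: "('o, 'a) ccc"
    and R Rp :: "('o, 'a) rig"
    and \<iota> :: 'a
    and \<G> :: "'o set"
  assumes "cartesian_closed V"
    and "has_equalizers V"
    and "has_countable_colimits V"
    and "has_countable_strong_intersections V"
    and "is_strong_preordered_ring V R Rp \<iota>"
    and "is_generating_class V \<G>"
    and "\<And>W. W \<in> \<G> \<Longrightarrow>
      firmly_archimedean (hom_ring V W R) (hom_pos V W R \<iota>) \<and>
      preordered_dyadic_algebra (hom_ring V W R) (hom_pos V W R \<iota>)"
  shows "are_mutual_commutants V (Rob Rp)
    (mat_aff V Rp, mat_aff_over V Rp)
    (mat_op_pointed V Rp, mat_op_pointed_over V Rp)"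
proof -
  interpret archimedean_stages V R Rp \<iota> \<G>
    using assms by (simp add: archimedean_stages_def archimedean_stages_axioms_def)
  show ?thesis
    unfolding are_mutual_commutants_def fst_conv snd_conv
    using mat_aff_iso_commutant mat_op_pointed_iso_commutant by blast
qed

end
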